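(* Let $d\ge1$, $0<\theta<1$, and let $\phi\colon\mathbb{D}^d\to\mathbb{D}^d$ be the multi-lens map with parameter $\theta$, i.e. $\phi(z_1,\ldots,z_d)=(\lambda_\theta(z_1),\ldots,\lambda_\theta(z_d))$. Then the composition operator $C_\phi\colon H^2(\mathbb{D}^d)\to H^2(\mathbb{D}^d)$, $C_\phi f=f\circ\phi$, satisfies, for positive constants $a,b,a',b'$ depending only on $\theta$ and $d$, $$a'\,e^{-b' n^{1/(2d)}}\le a_n(C_\phi)\le a\,e^{-b\,n^{1/(2d+1)}}\qquad(n\ge1).$$ In particular $\gamma_d^{-}(C_\phi)=0$, although $C_\phi$ belongs to every Schatten class $S_p$, $p>0$.
   Context: $\mathbb{D}$ is the open unit disk and $\mathbb{D}^d$ the unit polydisk. For $0<\theta<1$ the lens map is $\lambda_\theta(z)=\frac{(1+z)^\theta-(1-z)^\theta}{(1+z)^\theta+(1-z)^\theta}$, $z\in\mathbb{D}$ (principal branches of the powers). $H^2(\mathbb{D}^d)$ is the Hilbert space of holomorphic $f$ on $\mathbb{D}^d$ with $\|f\|^2=\sup_{0<r<1}\int_{\mathbb{T}^d}|f(r\xi)|^2\,dm(\xi)<\infty$, $m$ the normalized Haar measure on the torus $\mathbb{T}^d$. The approximation numbers of a bounded operator $T$ on a Hilbert space are $a_n(T)=\inf\{\|T-R\|:\operatorname{rank}R<n\}$; $\gamma_d^{-}(T)=\liminf_{n\to\infty}\frac{\log(1/a_n(T))}{n^{1/d}}$; $T$ is in the Schatten class $S_p$ if $\sum_n a_n(T)^p<\infty$.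 *)

theory Defs
  imports "HOL-Analysis.Analysis"
begin

type_synonym ('n) hfun = "complex^'n \<Rightarrow> complex"

definition lens_map :: "real \<Rightarrow> complex \<Rightarrow> complex" where
  "lens_map \<theta> z =
     ((1 + z) powr (complex_of_real \<theta>) - (1 - z) powr (complex_of_real \<theta>)) /
     ((1 + z) powr (complex_of_real \<theta>) + (1 - z) powr (complex_of_real \<theta>))"

definition multi_lens :: "real \<Rightarrow> complex^('n::finite) \<Rightarrow> complex^'n" where
  "multi_lens \<theta> z = (\<chi> i. lens_map \<theta> (z $ i))"

definition polydisk :: "(complex^('n::finite)) set" where
  "polydisk = {z. \<forall>i. norm (z $ i) < 1}"

definition holo_polydisk :: "('n::finite) hfun \<Rightarrow> bool" where
  "holo_polydisk f \<longleftrightarrow> (\<forall>z\<in>polydisk. \<exists>L. (f has_derivative L) (at z) \<and>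
       (\<forall>c v. L (\<chi> i. c * v $ i) = c * L v))"

text \<open>Integral of |f(r\<xi>)|^2 against the normalized Haar measure of the torus,
  parametrised by angles t in [0,2\<pi>]^d.\<close>
definition torus_mean :: "('n::finite) hfun \<Rightarrow> real \<Rightarrow> real" where
  "torus_mean f r = integral (cbox 0 (\<chi> i. 2 * pi))
      (\<lambda>t::real^'n. (cmod (f (\<chi> i. complex_of_real r * cis (t $ i))))\<^sup>2) / (2 * pi) ^ CARD('n)"

definition h2_norm :: "('n::finite) hfun \<Rightarrow> ereal" where
  "h2_norm f = (SUP r\<in>{0<..<1}. ereal (sqrt (torus_mean f r)))"

definition H2 :: "('n::finite) hfun set" where
  "H2 = {f. holo_polydisk f \<and> h2_norm f < \<infinity>}"

definition comp_op :: "(complex^('n::finite) \<Rightarrow> complex^'n) \<Rightarrow> 'n hfun \<Rightarrow> 'n hfun" where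
  "comp_op \<phi> f = f \<circ> \<phi>"

definition op_dist :: "(('n::finite) hfun \<Rightarrow> 'n hfun) \<Rightarrow> ('n hfun \<Rightarrow> 'n hfun) \<Rightarrow> ereal" where
  "op_dist T R = (SUP f\<in>{f\<in>H2. h2_norm f \<le> 1}. h2_norm (\<lambda>z. T f z - R f z))"

definition rank_less :: "(('n::finite) hfun \<Rightarrow> 'n hfun) \<Rightarrow> nat \<Rightarrow> bool" where
  "rank_less R n \<longleftrightarrow>
     (\<forall>f\<in>H2. \<forall>g\<in>H2. R (\<lambda>z. f z + g z) = (\<lambda>z. R f z + R g z)) \<and>
     (\<forall>f\<in>H2. \<forall>c. R (\<lambda>z. c * f z) = (\<lambda>z. c * R f z)) \<and>
     (\<exists>k g. k < n \<and> (\<forall>i<k. g i \<in> H2) \<and>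
        (\<forall>f\<in>H2. \<exists>c. R f = (\<lambda>z. \<Sum>i<k. c i * g i z)))"

text \<open>Approximation numbers a_n(T) (a_0 = \<infinity> by convention, as INF of the empty set).\<close>
definition approx_num :: "(('n::finite) hfun \<Rightarrow> 'n hfun) \<Rightarrow> nat \<Rightarrow> ereal" where
  "approx_num T n = (INF R\<in>{R. rank_less R n}. op_dist T R)"

definition gamma_minus :: "(('n::finite) hfun \<Rightarrow> 'n hfun) \<Rightarrow> ereal" where
  "gamma_minus T = liminf (\<lambda>n. ereal (ln (1 / real_of_ereal (approx_num T n)) /
                                         real n powr (1 / real CARD('n))))"

definition schatten :: "(('n::finite) hfun \<Rightarrow> 'n hfun) \<Rightarrow> real \<Rightarrow> bool" where
  "schatten T p \<longleftrightarrow> (\<forall>n\<ge>1. approx_num T n < \<infinity>) \<and>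
      summable (\<lambda>n. real_of_ereal (approx_num T (Suc n)) powr p)"

end

theory Submission
  imports Defs "HOL-Complex_Analysis.Complex_Analysis" "HOL-Real_Asymp.Real_Asymp"
begin

text \<open>
  The Cayley transform turns the lens map into \<open>p \<mapsto> p powr \<theta>\<close> on the right half-plane, so in logarithmic
  coordinates the image of the disk is a strip strictly inside the strip of the disk.

  Upper bound: interpolate \<open>f\<close> on a grid of about \<open>L\<^sup>2\<close> nodes per variable, spaced by \<open>1 / L\<close> in logarithmic
  coordinates up to height \<open>L\<close>. In one variable the minimal-norm interpolation error is a Blaschke product times a
  function of no larger \<open>H\<^sup>2\<close>-norm, and on the image of the lens map this product is at most \<open>exp (- c L)\<close> away from
  the contact points \<open>1\<close> and \<open>-1\<close>; near them the integrable singularity \<open>\<bar>1 - z\<^sup>2\<bar> powr (- \<theta>)\<close> of the point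
  evaluation bound takes over. Tensorising gives an error \<open>exp (- c L)\<close> at rank of order \<open>L ^ (2 d)\<close>, which is even better
  than the stated exponent.

  Lower bound: on a grid of \<open>L ^ (2 d)\<close> such nodes, Lagrange functions built from Blaschke quotients are bounded by
  \<open>exp (C L)\<close>. An operator of smaller rank kills a combination of them, which \<open>C\<^sub>\<phi>\<close> does not make small, by evaluating at
  the preimage of the node with the largest coefficient.
\<close>

section \<open>Interpolation in the Hardy space of the disk\<close>

text \<open>The spacing 1 / L is what makes the two bounds match. It puts about L nodes at bounded
  hyperbolic distance from a point of the image; on the other hand - ln (tanh (m / (2 L))) summed
  over all m \<ge> 1 is only O(L), so a Blaschke product with one node removed is still at least exp
  (- C L) at that node, however many nodes there are. Cutting off at height L makes the region near
  the contact points contribute at the same rate. Hence the rate is n powr (1 / (2 d)) on both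
  sides, and the weaker exponent 1 / (2 d + 1) follows by monotonicity of powers of n \<ge> 1.
  Boundary values on the torus are avoided: every estimate concerns finite combinations of point
  evaluations, whose squared norms multiply under tensor products. To see this, f is dilated by r <
  1, which makes each slice analytic across the closed disk, the one-variable bound is applied to
  the variables in turn, and r tends to 1 at finitely many interior points. So
  \<open>circ_mean\<close> is evaluated only for functions analytic across the closed disk, and
  needs no supremum over radii.\<close>

definition circ_mean :: "(complex \<Rightarrow> complex) \<Rightarrow> real" where
  "circ_mean h = integral {0..2*pi} (\<lambda>t. (cmod (h (cis t)))\<^sup>2) / (2*pi)"

text \<open>The Szego kernel at \<open>a\<close>, rescaled to take the value 1 there; its squared
  mean is 1 - |a|^2.\<close>

definition szego :: "complex \<Rightarrow> complex \<Rightarrow> complex" where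
  "szego a z = of_real (1 - (cmod a)\<^sup>2) / (1 - cnj a * z)"

definition blaschke :: "complex \<Rightarrow> complex \<Rightarrow> complex" where
  "blaschke a z = (z - a) / (1 - cnj a * z)"

lemma one_minus_cnj_mult_nonzero:
  assumes "cmod a < 1" "cmod z \<le> 1"
  shows "1 - cnj a * z \<noteq> 0"
proof
  assume "1 - cnj a * z = 0"
  then have "cmod (cnj a * z) = 1" by simp
  moreover have "cmod a * cmod z \<le> cmod a" using assms mult_left_le[of "cmod z" "cmod a"] by simp
  ultimately show False using assms by (simp add: norm_mult)
qed

lemma continuous_on_cis_comp:
  fixes h :: "complex \<Rightarrow> complex"
  assumes "h analytic_on cball 0 1"
  shows "continuous_on S (\<lambda>t. h (cis t))"
proof -
  have "continuous_on (cball 0 1) h" using assms analytic_imp_holomorphic holomorphic_on_imp_continuous_on by blast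
  moreover have "continuous_on S cis" by (intro continuous_intros)
  ultimately show ?thesis
    by (rule continuous_on_compose2) auto
qed

lemma szego_analytic: assumes "cmod a < 1" shows "szego a analytic_on cball 0 1"
  unfolding szego_def[abs_def]
  by (intro analytic_intros) (use assms one_minus_cnj_mult_nonzero in auto)

lemma blaschke_analytic: assumes "cmod a < 1" shows "blaschke a analytic_on cball 0 1"
  unfolding blaschke_def[abs_def]
  by (intro analytic_intros) (use assms one_minus_cnj_mult_nonzero in auto)

lemma szego_self: assumes "cmod a < 1" shows "szego a a = 1"
proof -
  have "1 - cnj a * a = of_real (1 - (cmod a)\<^sup>2)"
    using complex_norm_square[of a] by (simp add: mult.commute)
  moreover have "1 - (cmod a)\<^sup>2 \<noteq> 0" using assms power_less_one_iff[of "cmod a" 2] by auto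
  then have "complex_of_real (1 - (cmod a)\<^sup>2) \<noteq> 0" by (simp only: of_real_eq_0_iff not_False_eq_True)
  ultimately show ?thesis unfolding szego_def by (simp only: divide_self not_False_eq_True)
qed

text \<open>Both later facts about a Blaschke factor, modulus at most 1 in the disk and exactly 1 on
  the circle, are read off from this identity.\<close>

lemma blaschke_norm_diff:
  assumes "cmod a < 1" "cmod z \<le> 1"
  shows "1 - (cmod (blaschke a z))\<^sup>2 = (1 - (cmod a)\<^sup>2) * (1 - (cmod z)\<^sup>2) / (cmod (1 - cnj a * z))\<^sup>2"
proof -
  have nz: "cmod (1 - cnj a * z) \<noteq> 0" using one_minus_cnj_mult_nonzero[OF assms] by simp
  have "(cmod (1 - cnj a * z))\<^sup>2 - (cmod (z - a))\<^sup>2 = (1 - (cmod a)\<^sup>2) * (1 - (cmod z)\<^sup>2)"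
    unfolding cmod_power2 by (simp add: algebra_simps power2_eq_square)
  then show ?thesis unfolding blaschke_def norm_divide power_divide
    using nz by (simp add: field_simps)
qed

lemma norm_blaschke_le_1:
  assumes "cmod a < 1" "cmod z \<le> 1"
  shows "cmod (blaschke a z) \<le> 1"
proof -
  have "(cmod a)\<^sup>2 \<le> 1" "(cmod z)\<^sup>2 \<le> 1" using assms by (auto simp: power_le_one)
  then have "0 \<le> 1 - (cmod (blaschke a z))\<^sup>2"
    unfolding blaschke_norm_diff[OF assms] by simp
  then show ?thesis using abs_square_le_1[of "cmod (blaschke a z)"] by simp
qed

lemma norm_blaschke_circle:
  assumes "cmod a < 1" "cmod z = 1"
  shows "cmod (blaschke a z) = 1"
proof -
  have "1 - (cmod (blaschke a z))\<^sup>2 = 0"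
    using blaschke_norm_diff[of a z] assms by simp
  then show ?thesis using norm_ge_zero[of "blaschke a z"] by (auto simp: power2_eq_1_iff)
qed

lemma norm_prod_blaschke_le_1:
  assumes "A \<subseteq> ball 0 1" "cmod v \<le> 1"
  shows "cmod (\<Prod>a\<in>A. blaschke a v) \<le> 1"
  unfolding prod_norm[symmetric] using assms by (intro prod_le_1) (auto intro!: norm_blaschke_le_1)

text \<open>Cauchy's formula: on the circle cnj z = 1 / z turns the conjugated kernel into a
  multiple of z / (z - a). The factor in front of \<open>h a\<close> comes from the unnormalised
  integral and the scaling of \<open>szego\<close>.\<close>

lemma szego_reproducing:
  fixes h :: "complex \<Rightarrow> complex"
  assumes h: "h analytic_on cball 0 1" and a: "cmod a < 1"
  shows "((\<lambda>t. h (cis t) * cnj (szego a (cis t))) has_integral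
           (2 * pi * (1 - (cmod a)\<^sup>2)) * h a) {0..2*pi}"
proof -
  have "h holomorphic_on cball 0 1" using h analytic_imp_holomorphic by blast
  then have "((\<lambda>u. h u / (u - a)) has_contour_integral 2 * of_real pi * \<i> * h a) (circlepath 0 1)"
    using a by (intro Cauchy_integral_circlepath_simple) auto
  then have "((\<lambda>t. h (cis t) / (cis t - a) * \<i> * cis t) has_integral 2 * of_real pi * \<i> * h a) {0..2*pi}"
    unfolding circlepath_def by (subst (asm) has_contour_integral_part_circlepath_iff) (auto simp: cis_conv_exp)
  then have *: "((\<lambda>t. h (cis t) * (cis t / (cis t - a))) has_integral 2 * of_real pi * h a) {0..2*pi}"
    by (drule_tac has_integral_mult_right[where c = "-\<i>"]) (simp add: mult_ac)
  have "cnj (szego a (cis t)) = of_real (1 - (cmod a)\<^sup>2) * (cis t / (cis t - a))" for t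
  proof -
    have "cnj (szego a (cis t)) = of_real (1 - (cmod a)\<^sup>2) / (1 - a * cnj (cis t))"
      unfolding szego_def by simp
    also have "1 - a * cnj (cis t) = (cis t - a) / cis t"
      unfolding diff_divide_distrib using cis_neq_zero[of t] by (simp add: cis_cnj divide_inverse)
    finally show ?thesis by (simp only: divide_divide_eq_right times_divide_eq_right)
  qed
  then have "h (cis t) * cnj (szego a (cis t)) = of_real (1 - (cmod a)\<^sup>2) * (h (cis t) * (cis t / (cis t - a)))" for t
    by (simp only: mult.left_commute)
  moreover have "(2 * pi * (1 - (cmod a)\<^sup>2)) * h a = of_real (1 - (cmod a)\<^sup>2) * (2 * of_real pi * h a)"
    by (simp only: of_real_mult mult_ac of_real_numeral)
  ultimately show ?thesis using has_integral_mult_right[OF *] by (simp only:)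
qed

lemma circ_mean_has_integral:
  assumes "h analytic_on cball 0 1"
  shows "((\<lambda>t. (cmod (h (cis t)))\<^sup>2) has_integral 2 * pi * circ_mean h) {0..2*pi}"
proof -
  have "(\<lambda>t. (cmod (h (cis t)))\<^sup>2) integrable_on {0..2*pi}"
    by (intro integrable_continuous_interval continuous_intros continuous_on_cis_comp assms)
  then show ?thesis unfolding circ_mean_def by (simp add: has_integral_integrable_integral)
qed

lemma circ_mean_nonneg: "circ_mean h \<ge> 0"
proof -
  have "integral {0..2*pi} (\<lambda>t. (cmod (h (cis t)))\<^sup>2) \<ge> 0"
  proof (cases "(\<lambda>t. (cmod (h (cis t)))\<^sup>2) integrable_on {0..2*pi}")
    case True
    then show ?thesis by (rule integral_nonneg) simp
  next
    case False
    then show ?thesis by (subst not_integrable_integral) auto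
  qed
  then show ?thesis unfolding circ_mean_def by simp
qed

lemma norm_sq_diff_mult:
  "(cmod x)\<^sup>2 - 2 * Re (cnj y * (x * cnj k)) + (cmod y)\<^sup>2 * Re (k * cnj k) = (cmod (x - y * k))\<^sup>2"
  unfolding cmod_power2 by (simp add: algebra_simps power2_eq_square)

text \<open>Expanding the square leaves two inner products against \<open>szego a\<close>, one with
  \<open>h\<close> and one with \<open>szego a\<close> itself; the reproducing formula evaluates
  both.\<close>

lemma circ_mean_pythagoras:
  assumes h: "h analytic_on cball 0 1" and a: "cmod a < 1"
  shows "circ_mean (\<lambda>z. h z - h a * szego a z) = circ_mean h - (1 - (cmod a)\<^sup>2) * (cmod (h a))\<^sup>2"
proof -
  let ?k = "szego a" and ?A = "1 - (cmod a)\<^sup>2"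
  have i1: "((\<lambda>t. Re (cnj (h a) * (h (cis t) * cnj (?k (cis t))))) has_integral
     Re (cnj (h a) * ((2 * pi * ?A) * h a))) {0..2*pi}"
    by (intro has_integral_Re has_integral_mult_right szego_reproducing assms)
  have i2: "((\<lambda>t. Re (?k (cis t) * cnj (?k (cis t)))) has_integral Re ((2 * pi * ?A) * ?k a)) {0..2*pi}"
    by (intro has_integral_Re szego_reproducing szego_analytic a)
  have "((\<lambda>t. (cmod (h (cis t)))\<^sup>2 - 2 * Re (cnj (h a) * (h (cis t) * cnj (?k (cis t)))) +
        (cmod (h a))\<^sup>2 * Re (?k (cis t) * cnj (?k (cis t)))) has_integral
     (2 * pi * circ_mean h - 2 * Re (cnj (h a) * ((2 * pi * ?A) * h a)) + (cmod (h a))\<^sup>2 * Re ((2 * pi * ?A) * ?k a))) {0..2*pi}"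
    by (intro has_integral_add has_integral_diff has_integral_mult_right i1 i2 circ_mean_has_integral h)
  moreover have "(cmod (h (cis t)))\<^sup>2 - 2 * Re (cnj (h a) * (h (cis t) * cnj (?k (cis t)))) +
        (cmod (h a))\<^sup>2 * Re (?k (cis t) * cnj (?k (cis t))) = (cmod (h (cis t) - h a * ?k (cis t)))\<^sup>2" for t
    by (rule norm_sq_diff_mult)
  ultimately have e0: "((\<lambda>t. (cmod (h (cis t) - h a * ?k (cis t)))\<^sup>2) has_integral
     (2 * pi * circ_mean h - 2 * Re (cnj (h a) * ((2 * pi * ?A) * h a)) + (cmod (h a))\<^sup>2 * Re ((2 * pi * ?A) * ?k a))) {0..2*pi}"
    by (simp only:)
  have e1: "Re (cnj (h a) * ((2 * pi * ?A) * h a)) = 2 * pi * ?A * (cmod (h a))\<^sup>2"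
    unfolding cmod_power2[of "h a"] by (simp add: algebra_simps power2_eq_square)
  have e2: "Re ((2 * pi * ?A) * ?k a) = 2 * pi * ?A"
    unfolding szego_self[OF a] by simp
  have "((\<lambda>t. (cmod (h (cis t) - h a * ?k (cis t)))\<^sup>2) has_integral
     2 * pi * (circ_mean h - ?A * (cmod (h a))\<^sup>2)) {0..2*pi}"
    using e0 unfolding e1 e2 by (simp add: algebra_simps)
  then show ?thesis unfolding circ_mean_def[of "\<lambda>z. h z - h a * szego a z"]
    by (simp only: integral_unique) simp
qed

lemma one_minus_norm_sq_pos: "cmod a < 1 \<Longrightarrow> 0 < 1 - (cmod a)\<^sup>2"
  using power_less_one_iff[of "cmod a" 2] by auto

text \<open>The left side of the Pythagoras identity is nonnegative.\<close>

lemma point_eval_bound: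
  assumes "h analytic_on cball 0 1" "cmod a < 1"
  shows "(cmod (h a))\<^sup>2 \<le> circ_mean h / (1 - (cmod a)\<^sup>2)"
  using circ_mean_pythagoras[OF assms] circ_mean_nonneg[of "\<lambda>z. h z - h a * szego a z"] one_minus_norm_sq_pos[OF assms(2)]
  by (simp add: field_simps)

text \<open>An interpolation step that can be iterated: matching \<open>h\<close> at
  \<open>a\<close> leaves a remainder divisible by the Blaschke factor, and the quotient is again
  admissible, with no larger mean.\<close>

lemma divide_by_blaschke:
  assumes h: "h analytic_on cball 0 1" and a: "cmod a < 1"
  obtains q where "q analytic_on cball 0 1" "circ_mean q \<le> circ_mean h"
    "\<And>z. cmod z \<le> 1 \<Longrightarrow> h z = h a * szego a z + blaschke a z * q z"
proof -
  define g where "g = (\<lambda>z. h z - h a * szego a z)"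
  have g: "g analytic_on cball 0 1" unfolding g_def by (intro analytic_intros h szego_analytic a)
  have ga: "g a = 0" unfolding g_def using szego_self[OF a] by simp
  \<comment> \<open>Removable singularity: as \<open>g a = 0\<close>, this is g z / (z - a),
    extended by the derivative at \<open>a\<close>.\<close>
  define k where "k = (\<lambda>z. if z = a then deriv g a else (g z - g a) / (z - a))"
  obtain S where S: "open S" "cball 0 1 \<subseteq> S" "g holomorphic_on S"
    using g unfolding analytic_on_holomorphic by blast
  have "k holomorphic_on S" unfolding k_def
    by (rule pole_lemma_open[OF S(3,1)])
  then have k: "k analytic_on cball 0 1" using S unfolding analytic_on_holomorphic by blast
  define q where "q = (\<lambda>z. k z * (1 - cnj a * z))"
  have q: "q analytic_on cball 0 1" unfolding q_def by (intro analytic_intros k)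
  have gq: "g z = blaschke a z * q z" if "cmod z \<le> 1" for z
    using one_minus_cnj_mult_nonzero[OF a that] ga unfolding blaschke_def q_def k_def by auto
  \<comment> \<open>The Blaschke factor is unimodular on the circle, and \<open>g\<close> is \<open>h\<close> minus its orthogonal projection onto the kernel at \<open>a\<close>.\<close>
  have "cmod (q (cis t)) = cmod (g (cis t))" for t
    using gq[of "cis t"] norm_blaschke_circle[OF a, of "cis t"] by (simp add: norm_mult)
  then have "circ_mean q = circ_mean g" unfolding circ_mean_def by simp
  also have "\<dots> \<le> circ_mean h"
    unfolding g_def circ_mean_pythagoras[OF h a] using one_minus_norm_sq_pos[OF a] by simp
  finally have "circ_mean q \<le> circ_mean h" .
  moreover have "h z = h a * szego a z + blaschke a z * q z" if "cmod z \<le> 1" for z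
    unfolding gq[OF that, symmetric] g_def by simp
  ultimately show thesis by (rule that[OF q])
qed

text \<open>Iterates the division over the nodes; since no step increases the mean, the bound on
  \<open>q\<close> does not depend on how many nodes there are. The functions \<open>c\<close> are
  chosen before \<open>h\<close>, so the interpolant is linear in the values of \<open>h\<close> at
  the nodes.\<close>

lemma blaschke_interpolation:
  assumes "finite A" "A \<subseteq> ball 0 1"
  shows "\<exists>c. (\<forall>a\<in>A. c a analytic_on cball 0 1) \<and>
    (\<forall>h. h analytic_on cball 0 1 \<longrightarrow> (\<exists>q. q analytic_on cball 0 1 \<and> circ_mean q \<le> circ_mean h \<and>
       (\<forall>v. cmod v \<le> 1 \<longrightarrow> h v - (\<Sum>a\<in>A. c a v * h a) = (\<Prod>a\<in>A. blaschke a v) * q v)))"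
  using assms
proof (induction A rule: finite_induct)
  case empty
  show ?case by (intro exI[of _ "\<lambda>_ _. 0"]) auto
next
  case (insert b A)
  then have b: "cmod b < 1" and A: "\<And>a. a \<in> A \<Longrightarrow> cmod a < 1" by auto
  from insert obtain c where c: "\<forall>a\<in>A. c a analytic_on cball 0 1"
    and cq: "\<And>h. h analytic_on cball 0 1 \<Longrightarrow> (\<exists>q. q analytic_on cball 0 1 \<and> circ_mean q \<le> circ_mean h \<and>
       (\<forall>v. cmod v \<le> 1 \<longrightarrow> h v - (\<Sum>a\<in>A. c a v * h a) = (\<Prod>a\<in>A. blaschke a v) * q v))"
    by auto
  \<comment> \<open>Obtained by inserting the interpolant of the quotient k at \<open>A\<close>,
    where k a = (h a - h b * szego b a) / blaschke b a, into h = h b * szego b + blaschke b * k and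
    collecting the coefficients of \<open>h b\<close> and \<open>h a\<close>.\<close>
  define c' where "c' = (\<lambda>a v. if a = b then szego b v - blaschke b v * (\<Sum>a\<in>A. c a v * szego b a / blaschke b a)
      else blaschke b v * c a v / blaschke b a)"
  have nz: "blaschke b a \<noteq> 0" if "a \<in> A" for a
    using that insert.hyps one_minus_cnj_mult_nonzero[OF b, of a] A[OF that] unfolding blaschke_def by auto
  have c'an: "c' a analytic_on cball 0 1" if "a \<in> insert b A" for a
  proof (cases "a = b")
    case True
    have "c' b = (\<lambda>v. szego b v - blaschke b v * (\<Sum>a\<in>A. c a v * szego b a * inverse (blaschke b a)))"
      unfolding c'_def by (simp add: divide_inverse)
    then show ?thesis unfolding True
      by (simp only:) (intro analytic_intros szego_analytic blaschke_analytic b c[rule_format])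
  next
    case False
    then have "c' a = (\<lambda>v. blaschke b v * c a v * inverse (blaschke b a))"
      unfolding c'_def by (simp add: divide_inverse)
    then show ?thesis using False that
      by (simp only:) (intro analytic_intros blaschke_analytic b c[rule_format], auto)
  qed
  have "\<exists>q. q analytic_on cball 0 1 \<and> circ_mean q \<le> circ_mean h \<and>
       (\<forall>v. cmod v \<le> 1 \<longrightarrow> h v - (\<Sum>a\<in>insert b A. c' a v * h a) = (\<Prod>a\<in>insert b A. blaschke a v) * q v)"
    if h: "h analytic_on cball 0 1" for h
  proof -
    obtain k where k: "k analytic_on cball 0 1" "circ_mean k \<le> circ_mean h"
      and hk: "\<And>z. cmod z \<le> 1 \<Longrightarrow> h z = h b * szego b z + blaschke b z * k z"
      using divide_by_blaschke[OF h b] by metis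
    obtain q where q: "q analytic_on cball 0 1" "circ_mean q \<le> circ_mean k"
      and kq: "\<And>v. cmod v \<le> 1 \<Longrightarrow> k v - (\<Sum>a\<in>A. c a v * k a) = (\<Prod>a\<in>A. blaschke a v) * q v"
      using cq[OF k(1)] by metis
    have "h v - (\<Sum>a\<in>insert b A. c' a v * h a) = (\<Prod>a\<in>insert b A. blaschke a v) * q v" if v: "cmod v \<le> 1" for v
    proof -
      have kA: "k a = (h a - h b * szego b a) / blaschke b a" if "a \<in> A" for a
        using hk[of a] A[OF that] nz[OF that] by (simp add: field_simps)
      have "(\<Sum>a\<in>A. c' a v * h a) = (\<Sum>a\<in>A. blaschke b v * (c a v * k a) + blaschke b v * h b * (c a v * szego b a / blaschke b a))"
      proof (rule sum.cong)
        fix a assume "a \<in> A"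
        then have "a \<noteq> b" using insert.hyps by auto
        then show "c' a v * h a = blaschke b v * (c a v * k a) + blaschke b v * h b * (c a v * szego b a / blaschke b a)"
          unfolding kA[OF \<open>a \<in> A\<close>] c'_def using nz[OF \<open>a \<in> A\<close>] by (simp add: field_simps)
      qed simp
      also have "\<dots> = blaschke b v * (\<Sum>a\<in>A. c a v * k a) + blaschke b v * h b * (\<Sum>a\<in>A. c a v * szego b a / blaschke b a)"
        by (simp add: sum.distrib sum_distrib_left)
      finally have *: "(\<Sum>a\<in>A. c' a v * h a) = blaschke b v * (\<Sum>a\<in>A. c a v * k a) + blaschke b v * h b * (\<Sum>a\<in>A. c a v * szego b a / blaschke b a)" .
      have "h v - (\<Sum>a\<in>insert b A. c' a v * h a) = h v - c' b v * h b - (\<Sum>a\<in>A. c' a v * h a)"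
        using insert.hyps by simp
      also have "\<dots> = blaschke b v * (k v - (\<Sum>a\<in>A. c a v * k a))"
        unfolding * hk[OF v] by (simp add: c'_def algebra_simps)
      also have "\<dots> = (\<Prod>a\<in>insert b A. blaschke a v) * q v" unfolding kq[OF v] using insert.hyps by simp
      finally show ?thesis .
    qed
    then show ?thesis using q k(2) by (intro exI[of _ q]) auto
  qed
  then show ?case using c'an by blast
qed

section \<open>Means over the torus\<close>

text \<open>Density of normalised arc length in the angle. Keeping the cutoff in the integrand lets
  torus integrals be taken over a product of full Lebesgue measures, where Tonelli applies one
  coordinate at a time.\<close>

definition circ_weight :: "real \<Rightarrow> ennreal" where
  "circ_weight t = ennreal (1 / (2 * pi)) * indicator {0..2*pi} t"

lemma circ_weight_measurable [measurable]: "circ_weight \<in> borel_measurable borel"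
  unfolding circ_weight_def[abs_def] by measurable

lemma circ_mean_eq_nn_integral:
  assumes h: "h analytic_on cball 0 1"
  shows "ennreal (circ_mean h) = (\<integral>\<^sup>+t. circ_weight t * ennreal ((cmod (h (cis t)))\<^sup>2) \<partial>lborel)"
proof -
  have [measurable]: "(\<lambda>t. h (cis t)) \<in> borel_measurable borel"
    by (intro borel_measurable_continuous_onI continuous_on_cis_comp h)
  have "(\<integral>\<^sup>+t. circ_weight t * ennreal ((cmod (h (cis t)))\<^sup>2) \<partial>lborel)
      = (\<integral>\<^sup>+t. ennreal (1 / (2 * pi)) * ennreal (indicator {0..2*pi} t * (cmod (h (cis t)))\<^sup>2) \<partial>lborel)"
    by (intro nn_integral_cong) (auto simp: circ_weight_def indicator_def)
  also have "\<dots> = ennreal (1 / (2 * pi)) * ennreal (2 * pi * circ_mean h)"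
    by (subst nn_integral_cmult, measurable) (subst nn_integral_has_integral_lebesgue[OF _ circ_mean_has_integral[OF h]], simp_all)
  also have "\<dots> = ennreal (circ_mean h)"
    by (subst ennreal_mult[symmetric]) (auto simp: circ_mean_nonneg)
  finally show ?thesis ..
qed

lemma vec_lambda_measurable [measurable (raw)]:
  fixes f :: "'a \<Rightarrow> 'n::finite \<Rightarrow> real"
  assumes "\<And>i. (\<lambda>x. f x i) \<in> borel_measurable M"
  shows "(\<lambda>x. \<chi> i. f x i) \<in> borel_measurable M"
  by (subst borel_measurable_euclidean_space) (auto simp: Basis_vec_def inner_axis assms)

text \<open>Links \<open>torus_mean\<close>, an integral over a box of vectors, to a product measure
  from which single coordinates can be split off. Both measures give a box the product of its side
  lengths.\<close>

lemma lborel_vec_eq_distr_PiM: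
  "(lborel :: (real^'n::finite) measure) = distr (\<Pi>\<^sub>M i\<in>UNIV. lborel) borel (\<lambda>x. \<chi> i. x i)"
proof (rule lborel_eqI)
  fix l u :: "real^'n"
  assume lu: "\<And>b. b \<in> Basis \<Longrightarrow> l \<bullet> b \<le> u \<bullet> b"
  then have lu': "l $ i \<le> u $ i" for i
    using lu[of "axis i 1"] by (simp add: inner_axis Basis_vec_def) blast
  interpret product_sigma_finite "\<lambda>_::'n. lborel :: real measure" by standard
  have B: "Basis = (\<lambda>i. axis i (1::real)) ` (UNIV::'n set)" "inj (\<lambda>i. axis i 1 :: real^'n)"
    by (auto simp: Basis_vec_def inj_on_def axis_eq_axis)
  have "emeasure (distr (\<Pi>\<^sub>M i\<in>(UNIV::'n set). lborel) borel (\<lambda>x. \<chi> i. x i)) (box l u)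
     = emeasure (\<Pi>\<^sub>M i\<in>(UNIV::'n set). lborel) (\<Pi>\<^sub>E i\<in>UNIV. {l$i<..<u$i})"
    by (subst emeasure_distr) (auto simp: space_PiM box_def B(1) inner_axis PiE_iff intro!: arg_cong[where f="emeasure _"] vec_lambda_measurable)
  also have "\<dots> = (\<Prod>i\<in>(UNIV::'n set). ennreal (u $ i - l $ i))"
    by (subst emeasure_PiM) (auto simp: lu')
  also have "\<dots> = ennreal (\<Prod>b\<in>Basis. (u - l) \<bullet> b)"
    unfolding B(1) by (subst prod.reindex[OF B(2)]) (simp add: prod_ennreal lu' inner_axis)
  finally show "emeasure (distr (\<Pi>\<^sub>M i\<in>(UNIV::'n set). lborel) borel (\<lambda>x. \<chi> i. x i)) (box l u) = (\<Prod>b\<in>Basis. (u - l) \<bullet> b)" .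
qed simp

lemma open_polydisk: "open (polydisk :: (complex^'n::finite) set)"
proof -
  have *: "polydisk = (\<Inter>i. {z::complex^'n. norm (z $ i) < 1})" unfolding polydisk_def by auto
  have "open {z::complex^'n. norm (z $ i) < 1}" for i
    by (intro open_Collect_less continuous_intros)
  then show ?thesis unfolding * by (intro open_INT) auto
qed

lemma holo_polydisk_continuous:
  assumes "holo_polydisk f" shows "continuous_on polydisk f"
  using assms unfolding holo_polydisk_def
  by (intro continuous_at_imp_continuous_on) (meson has_derivative_continuous)

text \<open>Since r < 1, the slice lives on the disk of radius 1 / r, so it is analytic across the
  closed unit disk even when the other coordinates lie on the circle. Complex linearity of the
  derivative along \<open>v\<close> makes the slice complex differentiable.\<close>

lemma holo_polydisk_slice:
  fixes f :: "'n::finite hfun"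
  assumes f: "holo_polydisk f" and r: "0 < r" "r < 1" and x: "\<And>i. i \<noteq> k \<Longrightarrow> cmod (x i) \<le> 1"
  shows "(\<lambda>s. f (\<chi> i. of_real r * (if i = k then s else x i))) analytic_on cball 0 1"
proof -
  define P where "P = (\<lambda>s. (\<chi> i. of_real r * (if i = k then s else x i)) :: complex^'n)"
  define v :: "complex^'n" where "v = (\<chi> i. if i = k then of_real r else 0)"
  have lin: "bounded_linear (\<lambda>h. (\<chi> i. h * v $ i) :: complex^'n)"
    by (intro linear_conv_bounded_linear[THEN iffD1] linearI) (simp_all add: vec_eq_iff algebra_simps)
  define c where "c = P 0"
  have Peq: "P = (\<lambda>s. c + (\<chi> i. s * v $ i))"
    unfolding P_def v_def c_def by (simp add: vec_eq_iff fun_eq_iff)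
  have P': "(P has_derivative (\<lambda>h. \<chi> i. h * v $ i)) (at s)" for s
    unfolding Peq using has_derivative_add[OF has_derivative_const[of c] bounded_linear_imp_has_derivative[OF lin]] by simp
  have "(\<lambda>s. f (P s)) holomorphic_on ball 0 (1/r)"
    unfolding holomorphic_on_open[OF open_ball]
  proof
    fix s assume "s \<in> ball (0::complex) (1/r)"
    then have "r * cmod s < 1" using r by (simp add: field_simps)
    moreover have "r * cmod (x i) < 1" if "i \<noteq> k" for i
      using x[OF that] r mult_left_le[of "cmod (x i)" r] by linarith
    ultimately have "P s \<in> polydisk" unfolding polydisk_def P_def using r by (auto simp: norm_mult)
    then obtain L where L: "(f has_derivative L) (at (P s))" "\<And>c v. L (\<chi> i. c * v $ i) = c * L v"
      using f unfolding holo_polydisk_def by blast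
    have "((\<lambda>s. f (P s)) has_derivative (\<lambda>h. L (\<chi> i. h * v $ i))) (at s)"
      using has_derivative_compose[OF P' L(1)] .
    then show "\<exists>f'. ((\<lambda>s. f (P s)) has_field_derivative f') (at s)"
      unfolding L(2) has_field_derivative_def by (auto simp: mult.commute[of _ "L v"])
  qed
  moreover have "1 < 1 / r" using r by simp
  then have "cball 0 1 \<subseteq> ball (0::complex) (1/r)" by auto
  ultimately show ?thesis unfolding analytic_on_holomorphic P_def by blast
qed

text \<open>The mixed form, coordinates in \<open>S\<close> on the torus and the others frozen, is
  what an induction over the set of integrated coordinates produces.\<close>

lemma torus_integrand_continuous:
  fixes f :: "'n::finite hfun"
  assumes f: "continuous_on polydisk f" and r: "0 \<le> r" "r < 1" and x: "\<And>i. cmod (x i) \<le> 1"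
  shows "continuous_on UNIV (\<lambda>t::real^'n. f (\<chi> i. of_real r * (if i \<in> S then cis (t $ i) else x i)))"
proof (rule continuous_on_compose2[OF f])
  have "continuous_on UNIV (\<lambda>t::real^'n. of_real r * (if i \<in> S then cis (t $ i) else x i))" for i
    by (cases "i \<in> S") (auto intro!: continuous_intros)
  then show "continuous_on UNIV (\<lambda>t::real^'n. (\<chi> i. of_real r * (if i \<in> S then cis (t $ i) else x i)) :: complex^'n)"
    by (intro continuous_on_vec_lambda)
  have "r * cmod (x i) < 1" for i
    using x[of i] r mult_left_le[of "cmod (x i)" r] by linarith
  then show "range (\<lambda>t::real^'n. (\<chi> i. of_real r * (if i \<in> S then cis (t $ i) else x i)) :: complex^'n) \<subseteq> polydisk"
    using r unfolding polydisk_def by (auto simp: norm_mult)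
qed

lemma torus_integrand_measurable:
  fixes f :: "'n::finite hfun"
  assumes f: "continuous_on polydisk f" and r: "0 \<le> r" "r < 1" and x: "\<And>i. cmod (x i) \<le> 1"
  shows "(\<lambda>t. f (\<chi> i. of_real r * (if i \<in> S then cis (t i) else x i))) \<in> borel_measurable (\<Pi>\<^sub>M i\<in>S. lborel)"
proof -
  \<comment> \<open>Elements of the product over \<open>S\<close> carry no information outside
    \<open>S\<close>; padding with 0 maps them measurably to vectors without changing the
    integrand.\<close>
  have 1: "(\<lambda>t. \<chi> i. if i \<in> S then t i else 0) \<in> borel_measurable (\<Pi>\<^sub>M i\<in>S. (lborel::real measure))"
  proof (rule vec_lambda_measurable)
    fix i show "(\<lambda>t. if i \<in> S then t i else 0) \<in> borel_measurable (\<Pi>\<^sub>M i\<in>S. (lborel::real measure))"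
      by (cases "i \<in> S") simp_all
  qed
  have 2: "(\<lambda>t::real^'n. f (\<chi> i. of_real r * (if i \<in> S then cis (t $ i) else x i))) \<in> borel_measurable borel"
    by (intro borel_measurable_continuous_onI torus_integrand_continuous assms)
  have "(\<lambda>t. f (\<chi> i. of_real r * (if i \<in> S then cis (t i) else x i))) = 
     (\<lambda>t::real^'n. f (\<chi> i. of_real r * (if i \<in> S then cis (t $ i) else x i))) \<circ> (\<lambda>t. \<chi> i. if i \<in> S then t i else 0)"
    by (auto simp: fun_eq_iff intro!: arg_cong[where f=f])
  then show ?thesis using measurable_comp[OF 1 2] by (simp only:)
qed

lemma torus_mean_has_integral:
  fixes f :: "'n::finite hfun"
  assumes f: "continuous_on polydisk f" and r: "0 \<le> r" "r < 1"
  shows "((\<lambda>t::real^'n. (cmod (f (\<chi> i. complex_of_real r * cis (t $ i))))\<^sup>2) has_integral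
      (2 * pi) ^ CARD('n) * torus_mean f r) (cbox 0 (\<chi> i. 2 * pi))"
proof -
  have "(\<lambda>t::real^'n. (cmod (f (\<chi> i. complex_of_real r * cis (t $ i))))\<^sup>2) integrable_on cbox 0 (\<chi> i. 2 * pi)"
    using torus_integrand_continuous[OF f r, of "\<lambda>_. 0" UNIV]
    by (intro integrable_continuous continuous_intros) (auto intro: continuous_on_subset)
  then show ?thesis unfolding torus_mean_def by (simp add: has_integral_integrable_integral)
qed

lemma torus_mean_nonneg:
  fixes f :: "'n::finite hfun"
  assumes f: "continuous_on polydisk f" and r: "0 \<le> r" "r < 1"
  shows "0 \<le> torus_mean f r"
proof -
  have "0 \<le> (2 * pi) ^ CARD('n) * torus_mean f r"
    using has_integral_nonneg[OF torus_mean_has_integral[OF assms]] by simp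
  moreover have "(2 * pi) ^ CARD('n) > 0" by simp
  ultimately show ?thesis using zero_le_mult_iff linorder_not_less by blast
qed

lemma torus_mean_eq_nn_integral:
  fixes f :: "'n::finite hfun"
  assumes f: "continuous_on polydisk f" and r: "0 \<le> r" "r < 1"
  shows "ennreal (torus_mean f r) = (\<integral>\<^sup>+t. (\<Prod>i\<in>UNIV. circ_weight (t i)) *
      ennreal ((cmod (f (\<chi> i. complex_of_real r * cis (t i))))\<^sup>2) \<partial>(\<Pi>\<^sub>M i\<in>UNIV. lborel))"
proof -
  let ?f = "\<lambda>t::real^'n. (cmod (f (\<chi> i. complex_of_real r * cis (t $ i))))\<^sup>2"
  have [measurable]: "?f \<in> borel_measurable borel"
    using torus_integrand_continuous[OF f r, of "\<lambda>_. 0" UNIV]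
    by (intro borel_measurable_continuous_onI continuous_intros) auto
  have [measurable]: "(\<lambda>t::real^'n. t $ i) \<in> borel_measurable borel" for i
    by (intro borel_measurable_continuous_onI continuous_intros)
  have ind: "(\<Prod>i\<in>UNIV. circ_weight (t $ i)) = ennreal (1 / (2*pi) ^ CARD('n)) * indicator (cbox 0 (\<chi> i. 2 * pi)) t" for t :: "real^'n"
  proof (cases "t \<in> cbox 0 (\<chi> i. 2 * pi)")
    case True
    then have "circ_weight (t $ i) = ennreal (1 / (2*pi))" for i
      unfolding circ_weight_def by (auto simp: mem_box_cart)
    then show ?thesis using True by (simp add: ennreal_power power_one_over)
  next
    case False
    then obtain i where "t $ i \<notin> {0..2*pi}" by (auto simp: mem_box_cart)
    then have "circ_weight (t $ i) = 0" unfolding circ_weight_def by auto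
    then have "(\<Prod>i\<in>UNIV. circ_weight (t $ i)) = 0" by (intro prod_zero) auto
    then show ?thesis using False by simp
  qed
  have "(\<integral>\<^sup>+t. (\<Prod>i\<in>UNIV. circ_weight (t i)) *
      ennreal ((cmod (f (\<chi> i. complex_of_real r * cis (t i))))\<^sup>2) \<partial>(\<Pi>\<^sub>M i\<in>UNIV. lborel))
    = (\<integral>\<^sup>+t. (\<Prod>i\<in>UNIV. circ_weight (t $ i)) * ennreal (?f t) \<partial>lborel)"
    by (subst lborel_vec_eq_distr_PiM, subst nn_integral_distr) (auto intro!: vec_lambda_measurable)
  also have "\<dots> = (\<integral>\<^sup>+t. ennreal (1 / (2*pi) ^ CARD('n)) * ennreal (indicator (cbox 0 (\<chi> i. 2 * pi)) t * ?f t) \<partial>lborel)"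
    unfolding ind by (intro nn_integral_cong) (auto simp: indicator_def)
  also have "\<dots> = ennreal (1 / (2*pi) ^ CARD('n)) * ennreal ((2 * pi) ^ CARD('n) * torus_mean f r)"
    by (subst nn_integral_cmult, measurable) (subst nn_integral_has_integral_lebesgue[OF _ torus_mean_has_integral[OF f r]], simp_all)
  also have "\<dots> = ennreal (torus_mean f r)"
    by (subst ennreal_mult[symmetric]) (auto simp: torus_mean_nonneg[OF f r])
  finally show ?thesis ..
qed

section \<open>Tensor products of functionals on the disk\<close>

text \<open>A finite combination of point evaluations, regarded as a functional on the Hardy space
  of the disk with squared norm at most \<open>C\<close>. It is tested on functions analytic across
  the closed disk because it gets applied to dilated slices.\<close>

definition disc_bound :: "complex set \<Rightarrow> (complex \<Rightarrow> complex) \<Rightarrow> real \<Rightarrow> bool" where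
  "disc_bound P c C \<longleftrightarrow> finite P \<and> P \<subseteq> ball 0 1 \<and> 0 \<le> C \<and>
     (\<forall>h. h analytic_on cball 0 1 \<longrightarrow> (cmod (\<Sum>p\<in>P. c p * h p))\<^sup>2 \<le> C * circ_mean h)"

lemma sum_PiE_insert:
  assumes "finite S" "k \<notin> S"
  shows "(\<Sum>p\<in>Pi\<^sub>E (insert k S) P. g p) = (\<Sum>s\<in>P k. \<Sum>p\<in>Pi\<^sub>E S P. g (p(k := s)))"
  unfolding PiE_insert_eq sum.cartesian_product
  by (subst sum.reindex[OF inj_combinator[OF assms(2)]]) (simp add: case_prod_unfold)

text \<open>Squared norms of functionals multiply under tensor products. The bound for variable
  \<open>k\<close> is applied to the function already summed over the other variables; the induction
  hypothesis then bounds that function at each point of the circle, under the integral.\<close>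

lemma tensor_functional_partial:
  fixes f :: "'n::finite hfun"
  assumes f: "holo_polydisk f" and r: "0 < r" "r < 1"
    and B: "\<And>i. disc_bound (P i) (c i) (C i)"
    and "finite S" and "\<And>i. cmod (x i) \<le> 1"
  shows "ennreal ((cmod (\<Sum>p\<in>Pi\<^sub>E S P. (\<Prod>i\<in>S. c i (p i)) * f (\<chi> i. of_real r * (if i \<in> S then p i else x i))))\<^sup>2)
     \<le> (\<integral>\<^sup>+t. (\<Prod>i\<in>S. ennreal (C i) * circ_weight (t i)) *
          ennreal ((cmod (f (\<chi> i. of_real r * (if i \<in> S then cis (t i) else x i))))\<^sup>2) \<partial>(\<Pi>\<^sub>M i\<in>S. lborel))"
  using assms(5,6)
proof (induction S arbitrary: x rule: finite_induct)
  case empty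
  show ?case by (simp add: nn_integral_const PiM_empty)
next
  case (insert k S)
  interpret product_sigma_finite "\<lambda>_::'n. lborel :: real measure" by standard
  have cont: "continuous_on polydisk f" by (rule holo_polydisk_continuous[OF f])
  have Pk: "finite (P i)" "P i \<subseteq> ball 0 1" "0 \<le> C i" for i using B unfolding disc_bound_def by auto
  define H where "H = (\<lambda>s. \<Sum>p\<in>Pi\<^sub>E S P. (\<Prod>i\<in>S. c i (p i)) * f (\<chi> i. of_real r * (if i \<in> S then p i else (x(k := s)) i)))"
  have H: "H analytic_on cball 0 1"
    unfolding H_def
  proof (intro analytic_on_sum analytic_on_mult analytic_on_const)
    fix p assume p: "p \<in> Pi\<^sub>E S P"
    have "cmod (if i \<in> S then p i else x i) \<le> 1" for i
      using p Pk(2)[of i] insert.prems[of i] by (auto dest!: PiE_mem[of p S P i])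
    then have "(\<lambda>s. f (\<chi> i. of_real r * (if i = k then s else (if i \<in> S then p i else x i)))) analytic_on cball 0 1"
      by (intro holo_polydisk_slice[OF f r])
    moreover have "(if i = k then s else (if i \<in> S then p i else x i)) = (if i \<in> S then p i else (x(k := s)) i)" for i s
      using insert.hyps by auto
    ultimately show "(\<lambda>s. f (\<chi> i. of_real r * (if i \<in> S then p i else (x(k := s)) i))) analytic_on cball 0 1"
      by simp
  qed
  have "(\<Sum>p\<in>Pi\<^sub>E (insert k S) P. (\<Prod>i\<in>insert k S. c i (p i)) * f (\<chi> i. of_real r * (if i \<in> insert k S then p i else x i)))
      = (\<Sum>s\<in>P k. c k s * H s)"
    unfolding H_def sum_distrib_left sum_PiE_insert[OF insert.hyps]
  proof (intro sum.cong refl)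
    fix s p
    have "(\<Prod>i\<in>insert k S. c i ((p(k := s)) i)) = c k s * (\<Prod>i\<in>S. c i (p i))"
      using insert.hyps by (simp, intro disjI2 prod.cong) auto
    moreover have "(\<chi> i. of_real r * (if i \<in> insert k S then (p(k := s)) i else x i)) = 
       ((\<chi> i. of_real r * (if i \<in> S then p i else (x(k := s)) i)) :: complex^'n)"
      using insert.hyps by (auto simp: vec_eq_iff)
    ultimately show "(\<Prod>i\<in>insert k S. c i ((p(k := s)) i)) * f (\<chi> i. of_real r * (if i \<in> insert k S then (p(k := s)) i else x i))
      = c k s * ((\<Prod>i\<in>S. c i (p i)) * f (\<chi> i. of_real r * (if i \<in> S then p i else (x(k := s)) i)))" by simp
  qed
  then have "(cmod (\<Sum>p\<in>Pi\<^sub>E (insert k S) P. (\<Prod>i\<in>insert k S. c i (p i)) * f (\<chi> i. of_real r * (if i \<in> insert k S then p i else x i))))\<^sup>2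
      \<le> C k * circ_mean H"
    using B[of k] H unfolding disc_bound_def by simp
  then have "ennreal ((cmod (\<Sum>p\<in>Pi\<^sub>E (insert k S) P. (\<Prod>i\<in>insert k S. c i (p i)) * f (\<chi> i. of_real r * (if i \<in> insert k S then p i else x i))))\<^sup>2)
      \<le> ennreal (C k) * ennreal (circ_mean H)"
    by (subst ennreal_mult[symmetric]) (auto simp: Pk circ_mean_nonneg intro!: ennreal_leI)
  also have "\<dots> = (\<integral>\<^sup>+s. ennreal (C k) * circ_weight s * ennreal ((cmod (H (cis s)))\<^sup>2) \<partial>lborel)"
  proof -
    have [measurable]: "(\<lambda>t. H (cis t)) \<in> borel_measurable borel"
      by (intro borel_measurable_continuous_onI continuous_on_cis_comp H)
    show ?thesis unfolding circ_mean_eq_nn_integral[OF H]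
      by (subst nn_integral_cmult[symmetric]) (simp_all add: mult.assoc)
  qed
  also have "\<dots> \<le> (\<integral>\<^sup>+s. ennreal (C k) * circ_weight s * (\<integral>\<^sup>+t. (\<Prod>i\<in>S. ennreal (C i) * circ_weight (t i)) *
          ennreal ((cmod (f (\<chi> i. of_real r * (if i \<in> S then cis (t i) else (x(k := cis s)) i))))\<^sup>2) \<partial>(\<Pi>\<^sub>M i\<in>S. lborel)) \<partial>lborel)"
    unfolding H_def using insert.prems by (intro nn_integral_mono mult_left_mono insert.IH) auto
  also have "\<dots> = (\<integral>\<^sup>+s. (\<integral>\<^sup>+t. ennreal (C k) * circ_weight s * ((\<Prod>i\<in>S. ennreal (C i) * circ_weight (t i)) *
          ennreal ((cmod (f (\<chi> i. of_real r * (if i \<in> S then cis (t i) else (x(k := cis s)) i))))\<^sup>2)) \<partial>(\<Pi>\<^sub>M i\<in>S. lborel)) \<partial>lborel)"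
  proof (intro nn_integral_cong, subst nn_integral_cmult)
    fix s
    have [measurable]: "(\<lambda>t. f (\<chi> i. of_real r * (if i \<in> S then cis (t i) else (x(k := cis s)) i))) \<in> borel_measurable (\<Pi>\<^sub>M i\<in>S. lborel)"
      using insert.prems r by (intro torus_integrand_measurable cont) auto
    show "(\<lambda>t. (\<Prod>i\<in>S. ennreal (C i) * circ_weight (t i)) *
          ennreal ((cmod (f (\<chi> i. of_real r * (if i \<in> S then cis (t i) else (x(k := cis s)) i))))\<^sup>2)) \<in> borel_measurable (\<Pi>\<^sub>M i\<in>S. lborel)"
      by measurable
  qed simp
  also have "\<dots> = (\<integral>\<^sup>+s. (\<integral>\<^sup>+t. (\<Prod>i\<in>insert k S. ennreal (C i) * circ_weight ((t(k := s)) i)) *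
          ennreal ((cmod (f (\<chi> i. of_real r * (if i \<in> insert k S then cis ((t(k := s)) i) else x i))))\<^sup>2) \<partial>(\<Pi>\<^sub>M i\<in>S. lborel)) \<partial>lborel)"
  proof (intro nn_integral_cong)
    fix s t
    have "(\<Prod>i\<in>insert k S. ennreal (C i) * circ_weight ((t(k := s)) i)) = ennreal (C k) * circ_weight s * (\<Prod>i\<in>S. ennreal (C i) * circ_weight (t i))"
      using insert.hyps by (simp, intro arg_cong2[where f="(*)"] refl prod.cong) auto
    moreover have "(\<chi> i. of_real r * (if i \<in> insert k S then cis ((t(k := s)) i) else x i)) = 
       ((\<chi> i. of_real r * (if i \<in> S then cis (t i) else (x(k := cis s)) i)) :: complex^'n)"
      using insert.hyps by (auto simp: vec_eq_iff)
    ultimately show "ennreal (C k) * circ_weight s * ((\<Prod>i\<in>S. ennreal (C i) * circ_weight (t i)) *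
          ennreal ((cmod (f (\<chi> i. of_real r * (if i \<in> S then cis (t i) else (x(k := cis s)) i))))\<^sup>2))
      = (\<Prod>i\<in>insert k S. ennreal (C i) * circ_weight ((t(k := s)) i)) *
          ennreal ((cmod (f (\<chi> i. of_real r * (if i \<in> insert k S then cis ((t(k := s)) i) else x i))))\<^sup>2)"
      by (simp add: mult.assoc)
  qed
  also have "\<dots> = (\<integral>\<^sup>+t. (\<Prod>i\<in>insert k S. ennreal (C i) * circ_weight (t i)) *
          ennreal ((cmod (f (\<chi> i. of_real r * (if i \<in> insert k S then cis (t i) else x i))))\<^sup>2) \<partial>(\<Pi>\<^sub>M i\<in>insert k S. lborel))"
  proof (rule product_nn_integral_insert_rev[OF insert.hyps, symmetric])
    have [measurable]: "(\<lambda>t. f (\<chi> i. of_real r * (if i \<in> insert k S then cis (t i) else x i))) \<in> borel_measurable (\<Pi>\<^sub>M i\<in>insert k S. lborel)"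
      using insert.prems r by (intro torus_integrand_measurable cont) auto
    show "(\<lambda>t. (\<Prod>i\<in>insert k S. ennreal (C i) * circ_weight (t i)) *
          ennreal ((cmod (f (\<chi> i. of_real r * (if i \<in> insert k S then cis (t i) else x i))))\<^sup>2)) \<in> borel_measurable (\<Pi>\<^sub>M i\<in>insert k S. lborel)"
      by measurable
  qed
  finally show ?case .
qed

lemma tensor_functional_dilated:
  fixes f :: "'n::finite hfun"
  assumes f: "holo_polydisk f" and r: "0 < r" "r < 1"
    and B: "\<And>i. disc_bound (P i) (c i) (C i)"
  shows "(cmod (\<Sum>p\<in>Pi\<^sub>E UNIV P. (\<Prod>i\<in>UNIV. c i (p i)) * f (\<chi> i. of_real r * p i)))\<^sup>2
     \<le> (\<Prod>i\<in>UNIV. C i) * torus_mean f r"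
proof -
  have C: "0 \<le> C i" for i using B unfolding disc_bound_def by auto
  have cont: "continuous_on polydisk f" by (rule holo_polydisk_continuous[OF f])
  have [measurable]: "(\<lambda>t. f (\<chi> i. of_real r * cis (t i))) \<in> borel_measurable (\<Pi>\<^sub>M i\<in>UNIV. lborel)"
    using torus_integrand_measurable[OF cont, of r "\<lambda>_. 0" UNIV] r by simp
  have "ennreal ((cmod (\<Sum>p\<in>Pi\<^sub>E UNIV P. (\<Prod>i\<in>UNIV. c i (p i)) * f (\<chi> i. of_real r * p i)))\<^sup>2)
     \<le> (\<integral>\<^sup>+t. (\<Prod>i\<in>UNIV. ennreal (C i) * circ_weight (t i)) *
          ennreal ((cmod (f (\<chi> i. of_real r * cis (t i))))\<^sup>2) \<partial>(\<Pi>\<^sub>M i\<in>UNIV. lborel))"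
    using tensor_functional_partial[OF f r B, of UNIV "\<lambda>_. 0"] by simp
  also have "\<dots> = (\<Prod>i\<in>UNIV. ennreal (C i)) * ennreal (torus_mean f r)"
    using r unfolding torus_mean_eq_nn_integral[OF cont less_imp_le[OF r(1)] r(2)] prod.distrib mult.assoc
    by (subst nn_integral_cmult) auto
  also have "\<dots> = ennreal ((\<Prod>i\<in>UNIV. C i) * torus_mean f r)"
    using r torus_mean_nonneg[OF cont, of r] by (simp add: prod_ennreal C prod_nonneg ennreal_mult)
  finally show ?thesis using r by (simp add: torus_mean_nonneg[OF cont] prod_nonneg C)
qed

text \<open>Only finitely many interior points are evaluated, so letting r tend to 1 takes no more
  than continuity of \<open>f\<close>.\<close>

lemma tensor_functional:
  fixes f :: "'n::finite hfun"
  assumes f: "holo_polydisk f"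
    and M: "\<And>r. 0 < r \<Longrightarrow> r < 1 \<Longrightarrow> torus_mean f r \<le> M"
    and B: "\<And>i. disc_bound (P i) (c i) (C i)"
  shows "(cmod (\<Sum>p\<in>Pi\<^sub>E UNIV P. (\<Prod>i\<in>UNIV. c i (p i)) * f (\<chi> i. p i)))\<^sup>2 \<le> (\<Prod>i\<in>UNIV. C i) * M"
proof -
  have C: "0 \<le> C i" and P: "P i \<subseteq> ball 0 1" for i using B unfolding disc_bound_def by auto
  define g where "g = (\<lambda>r. (cmod (\<Sum>p\<in>Pi\<^sub>E UNIV P. (\<Prod>i\<in>UNIV. c i (p i)) * f (\<chi> i. of_real r * p i)))\<^sup>2)"
  have "((\<lambda>r. f (\<chi> i. of_real r * p i)) \<longlongrightarrow> f (\<chi> i. of_real 1 * p i)) (at_left 1)" if p: "p \<in> Pi\<^sub>E UNIV P" for p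
  proof -
    have "(\<chi> i. of_real 1 * p i) \<in> polydisk" using p P unfolding polydisk_def by (auto simp: PiE_iff) (metis mem_ball_0 subsetD)
    then have 1: "isCont f (\<chi> i. of_real 1 * p i)"
      using holo_polydisk_continuous[OF f] open_polydisk continuous_on_eq_continuous_at by blast
    have "((\<lambda>r::real. complex_of_real r) \<longlongrightarrow> of_real 1) (at_left 1)"
      by (intro tendsto_intros)
    then have 2: "((\<lambda>r. \<chi> i. complex_of_real r * p i) \<longlongrightarrow> (\<chi> i. of_real 1 * p i)) (at_left 1)"
      by (intro tendsto_vec_lambda tendsto_mult tendsto_const)
    show ?thesis by (rule isCont_tendsto_compose[OF 1 2])
  qed
  then have "(g \<longlongrightarrow> g 1) (at_left 1)" unfolding g_def
    by (intro tendsto_power tendsto_norm tendsto_sum tendsto_mult tendsto_const)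
  moreover have "eventually (\<lambda>r. g r \<le> (\<Prod>i\<in>UNIV. C i) * M) (at_left 1)"
    using eventually_at_left_real[of 0 1, OF zero_less_one]
  proof eventually_elim
    case (elim r)
    then have "g r \<le> (\<Prod>i\<in>UNIV. C i) * torus_mean f r"
      unfolding g_def by (intro tensor_functional_dilated[OF f _ _ B]) auto
    also have "\<dots> \<le> (\<Prod>i\<in>UNIV. C i) * M"
      using elim M[of r] by (intro mult_left_mono prod_nonneg) (auto simp: C)
    finally show ?case .
  qed
  ultimately have "g 1 \<le> (\<Prod>i\<in>UNIV. C i) * M"
    by (rule tendsto_upperbound) simp
  then show ?thesis unfolding g_def by simp
qed

lemma disc_bound_point:
  assumes "cmod v < 1" shows "disc_bound {v} (\<lambda>_. 1) (1 / (1 - (cmod v)\<^sup>2))"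
  using assms point_eval_bound[OF _ assms] one_minus_norm_sq_pos[OF assms] unfolding disc_bound_def by auto

lemma polydisk_point_bound:
  fixes f :: "'n::finite hfun"
  assumes f: "holo_polydisk f" and v: "v \<in> polydisk"
    and M: "\<And>r. 0 < r \<Longrightarrow> r < 1 \<Longrightarrow> torus_mean f r \<le> M"
  shows "(cmod (f v))\<^sup>2 \<le> (\<Prod>i\<in>UNIV. 1 / (1 - (cmod (v $ i))\<^sup>2)) * M"
proof -
  have "disc_bound {v $ i} (\<lambda>_. 1) (1 / (1 - (cmod (v $ i))\<^sup>2))" for i
    using v by (intro disc_bound_point) (auto simp: polydisk_def)
  from tensor_functional[where P = "\<lambda>i. {v $ i}", OF f M this]
  have "(cmod (\<Sum>p\<in>(\<Pi>\<^sub>E i\<in>UNIV. {v $ i}). f (\<chi> i. p i)))\<^sup>2 \<le> (\<Prod>i\<in>UNIV. 1 / (1 - (cmod (v $ i))\<^sup>2)) * M"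
    by simp
  moreover have "(\<Pi>\<^sub>E i\<in>UNIV. {v $ i}) = {\<lambda>i. v $ i}" by (auto simp: PiE_iff)
  ultimately show ?thesis by simp
qed

text \<open>Squared norms multiply, so a tensor product with an error factor in some coordinate
  gains the squared Blaschke product there, while point evaluation weights cover the rest. Fewer
  than 2^d such terms occur, d being the number of coordinates, whence 4^d after squaring. The
  functions \<open>c\<close> are fixed before \<open>f\<close>, \<open>M\<close> and
  \<open>v\<close> and thus define one linear operator.\<close>

lemma grid_interpolation:
  assumes A: "finite A" "A \<subseteq> ball 0 1"
  obtains c where "\<And>a. a \<in> A \<Longrightarrow> c a analytic_on cball 0 1"
    "\<And>(f :: 'n::finite hfun) M v. holo_polydisk f \<Longrightarrow> (\<And>r. 0 < r \<Longrightarrow> r < 1 \<Longrightarrow> torus_mean f r \<le> M) \<Longrightarrow> v \<in> polydisk \<Longrightarrow>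
      (cmod (f v - (\<Sum>p\<in>(\<Pi>\<^sub>E i\<in>UNIV. A). (\<Prod>i\<in>UNIV. c (p i) (v $ i)) * f (\<chi> i. p i))))\<^sup>2
       \<le> 4 ^ CARD('n) * (\<Sum>i\<in>UNIV. (cmod (\<Prod>a\<in>A. blaschke a (v $ i)))\<^sup>2) * (\<Prod>i\<in>UNIV. 1 / (1 - (cmod (v $ i))\<^sup>2)) * M"
proof -
  from blaschke_interpolation[OF A] obtain c where cA: "\<forall>a\<in>A. c a analytic_on cball 0 1"
    and cq: "\<forall>h. h analytic_on cball 0 1 \<longrightarrow> (\<exists>q. q analytic_on cball 0 1 \<and> circ_mean q \<le> circ_mean h \<and>
       (\<forall>v. cmod v \<le> 1 \<longrightarrow> h v - (\<Sum>a\<in>A. c a v * h a) = (\<Prod>a\<in>A. blaschke a v) * q v))"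
    by (elim exE conjE) (rule that)
  note c = cA[rule_format]
  define \<beta> where "\<beta> = (\<lambda>v. (cmod (\<Prod>a\<in>A. blaschke a v))\<^sup>2)"
  have \<beta>: "0 \<le> \<beta> v" "cmod v < 1 \<Longrightarrow> \<beta> v \<le> 1" for v
    using norm_prod_blaschke_le_1[OF A(2), of v] unfolding \<beta>_def by (auto simp: power_le_one)
  \<comment> \<open>Evaluation at \<open>v\<close> and interpolated evaluation at \<open>v\<close>,
    both written on the point set \<open>insert v A\<close> so that their difference is again a
    functional on it; \<open>v\<close> may itself be a node.\<close>
  define E R :: "complex \<Rightarrow> complex \<Rightarrow> complex"
    where "E = (\<lambda>v p. if p = v then 1 else 0)" and "R = (\<lambda>v p. if p \<in> A then c p v else 0)"
  have Esum: "(\<Sum>p\<in>insert v A. E v p * h p) = h v" for v h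
    using A(1) unfolding E_def by (simp add: if_distrib[of "\<lambda>x. x * _"] sum.delta cong: if_cong)
  have Rsum: "(\<Sum>p\<in>insert v A. R v p * h p) = (\<Sum>p\<in>A. c p v * h p)" for v h
    using A(1) by (intro sum.mono_neutral_cong_right) (auto simp: R_def)
  have dE: "disc_bound (insert v A) (E v) (1 / (1 - (cmod v)\<^sup>2))" if "cmod v < 1" for v
    using that A point_eval_bound[OF _ that] one_minus_norm_sq_pos[OF that] unfolding disc_bound_def by (auto simp: Esum)
  \<comment> \<open>Up to sign the error functional is the Blaschke product at \<open>v\<close>
    times the value of the quotient at \<open>v\<close>, and the quotient has no larger mean than
    \<open>h\<close>.\<close>
  have dQ: "disc_bound (insert v A) (\<lambda>p. R v p - E v p) (\<beta> v * (1 / (1 - (cmod v)\<^sup>2)))" if v: "cmod v < 1" for v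
    unfolding disc_bound_def
  proof (intro conjI allI impI)
    show "finite (insert v A)" "insert v A \<subseteq> ball 0 1" using A v by auto
    show "0 \<le> \<beta> v * (1 / (1 - (cmod v)\<^sup>2))" using \<beta> one_minus_norm_sq_pos[OF v] by simp
    fix h :: "complex \<Rightarrow> complex" assume h: "h analytic_on cball 0 1"
    obtain q where q: "q analytic_on cball 0 1" "circ_mean q \<le> circ_mean h"
      "\<forall>v. cmod v \<le> 1 \<longrightarrow> h v - (\<Sum>a\<in>A. c a v * h a) = (\<Prod>a\<in>A. blaschke a v) * q v"
      using cq[rule_format, OF h] by (elim exE conjE) (rule that)
    have "(\<Sum>p\<in>insert v A. (R v p - E v p) * h p) = - ((\<Prod>a\<in>A. blaschke a v) * q v)"
      using q(3)[rule_format, of v] v unfolding left_diff_distrib sum_subtractf Esum Rsum by (simp add: algebra_simps)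
    then have "(cmod (\<Sum>p\<in>insert v A. (R v p - E v p) * h p))\<^sup>2 = \<beta> v * (cmod (q v))\<^sup>2"
      unfolding \<beta>_def by (simp add: norm_mult power_mult_distrib)
    also have "\<dots> \<le> \<beta> v * (circ_mean h / (1 - (cmod v)\<^sup>2))"
      using one_minus_norm_sq_pos[OF v] \<beta>
      by (intro mult_left_mono order_trans[OF point_eval_bound[OF q(1) v] divide_right_mono[OF q(2)]]) auto
    finally show "(cmod (\<Sum>p\<in>insert v A. (R v p - E v p) * h p))\<^sup>2 \<le> \<beta> v * (1 / (1 - (cmod v)\<^sup>2)) * circ_mean h"
      by simp
  qed
  have main: "(cmod (f v - (\<Sum>p\<in>(\<Pi>\<^sub>E i\<in>UNIV. A). (\<Prod>i\<in>UNIV. c (p i) (v $ i)) * f (\<chi> i. p i))))\<^sup>2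
       \<le> 4 ^ CARD('n) * (\<Sum>i\<in>UNIV. \<beta> (v $ i)) * (\<Prod>i\<in>UNIV. 1 / (1 - (cmod (v $ i))\<^sup>2)) * M"
    if f: "holo_polydisk f" and M: "\<And>r. 0 < r \<Longrightarrow> r < 1 \<Longrightarrow> torus_mean f r \<le> M" and v: "v \<in> polydisk" 
    for f :: "'n hfun" and M v
  proof -
    have v1: "cmod (v $ i) < 1" for i using v unfolding polydisk_def by auto
    have "0 \<le> torus_mean f (1/2)" by (intro torus_mean_nonneg holo_polydisk_continuous f) auto
    also have "\<dots> \<le> M" by (rule M) auto
    finally have M0: "0 \<le> M" .
    define W where "W = (\<Prod>i\<in>UNIV. 1 / (1 - (cmod (v $ i))\<^sup>2))"
    have W: "0 \<le> W" unfolding W_def using one_minus_norm_sq_pos[OF v1] by (intro prod_nonneg) (simp add: less_imp_le)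
    define X where "X = (\<Sum>i\<in>UNIV. \<beta> (v $ i)) * W * M"
    define P where "P = (\<lambda>i. insert (v $ i) A)"
    define T where "T = (\<lambda>S. \<Sum>p\<in>Pi\<^sub>E UNIV P. (\<Prod>i\<in>UNIV. if i \<in> S then R (v $ i) (p i) - E (v $ i) (p i) else E (v $ i) (p i)) * f (\<chi> i. p i))"
    have T: "(cmod (T S))\<^sup>2 \<le> (\<Prod>i\<in>UNIV. (if i \<in> S then \<beta> (v $ i) else 1) * (1 / (1 - (cmod (v $ i))\<^sup>2))) * M" for S
    proof -
      have d: "disc_bound (P i) (if i \<in> S then (\<lambda>p. R (v $ i) p - E (v $ i) p) else E (v $ i))
        ((if i \<in> S then \<beta> (v $ i) else 1) * (1 / (1 - (cmod (v $ i))\<^sup>2)))" for i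
        using dE[OF v1, of i] dQ[OF v1, of i] unfolding P_def by simp
      have "(\<Prod>i\<in>UNIV. (if i \<in> S then (\<lambda>p. R (v $ i) p - E (v $ i) p) else E (v $ i)) (p i)) =
        (\<Prod>i\<in>UNIV. if i \<in> S then R (v $ i) (p i) - E (v $ i) (p i) else E (v $ i) (p i))" for p
        by (intro prod.cong) auto
      then show ?thesis unfolding T_def
        using tensor_functional[where P = P and c = "\<lambda>i. if i \<in> S then (\<lambda>p. R (v $ i) p - E (v $ i) p) else E (v $ i)"
          and C = "\<lambda>i. (if i \<in> S then \<beta> (v $ i) else 1) * (1 / (1 - (cmod (v $ i))\<^sup>2))", OF f M d]
        by (simp only:)
    qed
    have TX: "cmod (T S) \<le> sqrt X" if S: "S \<noteq> {}" for S
    proof (rule real_le_rsqrt)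
      obtain k where k: "k \<in> S" using S by auto
      have "(cmod (T S))\<^sup>2 \<le> (\<Prod>i\<in>UNIV. (if i \<in> S then \<beta> (v $ i) else 1)) * W * M"
        using T[of S] unfolding W_def prod.distrib .
      \<comment> \<open>The factor of one index in \<open>S\<close> is kept and the others are at
        most 1; passing to the sum over all coordinates makes the bound the same for every nonempty
        \<open>S\<close>.\<close>
      also have "(\<Prod>i\<in>UNIV. (if i \<in> S then \<beta> (v $ i) else 1)) \<le> (\<Sum>i\<in>UNIV. \<beta> (v $ i))"
      proof -
        have "(\<Prod>i\<in>UNIV. (if i \<in> S then \<beta> (v $ i) else 1)) = \<beta> (v $ k) * (\<Prod>i\<in>UNIV - {k}. (if i \<in> S then \<beta> (v $ i) else 1))"
          using k by (subst prod.remove[of _ k]) auto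
        also have "\<dots> \<le> \<beta> (v $ k) * 1"
          using \<beta> v1 by (intro mult_left_mono prod_le_1) auto
        also have "\<dots> \<le> (\<Sum>i\<in>UNIV. \<beta> (v $ i))" using \<beta> member_le_sum[of k UNIV "\<lambda>i. \<beta> (v $ i)"] by simp
        finally show ?thesis .
      qed
      finally show "(cmod (T S))\<^sup>2 \<le> X" unfolding X_def using W M0 by (simp add: mult_right_mono)
    qed
    have PT: "T {} = f v"
    proof -
      have "T {} = (\<Sum>p\<in>{\<lambda>i. v $ i}. (\<Prod>i\<in>UNIV. E (v $ i) (p i)) * f (\<chi> i. p i))"
        unfolding T_def
      proof (rule sum.mono_neutral_cong_right)
        show "finite (Pi\<^sub>E UNIV P)" using A unfolding P_def by (intro finite_PiE) auto
        show "{\<lambda>i. v $ i} \<subseteq> Pi\<^sub>E UNIV P" unfolding P_def by auto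
        show "\<forall>p\<in>Pi\<^sub>E UNIV P - {\<lambda>i. v $ i}. (\<Prod>i\<in>UNIV. if i \<in> {} then R (v $ i) (p i) - E (v $ i) (p i) else E (v $ i) (p i)) * f (\<chi> i. p i) = 0"
          unfolding E_def by (auto simp: fun_eq_iff)
      qed simp
      then show ?thesis unfolding E_def by simp
    qed
    have "(\<Sum>p\<in>(\<Pi>\<^sub>E i\<in>UNIV. A). (\<Prod>i\<in>UNIV. c (p i) (v $ i)) * f (\<chi> i. p i)) = (\<Sum>p\<in>Pi\<^sub>E UNIV P. (\<Prod>i\<in>UNIV. R (v $ i) (p i)) * f (\<chi> i. p i))"
    proof (rule sum.mono_neutral_cong_left)
      show "finite (Pi\<^sub>E UNIV P)" using A unfolding P_def by (intro finite_PiE) auto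
      show "(\<Pi>\<^sub>E i\<in>UNIV. A) \<subseteq> Pi\<^sub>E UNIV P" unfolding P_def by (intro PiE_mono) auto
      show "\<forall>p\<in>Pi\<^sub>E UNIV P - (\<Pi>\<^sub>E i\<in>UNIV. A). (\<Prod>i\<in>UNIV. R (v $ i) (p i)) * f (\<chi> i. p i) = 0"
        unfolding R_def by (auto simp: PiE_iff)
      show "(\<Prod>i\<in>UNIV. c (p i) (v $ i)) * f (\<chi> i. p i) = (\<Prod>i\<in>UNIV. R (v $ i) (p i)) * f (\<chi> i. p i)" if "p \<in> (\<Pi>\<^sub>E i\<in>UNIV. A)" for p
        using that unfolding R_def by (auto simp: PiE_iff)
    qed
    \<comment> \<open>Expand the product of the factors \<open>R = (R - E) + E\<close>: the term without error factor is \<open>f v\<close>, every other term is small.\<close>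
    also have "\<dots> = (\<Sum>S\<in>Pow UNIV. T S)"
    proof -
      have "(\<Prod>i\<in>UNIV. R (v $ i) (p i)) = (\<Sum>S\<in>Pow UNIV. \<Prod>i\<in>UNIV. if i \<in> S then R (v $ i) (p i) - E (v $ i) (p i) else E (v $ i) (p i))" for p
      proof -
        have "(\<Prod>i\<in>UNIV. R (v $ i) (p i)) = (\<Prod>i\<in>UNIV. (R (v $ i) (p i) - E (v $ i) (p i)) + E (v $ i) (p i))" by simp
        also have "\<dots> = (\<Sum>S\<in>Pow UNIV. (\<Prod>i\<in>S. R (v $ i) (p i) - E (v $ i) (p i)) * (\<Prod>i\<in>UNIV - S. E (v $ i) (p i)))"
          by (rule prod_add) simp
        also have "\<dots> = (\<Sum>S\<in>Pow UNIV. \<Prod>i\<in>UNIV. if i \<in> S then R (v $ i) (p i) - E (v $ i) (p i) else E (v $ i) (p i))"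
          by (intro sum.cong refl) (simp add: prod.If_cases Compl_eq_Diff_UNIV)
        finally show ?thesis .
      qed
      then show ?thesis unfolding T_def by (simp only: sum_distrib_right) (rule sum.swap)
    qed
    also have "\<dots> = f v + (\<Sum>S\<in>Pow UNIV - {{}}. T S)"
      unfolding PT[symmetric] by (rule sum.remove) auto
    finally have "cmod (f v - (\<Sum>p\<in>(\<Pi>\<^sub>E i\<in>UNIV. A). (\<Prod>i\<in>UNIV. c (p i) (v $ i)) * f (\<chi> i. p i))) = cmod (\<Sum>S\<in>Pow UNIV - {{}}. T S)"
      by simp
    also have "\<dots> \<le> (\<Sum>S\<in>Pow (UNIV::'n set) - {{}}. sqrt X)" by (intro sum_norm_le TX) auto
    also have "\<dots> \<le> (\<Sum>S\<in>Pow (UNIV::'n set). sqrt X)"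
      unfolding X_def using W M0 \<beta> by (intro sum_mono2) (auto intro!: mult_nonneg_nonneg sum_nonneg)
    also have "\<dots> = 2 ^ CARD('n) * sqrt X" by (simp add: card_Pow)
    finally have "(cmod (f v - (\<Sum>p\<in>(\<Pi>\<^sub>E i\<in>UNIV. A). (\<Prod>i\<in>UNIV. c (p i) (v $ i)) * f (\<chi> i. p i))))\<^sup>2 \<le> (2 ^ CARD('n) * sqrt X)\<^sup>2"
      by (intro power_mono) auto
    also have "\<dots> = (2 ^ CARD('n))\<^sup>2 * X"
    proof -
      have "0 \<le> X" using W M0 \<beta> unfolding X_def by (simp add: sum_nonneg)
      then show ?thesis by (simp add: power_mult_distrib)
    qed
    also have "(2 ^ CARD('n))\<^sup>2 = (4::real) ^ CARD('n)"
      using power_mult[of "2::real" 2 "CARD('n)"] power_mult[of "2::real" "CARD('n)" 2] by (simp add: mult.commute)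
    finally show ?thesis unfolding X_def W_def by (simp add: mult.assoc)
  qed
  show thesis by (rule that[OF c main[unfolded \<beta>_def]])
qed

section \<open>The lens map\<close>

definition lens_power :: "real \<Rightarrow> complex \<Rightarrow> complex" where
  "lens_power \<theta> z = ((1 + z) / (1 - z)) powr of_real \<theta>"

lemma cayley_Re_pos:
  assumes "cmod z < 1" shows "0 < Re ((1 + z) / (1 - z))"
proof -
  have "Re z < 1" using complex_Re_le_cmod[of z] assms by linarith
  then have "1 - z \<noteq> 0" by auto
  have "(cmod z)\<^sup>2 < 1" using assms by (simp add: power_less_one_iff)
  then have "0 < Re ((1 + z) * cnj (1 - z))" unfolding cmod_power2 by (simp add: algebra_simps power2_eq_square)
  then have "0 < Re ((1 + z) * cnj (1 - z)) / (cmod (1 - z))\<^sup>2" using \<open>1 - z \<noteq> 0\<close> by simp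
  also have "\<dots> = Re ((1 + z) / (1 - z))" by (metis Re_complex_div_gt_0 Re_divide_of_real complex_div_cnj of_real_power)
  finally show ?thesis .
qed

lemma one_minus_norm_cayley_sq:
  assumes "0 < Re q"
  shows "1 - (cmod ((q - 1) / (q + 1)))\<^sup>2 = 4 * Re q / (cmod (q + 1))\<^sup>2"
proof -
  have nz: "q + 1 \<noteq> 0" using assms by (auto simp: complex_eq_iff)
  have eq: "(cmod (q + 1))\<^sup>2 - (cmod (q - 1))\<^sup>2 = 4 * Re q"
    unfolding cmod_power2 by (simp add: algebra_simps power2_eq_square)
  have "1 - (cmod ((q - 1) / (q + 1)))\<^sup>2 = ((cmod (q + 1))\<^sup>2 - (cmod (q - 1))\<^sup>2) / (cmod (q + 1))\<^sup>2"
    unfolding norm_divide power_divide using nz by (simp add: diff_divide_distrib[of "(cmod (q + 1))\<^sup>2"])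
  then show ?thesis unfolding eq .
qed

lemma cmod_one_minus_square: "cmod (1 - z\<^sup>2) = cmod (1 - z) * cmod (1 + z)"
  unfolding norm_mult[symmetric] by (simp add: algebra_simps power2_eq_square)

text \<open>\<open>cmod (1 - z\<^sup>2)\<close> is comparable to the distance to the nearer contact
  point. As |1 - z| and |1 + z| are at most 2, it keeps the half-plane coordinate away from 0 and
  from infinity at once.\<close>

lemma cayley_norm_bounds:
  assumes "cmod z < 1"
  shows "cmod (1 - z\<^sup>2) / 4 \<le> cmod ((1 + z) / (1 - z))"
    and "cmod (1 - z\<^sup>2) / 4 \<le> 1 / cmod ((1 + z) / (1 - z))"
    and "0 < cmod (1 - z\<^sup>2)"
proof -
  have nz: "1 - z \<noteq> 0" "1 + z \<noteq> 0" using assms by (auto simp: add_eq_0_iff)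
  have le: "cmod (1 - z) \<le> 2" "cmod (1 + z) \<le> 2"
    using norm_triangle_ineq4[of 1 z] norm_triangle_ineq[of 1 z] assms by simp_all
  have "cmod (1 - z) * cmod (1 - z) \<le> 2 * 2" "cmod (1 + z) * cmod (1 + z) \<le> 2 * 2"
    using le by (intro mult_mono; simp)+
  then show "cmod (1 - z\<^sup>2) / 4 \<le> cmod ((1 + z) / (1 - z))" "cmod (1 - z\<^sup>2) / 4 \<le> 1 / cmod ((1 + z) / (1 - z))"
    unfolding cmod_one_minus_square norm_divide using nz by (simp_all add: field_simps)
  show "0 < cmod (1 - z\<^sup>2)" unfolding cmod_one_minus_square using nz by simp
qed

context
  fixes \<theta> :: real
  assumes \<theta>: "0 < \<theta>" "\<theta> < 1"
begin

lemma cos_half_pos: "0 < cos (\<theta> * pi / 2)"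
  using \<theta> pi_gt_zero by (intro cos_gt_zero) (auto simp: mult_less_cancel_right1)

text \<open>The half-plane coordinate has argument below pi / 2 in modulus, so its \<theta>-th power
  lies in the sector of half-angle \<theta> * pi / 2. As \<theta> < 1, real part and modulus are
  comparable there.\<close>

lemma lens_power_sector:
  assumes "cmod z < 1"
  shows "cos (\<theta> * pi / 2) * cmod (lens_power \<theta> z) \<le> Re (lens_power \<theta> z)"
    and "cmod (lens_power \<theta> z) = cmod ((1 + z) / (1 - z)) powr \<theta>"
    and "0 < cmod (lens_power \<theta> z)"
    and "0 < Re (lens_power \<theta> z)"
proof -
  define p where "p = (1 + z) / (1 - z)"
  have p: "0 < Re p" unfolding p_def by (rule cayley_Re_pos[OF assms])
  then have p0: "p \<noteq> 0" by auto
  have q: "lens_power \<theta> z = exp (of_real \<theta> * Ln p)" using p0 unfolding lens_power_def p_def powr_def by simp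
  show nq: "cmod (lens_power \<theta> z) = cmod ((1 + z) / (1 - z)) powr \<theta>"
    unfolding lens_power_def by (subst norm_powr_real_powr') auto
  show q0: "0 < cmod (lens_power \<theta> z)" unfolding q by simp
  have "\<bar>Im (Ln p)\<bar> < pi / 2" using Re_Ln_pos_lt[OF p0] p by simp
  then have "\<bar>\<theta> * Im (Ln p)\<bar> \<le> \<theta> * pi / 2" using \<theta> by (simp add: abs_mult)
  moreover have "\<theta> * pi / 2 \<le> pi" using \<theta> by simp
  ultimately have "cos (\<theta> * pi / 2) \<le> cos \<bar>\<theta> * Im (Ln p)\<bar>"
    by (intro cos_monotone_0_pi_le) auto
  moreover have "Re (lens_power \<theta> z) = cmod (lens_power \<theta> z) * cos (\<theta> * Im (Ln p))"
    unfolding q Re_exp norm_exp_eq_Re by simp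
  ultimately show 1: "cos (\<theta> * pi / 2) * cmod (lens_power \<theta> z) \<le> Re (lens_power \<theta> z)"
    using q0 by (simp add: mult.commute mult_left_mono)
  show "0 < Re (lens_power \<theta> z)" using 1 q0 cos_half_pos by (meson less_le_trans mult_pos_pos)
qed

text \<open>Numerator and denominator are divided by (1 - z) powr \<theta>. The principal powers are
  multiplicative here because both arguments stay below pi / 2 in modulus.\<close>

lemma lens_map_eq:
  assumes "cmod z < 1"
  shows "lens_map \<theta> z = (lens_power \<theta> z - 1) / (lens_power \<theta> z + 1)"
proof -
  define p where "p = (1 + z) / (1 - z)"
  have p: "0 < Re p" unfolding p_def by (rule cayley_Re_pos[OF assms])
  then have p0: "p \<noteq> 0" by auto
  have z1: "0 < Re (1 - z)" using complex_Re_le_cmod[of z] assms by simp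
  then have z0: "1 - z \<noteq> 0" by auto
  have "\<bar>Im (Ln p)\<bar> < pi / 2" "\<bar>Im (Ln (1 - z))\<bar> < pi / 2"
    using Re_Ln_pos_lt[OF p0] p Re_Ln_pos_lt[OF z0] z1 by auto
  then have "Ln (p * (1 - z)) = Ln p + Ln (1 - z)"
    by (subst Ln_times_simple[OF p0 z0]) auto
  moreover have "p * (1 - z) = 1 + z" unfolding p_def using z0 by simp
  ultimately have "(1 + z) powr of_real \<theta> = lens_power \<theta> z * (1 - z) powr of_real \<theta>"
    using p0 z0 unfolding lens_power_def p_def[symmetric] powr_def by (auto simp: distrib_left exp_add)
  then have "lens_map \<theta> z = ((lens_power \<theta> z - 1) * (1 - z) powr of_real \<theta>) / ((lens_power \<theta> z + 1) * (1 - z) powr of_real \<theta>)"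
    unfolding lens_map_def by (simp add: algebra_simps)
  then show ?thesis using z0 by simp
qed

text \<open>With q = \<open>lens_power \<theta> z\<close> and m = |q|, the defect is 4 Re q / |q +
  1|^2, which in the sector is at least of order min m (1 / m); |1 - z^2| controls both m and 1 / m
  from below. The denominator 4 absorbs 4 powr \<theta>.\<close>

lemma lens_map_defect:
  assumes z: "cmod z < 1"
  shows "cos (\<theta> * pi / 2) / 4 * cmod (1 - z\<^sup>2) powr \<theta> \<le> 1 - (cmod (lens_map \<theta> z))\<^sup>2"
proof -
  define q where "q = lens_power \<theta> z"
  define m where "m = cmod q"
  note q = lens_power_sector[OF z, folded q_def]
  define \<delta> where "\<delta> = (cmod (1 - z\<^sup>2) / 4) powr \<theta>"
  have \<delta>m: "\<delta> \<le> m" "\<delta> \<le> 1 / m"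
  proof -
    show "\<delta> \<le> m" unfolding \<delta>_def m_def q(2) using cayley_norm_bounds[OF z] \<theta> by (intro powr_mono2) auto
    have "\<delta> \<le> (1 / cmod ((1 + z) / (1 - z))) powr \<theta>"
      unfolding \<delta>_def using cayley_norm_bounds[OF z] \<theta> by (intro powr_mono2) auto
    then show "\<delta> \<le> 1 / m" unfolding m_def q(2) by (simp add: powr_divide)
  qed
  have m: "0 < m" using q unfolding m_def by simp
  have "\<delta> * (m + 1)\<^sup>2 \<le> 4 * m"
  proof (cases "m \<le> 1")
    case True
    have "(m + 1)\<^sup>2 \<le> 2\<^sup>2" using m True by (intro power_mono) auto
    then have "\<delta> * (m + 1)\<^sup>2 \<le> m * 4" using \<delta>m m by (intro mult_mono) auto
    then show ?thesis by simp
  next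
    case False
    then have "(m + 1)\<^sup>2 \<le> (2 * m)\<^sup>2" by (intro power_mono) auto
    then have "\<delta> * (m + 1)\<^sup>2 \<le> 1 / m * (2 * m)\<^sup>2" using \<delta>m m by (intro mult_mono) auto
    then show ?thesis using m by (simp add: power2_eq_square)
  qed
  moreover have "\<delta> * (cmod (q + 1))\<^sup>2 \<le> \<delta> * (m + 1)\<^sup>2"
    unfolding m_def using norm_triangle_ineq[of q 1] by (intro mult_left_mono power_mono) (auto simp: \<delta>_def)
  ultimately have "\<delta> * (cmod (q + 1))\<^sup>2 \<le> 4 * m" by linarith
  moreover have "q + 1 \<noteq> 0" using q(4) by (auto simp: complex_eq_iff)
  ultimately have "\<delta> \<le> 4 * m / (cmod (q + 1))\<^sup>2" by (simp add: field_simps)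
  then have "cos (\<theta> * pi / 2) * \<delta> \<le> cos (\<theta> * pi / 2) * (4 * m / (cmod (q + 1))\<^sup>2)"
    using cos_half_pos by (intro mult_left_mono) auto
  also have "\<dots> = 4 * (cos (\<theta> * pi / 2) * m) / (cmod (q + 1))\<^sup>2" by simp
  also have "\<dots> \<le> 4 * Re q / (cmod (q + 1))\<^sup>2" using q(1) unfolding m_def by (intro divide_right_mono mult_left_mono) auto
  also have "\<dots> = 1 - (cmod (lens_map \<theta> z))\<^sup>2"
    unfolding lens_map_eq[OF z] q_def[symmetric] one_minus_norm_cayley_sq[OF q(4)] ..
  finally have "cos (\<theta> * pi / 2) * \<delta> \<le> 1 - (cmod (lens_map \<theta> z))\<^sup>2" .
  moreover have "cmod (1 - z\<^sup>2) powr \<theta> / 4 \<le> \<delta>"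
  proof -
    have "4 powr \<theta> \<le> 4 powr (1::real)" using \<theta> by (intro powr_mono) auto
    then show ?thesis unfolding \<delta>_def powr_divide by (intro divide_left_mono) auto
  qed
  then have "cos (\<theta> * pi / 2) * (cmod (1 - z\<^sup>2) powr \<theta> / 4) \<le> cos (\<theta> * pi / 2) * \<delta>"
    using cos_half_pos by (intro mult_left_mono) auto
  ultimately show ?thesis by simp
qed

lemma norm_lens_map_less_1:
  assumes z: "cmod z < 1" shows "cmod (lens_map \<theta> z) < 1"
proof -
  have "0 < cos (\<theta> * pi / 2) / 4 * cmod (1 - z\<^sup>2) powr \<theta>"
    using cos_half_pos cayley_norm_bounds(3)[OF z] by simp
  also have "\<dots> \<le> 1 - (cmod (lens_map \<theta> z))\<^sup>2" by (rule lens_map_defect[OF z])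
  finally show ?thesis using abs_square_less_1[of "cmod (lens_map \<theta> z)"] by simp
qed

lemma lens_map_holomorphic: "lens_map \<theta> holomorphic_on ball 0 1"
proof -
  have "(\<lambda>z. (lens_power \<theta> z - 1) / (lens_power \<theta> z + 1)) holomorphic_on ball 0 1"
  proof (intro holomorphic_intros)
    have "(\<lambda>z. ((1 + z) / (1 - z)) powr of_real \<theta>) holomorphic_on ball 0 1"
    proof (intro holomorphic_intros)
      fix z :: complex assume "z \<in> ball 0 1"
      then show "(1 + z) / (1 - z) \<notin> \<real>\<^sub>\<le>\<^sub>0" "1 - z \<noteq> 0"
        using cayley_Re_pos[of z] by (auto simp: complex_nonpos_Reals_iff)
    qed
    then show "lens_power \<theta> holomorphic_on ball 0 1" unfolding lens_power_def[abs_def] .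
    then show "lens_power \<theta> holomorphic_on ball 0 1" .
    fix z :: complex assume "z \<in> ball 0 1"
    then have "0 < Re (lens_power \<theta> z)" using lens_power_sector(4)[of z] by simp
    then show "lens_power \<theta> z + 1 \<noteq> 0"
      by (auto simp: complex_eq_iff)
  qed
  then show ?thesis by (rule holomorphic_transform) (simp add: lens_map_eq)
qed

end

section \<open>Nodes on the real diameter and their Blaschke products\<close>

definition node :: "real \<Rightarrow> complex" where
  "node x = of_real ((x - 1) / (x + 1))"

lemma norm_node: assumes "0 < x" shows "cmod (node x) < 1"
  unfolding node_def norm_of_real using assms by (auto simp: abs_less_iff field_simps)

lemma node_inj: "inj_on node {0<..}"
proof (rule inj_onI)
  fix x y :: real assume xy: "x \<in> {0<..}" "y \<in> {0<..}" and "node x = node y"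
  then have "(x - 1) / (x + 1) = (y - 1) / (y + 1)" unfolding node_def of_real_eq_iff by blast
  then have "(x - 1) * (y + 1) = (y - 1) * (x + 1)" using xy by (subst (asm) frac_eq_eq) auto
  then show "x = y" by (simp add: algebra_simps)
qed

text \<open>The Blaschke factor transported to the right half-plane by the Cayley transform: the
  node sits at the real point \<open>x\<close>, its reflection in the imaginary axis is - x, and for
  real nodes no unimodular factor appears.\<close>

lemma blaschke_node:
  assumes x: "0 < x" and q: "0 < Re q"
  shows "blaschke (node x) ((q - 1) / (q + 1)) = (q - of_real x) / (q + of_real x)"
proof -
  define y where "y = complex_of_real x"
  have nz: "q + 1 \<noteq> 0" "y + 1 \<noteq> 0" "q + y \<noteq> 0" using assms unfolding y_def by (auto simp: complex_eq_iff)
  have node: "node x = (y - 1) / (y + 1)" "cnj (node x) = node x"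
    unfolding node_def y_def by simp_all
  have e1: "(q - 1) / (q + 1) - (y - 1) / (y + 1) = 2 * (q - y) / ((q + 1) * (y + 1))"
    using nz by (simp add: field_simps)
  have e2: "1 - (y - 1) / (y + 1) * ((q - 1) / (q + 1)) = 2 * (q + y) / ((q + 1) * (y + 1))"
  proof -
    have "1 - (y - 1) / (y + 1) * ((q - 1) / (q + 1)) = ((q + 1) * (y + 1) - (y - 1) * (q - 1)) / ((q + 1) * (y + 1))"
      unfolding times_divide_times_eq using nz by (simp add: diff_divide_distrib[of "(q + 1) * (y + 1)"] mult.commute[of "y + 1"])
    also have "(q + 1) * (y + 1) - (y - 1) * (q - 1) = 2 * (q + y)" by (simp add: algebra_simps)
    finally show ?thesis .
  qed
  have "blaschke (node x) ((q - 1) / (q + 1)) = (2 * (q - y) / ((q + 1) * (y + 1))) / (2 * (q + y) / ((q + 1) * (y + 1)))"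
    unfolding blaschke_def node(2) unfolding node(1) e1 e2 ..
  also have "\<dots> = (q - y) / (q + y)"
  proof -
    have "(2 * a / d) / (2 * b / d) = a / b" if "d \<noteq> 0" for a b d :: complex using that by simp
    then show ?thesis using nz by (metis mult_eq_0_iff)
  qed
  finally show ?thesis unfolding y_def .
qed

lemma exp_add_exp_neg_le_4:
  assumes "\<bar>s\<bar> \<le> 1" shows "exp s + exp (-s) \<le> (4::real)"
proof -
  have "exp \<bar>s\<bar> \<le> exp 1" using assms by simp
  then have "exp \<bar>s\<bar> \<le> 3" using exp_le by linarith
  moreover have "exp (- \<bar>s\<bar>) \<le> 1" by simp
  ultimately have "exp \<bar>s\<bar> + exp (- \<bar>s\<bar>) \<le> 4" by linarith
  then show ?thesis by (cases "s \<ge> 0") (simp_all add: add.commute)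
qed

text \<open>With N = |q|^2 + x^2 and y = 2 x Re q the squared quotient is (N - y) / (N + y).
  Closeness of the logarithms gives N \<le> 4 |q| x and the sector gives y \<ge> 2 c |q| x, so y / N
  \<ge> c / 2, and the bound is (1 - c / 2) / (1 + c / 2).\<close>

lemma norm_sector_quotient_le:
  assumes x: "0 < x" and c: "0 < c" and q: "c * cmod q \<le> Re q" "0 < Re q" and s: "\<bar>ln (cmod q) - ln x\<bar> \<le> 1"
  shows "(cmod ((q - of_real x) / (q + of_real x)))\<^sup>2 \<le> (4 - 2 * c) / (4 + 2 * c)"
proof -
  define m where "m = cmod q"
  have m: "0 < m" using q unfolding m_def by (metis complex_Re_le_cmod less_le_trans)
  define N where "N = m\<^sup>2 + x\<^sup>2"
  define y where "y = 2 * x * Re q"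
  have y0: "0 < y" unfolding y_def using x q by simp
  have q0: "q + of_real x \<noteq> 0" using x q by (auto simp: complex_eq_iff)
  have "(cmod (q - of_real x))\<^sup>2 = N - y" "(cmod (q + of_real x))\<^sup>2 = N + y"
    unfolding N_def m_def y_def cmod_power2 by (simp_all add: algebra_simps power2_eq_square)
  moreover have "N = (exp (ln m - ln x) + exp (-(ln m - ln x))) * (m * x)"
    unfolding N_def using m x by (simp add: exp_diff field_simps power2_eq_square)
  then have "N \<le> 4 * (m * x)" using exp_add_exp_neg_le_4[OF s] m x unfolding m_def by (simp add: mult_right_mono)
  moreover have "2 * c * (m * x) \<le> y" using q(1) x unfolding y_def m_def by (simp add: mult.commute mult_left_mono mult.left_commute)
  ultimately have eq: "(cmod ((q - of_real x) / (q + of_real x)))\<^sup>2 = (N - y) / (N + y)" and Ny: "0 < N + y"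
     and Nc:     "N * c \<le> 2 * y"
    unfolding norm_divide power_divide using y0 m x c mult_right_mono[of N "4 * (m * x)" c] by (auto simp: N_def algebra_simps add_pos_pos)
  have "(N - y) * (4 + 2 * c) \<le> (4 - 2 * c) * (N + y)" using Nc by (simp add: algebra_simps)
  then show ?thesis unfolding eq using Ny c by (simp add: pos_divide_le_eq pos_le_divide_eq)
qed

text \<open>In the coordinate \<open>ln q\<close>, where \<open>q\<close> is the image in the right half-plane, the nodes are equally spaced with
  step \<open>1 / L\<close>; the range is chosen so that every \<open>s\<close> with \<open>\<bar>s\<bar> \<le> L + 2\<close> has \<open>L\<close> nodes within distance 1.\<close>

definition lens_nodes :: "nat \<Rightarrow> complex set" where
  "lens_nodes L = (\<lambda>j::int. node (exp (of_int j / of_nat L))) ` {- int (L * (L + 3))..<int (L * (L + 3))}"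

lemma finite_lens_nodes: "finite (lens_nodes L)" unfolding lens_nodes_def by simp

lemma lens_nodes_subset: "lens_nodes L \<subseteq> ball 0 1" unfolding lens_nodes_def by (auto intro!: norm_node)

lemma card_lens_nodes: "card (lens_nodes L) \<le> 8 * L\<^sup>2"
proof -
  have "card (lens_nodes L) \<le> 2 * (L * (L + 3))" unfolding lens_nodes_def
    by (rule order_trans[OF card_image_le]) (auto simp: nat_le_iff)
  \<comment> \<open>Uses L + 3 \<le> 4 L; for L = 0 both sides vanish.\<close>
  also have "\<dots> \<le> 8 * L\<^sup>2" by (cases L) (auto simp: power2_eq_square algebra_simps)
  finally show ?thesis .
qed

text \<open>The 2 bounds ln 4, the loss in \<open>cayley_norm_bounds\<close>; the power \<theta> < 1
  only shrinks the logarithm.\<close>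

lemma lens_power_ln_bound:
  assumes \<theta>: "0 < \<theta>" "\<theta> < 1" and z: "cmod z < 1" and L: "exp (- L) \<le> cmod (1 - z\<^sup>2)" and L0: "0 \<le> L"
  shows "\<bar>ln (cmod (lens_power \<theta> z))\<bar> \<le> L + 2"
proof -
  define m where "m = cmod ((1 + z) / (1 - z))"
  have b: "exp (-L) / 4 \<le> m" "exp (-L) / 4 \<le> 1 / m"
    using cayley_norm_bounds[OF z] L unfolding m_def by linarith+
  have "0 < exp (-L) / 4" by simp
  then have m: "0 < m" using b by linarith
  have l4: "ln (4::real) \<le> 2"
  proof -
    have "(4::real) \<le> (5/2)\<^sup>2" by (simp add: power2_eq_square)
    also have "\<dots> \<le> (exp 1)\<^sup>2" using exp_lower_Taylor_quadratic[of "1::real"] by (intro power_mono) auto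
    also have "\<dots> = exp 2" by (simp flip: exp_double)
    finally have "ln (4::real) \<le> ln (exp 2)" by (intro ln_mono) auto
    then show ?thesis by simp
  qed
  have "ln (exp (-L) / 4) \<le> ln m" using b(1) m by (intro ln_mono) auto
  then have "- L - 2 \<le> ln m" using l4 by (simp add: ln_div)
  moreover have "ln (exp (-L) / 4) \<le> ln (1 / m)" using b(2) m by (intro ln_mono) auto
  then have "ln m \<le> L + 2" using l4 m by (simp add: ln_div)
  ultimately have "\<bar>ln m\<bar> \<le> L + 2" by linarith
  moreover have "\<theta> * \<bar>ln m\<bar> \<le> 1 * \<bar>ln m\<bar>" using \<theta> by (intro mult_right_mono) auto
  moreover have "ln (cmod (lens_power \<theta> z)) = \<theta> * ln m"
    unfolding lens_power_sector(2)[OF \<theta> z] m_def[symmetric] using m by (simp add: ln_powr)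
  ultimately show ?thesis using \<theta> by (simp add: abs_mult)
qed

text \<open>Each of L nearby nodes contributes a factor bounded by the sector estimate, and all
  other factors are at most 1.\<close>

lemma lens_nodes_blaschke_small:
  assumes \<theta>: "0 < \<theta>" "\<theta> < 1" and z: "cmod z < 1" and L: "exp (- real L) \<le> cmod (1 - z\<^sup>2)"
  defines "c \<equiv> cos (\<theta> * pi / 2)"
  shows "(cmod (\<Prod>a\<in>lens_nodes L. blaschke a (lens_map \<theta> z)))\<^sup>2 \<le> ((4 - 2 * c) / (4 + 2 * c)) ^ L"
proof (cases "L = 0")
  case True
  then show ?thesis by (simp add: lens_nodes_def)
next
  case False
  define q where "q = lens_power \<theta> z"
  note q = lens_power_sector[OF \<theta> z, folded q_def c_def]
  define s where "s = ln (cmod q)"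
  have s: "\<bar>s\<bar> \<le> real L + 2" unfolding s_def q_def by (rule lens_power_ln_bound[OF \<theta> z]) (use L in auto)
  have c: "0 < c" unfolding c_def by (rule cos_half_pos[OF \<theta>])
  \<comment> \<open>A window of L consecutive indices from floor (s L) on: all lie within L of s L,
    that is within 1 in the logarithmic coordinate, and |s| \<le> L + 2 keeps the window inside the
    index range of the nodes.\<close>
  define J where "J = {\<lfloor>s * L\<rfloor>..<\<lfloor>s * L\<rfloor> + int L}"
  have LL: "\<bar>s * L\<bar> \<le> (real L + 2) * L" using s by (simp add: abs_mult mult_right_mono)
  have Jsub: "J \<subseteq> {- int (L * (L + 3))..<int (L * (L + 3))}"
  proof
    fix j assume j: "j \<in> J"
    have "of_int j \<le> s * L + real L - 1" "s * L - 1 < of_int j"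
      using j unfolding J_def by auto linarith+
    moreover have "s * L \<le> real L * L + 2 * L" "- (real L * L + 2 * L) \<le> s * L"
      using LL by (auto simp: abs_le_iff algebra_simps)
    moreover have "1 \<le> real L" using False by simp
    ultimately have "real_of_int j < real L * L + 3 * L" "- (real L * L + 3 * L) \<le> real_of_int j" by linarith+
    then have "real_of_int j < real_of_int (int (L * (L + 3)))" "real_of_int (- int (L * (L + 3))) \<le> real_of_int j"
      by (simp_all add: algebra_simps)
    then show "j \<in> {- int (L * (L + 3))..<int (L * (L + 3))}" by (auto simp only: of_int_less_iff of_int_le_iff atLeastLessThan_iff)
  qed
  define N where "N = (\<lambda>j::int. node (exp (of_int j / of_nat L))) ` J"
  have inj: "inj_on (\<lambda>j::int. node (exp (of_int j / of_nat L))) J"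
    using False by (auto intro!: inj_onI dest!: inj_onD[OF node_inj])
  have Nsub: "N \<subseteq> lens_nodes L" unfolding N_def lens_nodes_def using Jsub by (rule image_mono)
  have lz: "cmod (lens_map \<theta> z) \<le> 1" using norm_lens_map_less_1[OF \<theta> z] by simp
  have each: "(cmod (blaschke (node (exp (of_int j / of_nat L))) (lens_map \<theta> z)))\<^sup>2 \<le> (4 - 2 * c) / (4 + 2 * c)" if j: "j \<in> J" for j
  proof -
    have "\<bar>s * L - of_int j\<bar> \<le> L" using j False unfolding J_def by auto linarith+
    then have "\<bar>s - of_int j / L\<bar> \<le> 1" using False by (simp add: field_simps abs_le_iff)
    then show ?thesis
      unfolding lens_map_eq[OF \<theta> z] q_def[symmetric] 
      by (subst blaschke_node[OF _ q(4)]) (auto intro!: norm_sector_quotient_le q c simp: s_def)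
  qed
  have "(cmod (\<Prod>a\<in>lens_nodes L. blaschke a (lens_map \<theta> z)))\<^sup>2 = (\<Prod>a\<in>N. (cmod (blaschke a (lens_map \<theta> z)))\<^sup>2) * (\<Prod>a\<in>lens_nodes L - N. (cmod (blaschke a (lens_map \<theta> z)))\<^sup>2)"
    unfolding prod_norm[symmetric] prod_power_distrib
    using prod.subset_diff[OF Nsub finite_lens_nodes] by (simp add: mult.commute)
  also have "\<dots> \<le> (\<Prod>a\<in>N. (cmod (blaschke a (lens_map \<theta> z)))\<^sup>2) * 1"
    using lens_nodes_subset[of L] lz
    by (intro mult_left_mono prod_le_1 prod_nonneg) (auto intro!: power_le_one norm_blaschke_le_1)
  also have "(\<Prod>a\<in>N. (cmod (blaschke a (lens_map \<theta> z)))\<^sup>2) = (\<Prod>j\<in>J. (cmod (blaschke (node (exp (of_int j / of_nat L))) (lens_map \<theta> z)))\<^sup>2)"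
    unfolding N_def by (subst prod.reindex[OF inj]) simp
  also have "\<dots> * 1 \<le> (\<Prod>j\<in>J. (4 - 2 * c) / (4 + 2 * c))"
    unfolding mult_1_right using each by (intro prod_mono) auto
  also have "\<dots> = ((4 - 2 * c) / (4 + 2 * c)) ^ L" by (simp add: J_def)
  finally show ?thesis .
qed

section \<open>An integrable weight on the circle, singular at the zeros of sin (2 t)\<close>

lemma half_abs_le_abs_sin:
  assumes "\<bar>x\<bar> \<le> pi / 2" shows "\<bar>x\<bar> / 2 \<le> \<bar>sin x\<bar>"
proof -
  have *: "y / 2 \<le> sin y" if y: "0 \<le> y" "y \<le> pi / 2" for y
  proof (cases "y \<le> pi / 3")
    case True
    have "(\<lambda>y. sin y - y / 2) 0 \<le> (\<lambda>y. sin y - y / 2) y"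
    proof (rule DERIV_nonneg_imp_nondecreasing[OF y(1)])
      fix x assume x: "0 \<le> x" "x \<le> y"
      have "cos (pi / 3) \<le> cos x" using x True by (intro cos_monotone_0_pi_le) auto
      then have "0 \<le> cos x - 1 / 2" by (simp add: cos_60)
      moreover have "((\<lambda>y. sin y - y / 2) has_real_derivative cos x - 1 / 2) (at x)"
        by (auto intro!: derivative_eq_intros)
      ultimately show "\<exists>d. ((\<lambda>y. sin y - y / 2) has_real_derivative d) (at x) \<and> 0 \<le> d" by blast
    qed
    then show ?thesis by simp
  next
    case False
    \<comment> \<open>On the remaining interval sin y is at least sqrt 3 / 2, which exceeds pi / 4
      \<ge> y / 2.\<close>
    have "sin (pi / 3) \<le> sin y" using False y by (intro sin_monotone_2pi_le) auto
    moreover have "17/10 \<le> sqrt 3" by (rule real_le_rsqrt) (simp add: power2_eq_square)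
    ultimately show ?thesis using y pi_less_4 pi_approx by (simp add: sin_60)
  qed
  show ?thesis using *[of x] *[of "-x"] assms by (cases "0 \<le> x") auto
qed

lemma abs_sin_double_ge:
  assumes t: "t \<in> {0..2*pi}"
  obtains k :: nat where "k \<le> 4" "\<bar>t - k * pi / 2\<bar> \<le> \<bar>sin (2 * t)\<bar>"
proof -
  \<comment> \<open>k pi / 2 is the zero of sin (2 t) nearest to t; adding 1 / 2 before taking the
    floor rounds to the nearest integer.\<close>
  define k where "k = nat \<lfloor>2 * t / pi + 1 / 2\<rfloor>"
  have f0: "0 \<le> \<lfloor>2 * t / pi + 1 / 2\<rfloor>" using t by simp
  have "2 * t / pi \<le> 4" using t by (simp add: field_simps)
  then have "\<lfloor>2 * t / pi + 1 / 2\<rfloor> < 5" by (simp add: floor_less_iff)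
  then have k4: "k \<le> 4" unfolding k_def nat_le_iff by linarith
  have rk: "real k = of_int \<lfloor>2 * t / pi + 1 / 2\<rfloor>" unfolding k_def using f0 by simp
  have "\<bar>2 * t / pi - real k\<bar> \<le> 1 / 2" unfolding rk by linarith
  then have "\<bar>2 * t / pi - real k\<bar> * pi \<le> 1 / 2 * pi" by (intro mult_right_mono) auto
  moreover have "\<bar>2 * t / pi - real k\<bar> * pi = \<bar>2 * t - k * pi\<bar>"
    by (subst abs_of_pos[OF pi_gt_zero, symmetric], subst abs_mult[symmetric]) (simp add: left_diff_distrib)
  ultimately have "\<bar>2 * t - k * pi\<bar> / 2 \<le> \<bar>sin (2 * t - k * pi)\<bar>"
    by (intro half_abs_le_abs_sin) simp
  also have "\<bar>sin (2 * t - k * pi)\<bar> = \<bar>sin (2 * t)\<bar>"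
    by (simp add: sin_diff abs_mult)
  finally have "\<bar>t - k * pi / 2\<bar> \<le> \<bar>sin (2 * t)\<bar>" by (simp add: abs_if field_simps split: if_splits)
  then show thesis using k4 that by blast
qed

text \<open>The part to the right of \<open>a\<close> is a translate, and the part to the left a
  reflected translate, of the one-sided singularity at 0, so one integral settles both.\<close>

lemma nn_integral_powr_singularity_finite:
  assumes \<sigma>: "\<sigma> < 1" and a: "a \<in> {0..2*pi}"
  shows "(\<integral>\<^sup>+t. indicator {0..2*pi} t * inverse (ennreal (\<bar>t - a\<bar> powr \<sigma>)) \<partial>lborel) < \<infinity>"
proof -
  define g where "g = (\<lambda>u::real. indicator {0..2*pi} u * inverse (ennreal (u powr \<sigma>)))"
  have [measurable]: "g \<in> borel_measurable borel" unfolding g_def by measurable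
  have "(\<integral>\<^sup>+u. g u \<partial>lborel) = (\<integral>\<^sup>+u. ennreal (indicator {0..2*pi} u * u powr (- \<sigma>)) \<partial>lborel)"
  proof (rule nn_integral_cong_AE)
    show "AE u in lborel. g u = ennreal (indicator {0..2*pi} u * u powr (- \<sigma>))"
      using AE_lborel_singleton[of 0]
    proof eventually_elim
      case (elim u)
      then show ?case unfolding g_def
        by (cases "u > 0") (auto simp: indicator_def inverse_ennreal powr_minus)
    qed
  qed
  also have "\<dots> < \<infinity>"
    using \<sigma> by (subst nn_integral_has_integral_lebesgue[OF _ has_integral_powr_from_0[of "-\<sigma>" "2*pi"]]) auto
  finally have fin: "(\<integral>\<^sup>+u. g u \<partial>lborel) < \<infinity>" .
  have 1: "(\<integral>\<^sup>+u. g u \<partial>lborel) = (\<integral>\<^sup>+t. g (t - a) \<partial>lborel)"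
    using nn_integral_real_affine[of g 1 "-a"] by simp
  have 2: "(\<integral>\<^sup>+u. g u \<partial>lborel) = (\<integral>\<^sup>+t. g (a - t) \<partial>lborel)"
    using nn_integral_real_affine[of g "-1" a] by simp
  have "(\<integral>\<^sup>+t. indicator {0..2*pi} t * inverse (ennreal (\<bar>t - a\<bar> powr \<sigma>)) \<partial>lborel)
     \<le> (\<integral>\<^sup>+t. g (t - a) + g (a - t) \<partial>lborel)"
  proof (rule nn_integral_mono)
    fix t
    show "indicator {0..2*pi} t * inverse (ennreal (\<bar>t - a\<bar> powr \<sigma>)) \<le> g (t - a) + g (a - t)"
    proof (cases "t \<in> {0..2*pi}")
      case True
      show ?thesis
      proof (cases "a \<le> t")
        case at: True
        then have "g (t - a) = indicator {0..2*pi} t * inverse (ennreal (\<bar>t - a\<bar> powr \<sigma>))"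
          using True a unfolding g_def by simp
        then show ?thesis by simp
      next
        case False
        then have "g (a - t) = indicator {0..2*pi} t * inverse (ennreal (\<bar>t - a\<bar> powr \<sigma>))"
          using True a unfolding g_def by simp
        then show ?thesis by simp
      qed
    qed simp
  qed
  also have "\<dots> = (\<integral>\<^sup>+t. g (t - a) \<partial>lborel) + (\<integral>\<^sup>+t. g (a - t) \<partial>lborel)"
    by (rule nn_integral_add) measurable
  also have "\<dots> < \<infinity>" using fin 1 2 by simp
  finally show ?thesis .
qed

text \<open>For \<open>a\<close> \<le> 0 the right side is infinite, which is the case met at the
  zeros of the sine.\<close>

lemma inverse_ennreal_antimono:
  assumes "a \<le> b" shows "inverse (ennreal b) \<le> inverse (ennreal a)"
proof (cases "0 < a")
  case True
  then show ?thesis using assms by (simp add: inverse_ennreal ennreal_leI le_imp_inverse_le)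
next
  case False
  then show ?thesis by (simp add: ennreal_neg)
qed

text \<open>The inverse is taken in \<open>ennreal\<close> so that the weight is infinite, not 0, at the zeros of the sine.\<close>

definition sing_weight :: "real \<Rightarrow> real \<Rightarrow> ennreal" where
  "sing_weight \<sigma> t = inverse (ennreal (\<bar>sin (2 * t)\<bar> powr \<sigma>))"

lemma sing_weight_measurable [measurable]: "sing_weight \<sigma> \<in> borel_measurable borel"
  unfolding sing_weight_def[abs_def] by measurable

lemma sing_weight_integral_finite:
  assumes \<sigma>: "0 < \<sigma>" "\<sigma> < 1"
  shows "(\<integral>\<^sup>+t. circ_weight t * sing_weight \<sigma> t \<partial>lborel) < \<infinity>"
proof -
  let ?s = "\<lambda>(k::nat) t. indicator {0..2*pi} t * inverse (ennreal (\<bar>t - k * pi / 2\<bar> powr \<sigma>))"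
  have "(\<integral>\<^sup>+t. circ_weight t * sing_weight \<sigma> t \<partial>lborel) \<le> (\<integral>\<^sup>+t. ennreal (1 / (2*pi)) * (\<Sum>k\<le>4. ?s k t) \<partial>lborel)"
  proof (rule nn_integral_mono)
    fix t
    show "circ_weight t * sing_weight \<sigma> t \<le> ennreal (1 / (2*pi)) * (\<Sum>k\<le>4. ?s k t)"
    proof (cases "t \<in> {0..2*pi}")
      case True
      then obtain k :: nat where k: "k \<le> 4" "\<bar>t - k * pi / 2\<bar> \<le> \<bar>sin (2 * t)\<bar>" by (rule abs_sin_double_ge)
      have "sing_weight \<sigma> t \<le> ?s k t" unfolding sing_weight_def
        using True k(2) \<sigma> by (auto intro!: inverse_ennreal_antimono powr_mono2)
      also have "\<dots> \<le> (\<Sum>k\<le>4. ?s k t)" using k(1) by (intro member_le_sum) auto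
      finally have "sing_weight \<sigma> t \<le> (\<Sum>k\<le>4. ?s k t)" .
      moreover have "circ_weight t = ennreal (1 / (2*pi))" using True unfolding circ_weight_def by simp
      ultimately show ?thesis by (simp only: mult_left_mono zero_le)
    qed (simp add: circ_weight_def)
  qed
  also have "\<dots> = ennreal (1 / (2*pi)) * (\<Sum>k\<le>4. \<integral>\<^sup>+t. ?s k t \<partial>lborel)"
    by (subst nn_integral_cmult, measurable) (subst nn_integral_sum, auto)
  also have "\<dots> < \<infinity>"
  proof -
    have "(\<integral>\<^sup>+t. ?s k t \<partial>lborel) < \<infinity>" if "k \<le> 4" for k :: nat
    proof (rule nn_integral_powr_singularity_finite[OF \<sigma>(2)])
      have "real k * pi \<le> 4 * pi" using that by (intro mult_right_mono) auto
      then show "k * pi / 2 \<in> {0..2*pi}" by simp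
    qed
    then show ?thesis by (simp add: ennreal_mult_less_top)
  qed
  finally show ?thesis .
qed

text \<open>Rotating by cis (- 2 t) turns (r cis t)^2 into the real number r^2, so the imaginary
  part sees only the rotated 1. The bound is uniform in r, which lets one weight dominate the means
  for all radii.\<close>

lemma cmod_one_minus_square_ge_sin:
  "\<bar>sin (2 * t)\<bar> \<le> cmod (1 - (of_real r * cis t)\<^sup>2)"
proof -
  have "cmod (1 - (of_real r * cis t)\<^sup>2) = cmod (cis (- (2 * t)) * (1 - (of_real r * cis t)\<^sup>2))"
    by (simp add: norm_mult)
  also have "cis (- (2 * t)) * (1 - (of_real r * cis t)\<^sup>2) = cis (- (2 * t)) - of_real (r\<^sup>2)"
    by (simp add: right_diff_distrib power_mult_distrib Complex.DeMoivre cis_mult mult.left_commute)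
  finally show ?thesis using abs_Im_le_cmod[of "cis (- (2 * t)) - of_real (r\<^sup>2)"] by simp
qed

text \<open>The first estimate serves the coordinates where plain evaluation is used, the second the
  one coordinate carrying the interpolation error. The right sides do not depend on r and are
  integrable in t because \<sigma> < 1.\<close>

lemma lens_weight_bounds:
  assumes \<theta>: "0 < \<theta>" "\<theta> < 1"
  obtains C b \<sigma> :: real where "0 < C" "0 < b" "0 < \<sigma>" "\<sigma> < 1"
    "\<And>r t. 0 < r \<Longrightarrow> r < 1 \<Longrightarrow> sin (2 * t) \<noteq> 0 \<Longrightarrow>
       1 / (1 - (cmod (lens_map \<theta> (of_real r * cis t)))\<^sup>2) \<le> C / \<bar>sin (2 * t)\<bar> powr \<sigma>"
    "\<And>L r t. 0 < r \<Longrightarrow> r < 1 \<Longrightarrow> sin (2 * t) \<noteq> 0 \<Longrightarrow>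
       (cmod (\<Prod>a\<in>lens_nodes L. blaschke a (lens_map \<theta> (of_real r * cis t))))\<^sup>2 / (1 - (cmod (lens_map \<theta> (of_real r * cis t)))\<^sup>2)
        \<le> C * exp (- b * L) / \<bar>sin (2 * t)\<bar> powr \<sigma>"
proof -
  define c where "c = cos (\<theta> * pi / 2)"
  have c: "0 < c" "c \<le> 1" unfolding c_def using cos_half_pos[OF \<theta>] by auto
  define \<rho> where "\<rho> = (4 - 2 * c) / (4 + 2 * c)"
  have \<rho>: "0 < \<rho>" "\<rho> < 1" unfolding \<rho>_def using c by (auto simp: field_simps)
  \<comment> \<open>Near the contact points the Blaschke product need not be small; there the gap \<open>\<sigma> - \<theta>\<close> of exponents provides the decay.\<close>
  define \<sigma> where "\<sigma> = (1 + \<theta>) / 2"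
  have \<sigma>: "0 < \<sigma>" "\<sigma> < 1" "\<theta> < \<sigma>" "\<sigma> - \<theta> < 1" unfolding \<sigma>_def using \<theta> by (auto simp: field_simps)
  \<comment> \<open>The smaller of two rates: - ln \<rho> per node where |1 - z^2| \<ge> exp (- L),
    and \<sigma> - \<theta> in the remaining region.\<close>
  define b where "b = min (- ln \<rho>) (\<sigma> - \<theta>)"
  have b: "0 < b" "b \<le> - ln \<rho>" "b \<le> \<sigma> - \<theta>" unfolding b_def using \<rho> \<sigma> by auto
  \<comment> \<open>The defect bound contributes 4 / c, and u powr (\<sigma> - \<theta>) \<le> 2
    because u \<le> 2.\<close>
  define C where "C = 8 / c"
  have C: "0 < C" unfolding C_def using c by simp
  have main: "1 / (1 - (cmod (lens_map \<theta> z))\<^sup>2) \<le> C / S powr \<sigma>"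
    "(cmod (\<Prod>a\<in>lens_nodes L. blaschke a (lens_map \<theta> z)))\<^sup>2 / (1 - (cmod (lens_map \<theta> z))\<^sup>2) \<le> C * exp (- b * L) / S powr \<sigma>"
    if z: "cmod z < 1" and S: "0 < S" "S \<le> cmod (1 - z\<^sup>2)" for z S L
  proof -
    define u where "u = cmod (1 - z\<^sup>2)"
    define w where "w = 1 - (cmod (lens_map \<theta> z))\<^sup>2"
    define B where "B = (cmod (\<Prod>a\<in>lens_nodes L. blaschke a (lens_map \<theta> z)))\<^sup>2"
    have u: "0 < u" "u \<le> 2" "S \<le> u"
    proof -
      show "0 < u" unfolding u_def by (rule cayley_norm_bounds[OF z])
      have "(cmod z)\<^sup>2 \<le> 1" using z by (simp add: power_le_one)
      then show "u \<le> 2" unfolding u_def using norm_triangle_ineq4[of 1 "z\<^sup>2"] by (simp add: norm_power)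
      show "S \<le> u" unfolding u_def by (rule S)
    qed
    have w: "c / 4 * u powr \<theta> \<le> w" unfolding w_def u_def c_def by (rule lens_map_defect[OF \<theta> z])
    have w0: "0 < w" using less_le_trans[OF _ w] c u by simp
    have "1 / w \<le> 1 / (c / 4 * u powr \<theta>)" using w c u w0 by (intro divide_left_mono) (auto intro!: mult_pos_pos)
    also have "\<dots> = 4 / c * u powr (\<sigma> - \<theta>) / u powr \<sigma>" using u c by (simp add: powr_diff)
    finally have i: "1 / w \<le> 4 / c * u powr (\<sigma> - \<theta>) / u powr \<sigma>" .
    also have "\<dots> \<le> 4 / c * u powr (\<sigma> - \<theta>) / S powr \<sigma>"
      using u S c \<sigma> by (intro divide_left_mono powr_mono2 mult_pos_pos) auto
    finally have ii: "1 / w \<le> 4 / c * u powr (\<sigma> - \<theta>) / S powr \<sigma>" .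
    have "u powr (\<sigma> - \<theta>) \<le> 2 powr (\<sigma> - \<theta>)" using u \<sigma> by (intro powr_mono2) auto
    also have "\<dots> \<le> 2 powr 1" using \<sigma> by (intro powr_mono) auto
    finally have "4 / c * u powr (\<sigma> - \<theta>) \<le> C" unfolding C_def using c by (simp add: divide_right_mono)
    then have "4 / c * u powr (\<sigma> - \<theta>) / S powr \<sigma> \<le> C / S powr \<sigma>" by (intro divide_right_mono) auto
    with ii have iii: "1 / w \<le> C / S powr \<sigma>" by linarith
    then show "1 / (1 - (cmod (lens_map \<theta> z))\<^sup>2) \<le> C / S powr \<sigma>" unfolding w_def .
    have B01: "0 \<le> B" "B \<le> 1" unfolding B_def
      using norm_prod_blaschke_le_1[OF lens_nodes_subset, of "lens_map \<theta> z" L] norm_lens_map_less_1[OF \<theta> z] by (auto simp: power_le_one)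
    have "B / w \<le> C * exp (- b * L) / S powr \<sigma>"
    proof (cases "exp (- real L) \<le> u")
      case True
      have "B \<le> \<rho> ^ L" unfolding B_def \<rho>_def c_def using True unfolding u_def
        by (rule lens_nodes_blaschke_small[OF \<theta> z])
      also have "\<dots> = exp (ln \<rho> * L)" using \<rho> by (simp add: exp_of_nat2_mult)
      also have "\<dots> \<le> exp (- b * L)"
        unfolding exp_le_cancel_iff using b by (intro mult_right_mono) auto
      finally have "B * (1 / w) \<le> exp (- b * L) * (C / S powr \<sigma>)"
        using iii w0 B01 by (intro mult_mono) auto
      then show ?thesis by (simp add: mult.commute)
    next
      case False
      have "u powr (\<sigma> - \<theta>) \<le> exp (- real L) powr (\<sigma> - \<theta>)" using False u \<sigma> by (intro powr_mono2) auto
      also have "\<dots> = exp (- (\<sigma> - \<theta>) * L)" by (simp add: powr_def algebra_simps)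
      also have "\<dots> \<le> exp (- b * L)"
        unfolding exp_le_cancel_iff using b by (intro mult_right_mono) auto
      finally have "4 / c * u powr (\<sigma> - \<theta>) \<le> C * exp (- b * L)"
        unfolding C_def using c by (intro mult_mono divide_right_mono) auto
      then have "4 / c * u powr (\<sigma> - \<theta>) / S powr \<sigma> \<le> C * exp (- b * L) / S powr \<sigma>" by (intro divide_right_mono) auto
      moreover have "B / w \<le> 1 / w" using B01 w0 by (intro divide_right_mono) auto
      ultimately show ?thesis using ii by linarith
    qed
    then show "(cmod (\<Prod>a\<in>lens_nodes L. blaschke a (lens_map \<theta> z)))\<^sup>2 / (1 - (cmod (lens_map \<theta> z))\<^sup>2) \<le> C * exp (- b * L) / S powr \<sigma>"
      unfolding B_def w_def .
  qed
  show thesis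
    by (rule that[OF C b(1) \<sigma>(1,2)]) (intro main; simp add: norm_mult cmod_one_minus_square_ge_sin)+
qed

section \<open>The upper bound\<close>

lemma holo_polydisk_const: "holo_polydisk (\<lambda>_. c)"
  unfolding holo_polydisk_def by (auto intro!: exI[of _ "\<lambda>_. 0"])

lemma holo_polydisk_mult:
  fixes f g :: "'n::finite hfun"
  assumes "holo_polydisk f" "holo_polydisk g" shows "holo_polydisk (\<lambda>z. f z * g z)"
  unfolding holo_polydisk_def
proof
  fix z :: "complex^'n" assume z: "z \<in> polydisk"
  obtain L where L: "(f has_derivative L) (at z)" "\<And>c v. L (\<chi> i. c * v $ i) = c * L v"
    using assms(1) z unfolding holo_polydisk_def by blast
  obtain M where M: "(g has_derivative M) (at z)" "\<And>c v. M (\<chi> i. c * v $ i) = c * M v"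
    using assms(2) z unfolding holo_polydisk_def by blast
  show "\<exists>L. ((\<lambda>z. f z * g z) has_derivative L) (at z) \<and> (\<forall>c v. L (\<chi> i. c * v $ i) = c * L v)"
    by (rule exI, rule conjI, rule has_derivative_mult[OF L(1) M(1)]) (simp add: L M algebra_simps)
qed

lemma holo_polydisk_add:
  fixes f g :: "'n::finite hfun"
  assumes "holo_polydisk f" "holo_polydisk g" shows "holo_polydisk (\<lambda>z. f z + g z)"
  unfolding holo_polydisk_def
proof
  fix z :: "complex^'n" assume z: "z \<in> polydisk"
  obtain L where L: "(f has_derivative L) (at z)" "\<And>c v. L (\<chi> i. c * v $ i) = c * L v"
    using assms(1) z unfolding holo_polydisk_def by blast
  obtain M where M: "(g has_derivative M) (at z)" "\<And>c v. M (\<chi> i. c * v $ i) = c * M v"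
    using assms(2) z unfolding holo_polydisk_def by blast
  show "\<exists>L. ((\<lambda>z. f z + g z) has_derivative L) (at z) \<and> (\<forall>c v. L (\<chi> i. c * v $ i) = c * L v)"
    by (rule exI, rule conjI, rule has_derivative_add[OF L(1) M(1)]) (simp add: L M algebra_simps)
qed

lemma holo_polydisk_sum:
  "(\<And>x. x \<in> X \<Longrightarrow> holo_polydisk (f x)) \<Longrightarrow> holo_polydisk (\<lambda>z. \<Sum>x\<in>X. f x z)"
  by (induction X rule: infinite_finite_induct) (auto intro: holo_polydisk_const holo_polydisk_add)

lemma holo_polydisk_prod:
  "(\<And>x. x \<in> X \<Longrightarrow> holo_polydisk (f x)) \<Longrightarrow> holo_polydisk (\<lambda>z. \<Prod>x\<in>X. f x z)"
  by (induction X rule: infinite_finite_induct) (auto intro: holo_polydisk_const holo_polydisk_mult)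

lemma holo_polydisk_coord:
  assumes "F holomorphic_on ball 0 1"
  shows "holo_polydisk (\<lambda>z::complex^'n::finite. F (z $ k))"
  unfolding holo_polydisk_def
proof
  fix z :: "complex^'n" assume z: "z \<in> polydisk"
  then have "z $ k \<in> ball 0 1" unfolding polydisk_def by simp
  then obtain d where d: "(F has_field_derivative d) (at (z $ k))"
    using assms holomorphic_on_open[OF open_ball] by blast
  have "((\<lambda>z::complex^'n. z $ k) has_derivative (\<lambda>h. h $ k)) (at z)"
    by (rule bounded_linear_imp_has_derivative[OF bounded_linear_vec_nth])
  then have "((\<lambda>z. F (z $ k)) has_derivative (\<lambda>h. d * h $ k)) (at z)"
    using d unfolding has_field_derivative_def by (rule has_derivative_compose)
  then show "\<exists>L. ((\<lambda>z. F (z $ k)) has_derivative L) (at z) \<and> (\<forall>c v. L (\<chi> i. c * v $ i) = c * L v)"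
    by (intro exI conjI) auto
qed

text \<open>A pointwise bound by a product of one-variable weights turns the mean into a power of a
  single integral. Working in \<open>ennreal\<close> allows the weight to be infinite at some
  angles.\<close>

lemma torus_mean_le_prod:
  fixes f :: "'n::finite hfun"
  assumes f: "continuous_on polydisk f" and r: "0 \<le> r" "r < 1"
    and le: "\<And>t. ennreal ((cmod (f (\<chi> i. of_real r * cis (t i))))\<^sup>2) \<le> ennreal K * (\<Prod>i\<in>UNIV. S (t i))"
    and [measurable]: "S \<in> borel_measurable borel"
  shows "ennreal (torus_mean f r) \<le> ennreal K * (\<integral>\<^sup>+t. circ_weight t * S t \<partial>lborel) ^ CARD('n)"
proof -
  interpret product_sigma_finite "\<lambda>_::'n. lborel :: real measure" by standard
  have "ennreal (torus_mean f r) \<le> (\<integral>\<^sup>+t. ennreal K * (\<Prod>i\<in>(UNIV::'n set). circ_weight (t i) * S (t i)) \<partial>(\<Pi>\<^sub>M i\<in>UNIV. lborel))"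
    unfolding torus_mean_eq_nn_integral[OF f r]
  proof (rule nn_integral_mono)
    fix t
    have "(\<Prod>i\<in>UNIV. circ_weight (t i)) * ennreal ((cmod (f (\<chi> i. of_real r * cis (t i))))\<^sup>2)
       \<le> (\<Prod>i\<in>UNIV. circ_weight (t i)) * (ennreal K * (\<Prod>i\<in>UNIV. S (t i)))"
      by (intro mult_left_mono le) simp
    then show "(\<Prod>i\<in>UNIV. circ_weight (t i)) * ennreal ((cmod (f (\<chi> i. of_real r * cis (t i))))\<^sup>2)
       \<le> ennreal K * (\<Prod>i\<in>UNIV. circ_weight (t i) * S (t i))"
      by (simp add: prod.distrib mult.left_commute)
  qed
  also have "\<dots> = ennreal K * (\<Prod>i\<in>(UNIV::'n set). \<integral>\<^sup>+t. circ_weight t * S t \<partial>lborel)"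
    by (subst nn_integral_cmult, measurable) (subst product_nn_integral_prod, auto)
  finally show ?thesis by simp
qed

lemma nn_integral_circ_weight: "(\<integral>\<^sup>+t. circ_weight t * 1 \<partial>lborel) = 1"
  unfolding circ_weight_def
  by (simp add: nn_integral_cmult flip: ennreal_mult)

lemma h2_norm_le_iff:
  assumes "0 \<le> B"
  shows "h2_norm f \<le> ereal B \<longleftrightarrow> (\<forall>r. 0 < r \<longrightarrow> r < 1 \<longrightarrow> torus_mean f r \<le> B\<^sup>2)"
proof -
  have "sqrt x \<le> B \<longleftrightarrow> x \<le> B\<^sup>2" for x
    using assms by (metis real_sqrt_le_iff real_sqrt_abs abs_of_nonneg)
  then show ?thesis unfolding h2_norm_def by (auto simp: SUP_le_iff)
qed

lemma h2_norm_le_bound: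
  fixes f :: "'n::finite hfun"
  assumes f: "holo_polydisk f" and B: "\<And>z. z \<in> polydisk \<Longrightarrow> cmod (f z) \<le> B"
  shows "h2_norm f \<le> ereal B"
proof -
  have "(0::complex^'n) \<in> polydisk" by (simp add: polydisk_def)
  from B[OF this] have B0: "0 \<le> B" using norm_ge_zero order_trans by blast
  have "torus_mean f r \<le> B\<^sup>2" if r: "0 < r" "r < 1" for r
  proof -
    have "ennreal (torus_mean f r) \<le> ennreal (B\<^sup>2) * (\<integral>\<^sup>+t. circ_weight t * 1 \<partial>lborel) ^ CARD('n)"
    proof (rule torus_mean_le_prod[OF holo_polydisk_continuous[OF f]])
      fix t :: "'n \<Rightarrow> real"
      have "cmod (f (\<chi> i. of_real r * cis (t i))) \<le> B"
        using r by (intro B) (simp add: polydisk_def norm_mult)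
      then show "ennreal ((cmod (f (\<chi> i. of_real r * cis (t i))))\<^sup>2) \<le> ennreal (B\<^sup>2) * (\<Prod>i\<in>(UNIV::'n set). 1)"
        by (simp add: power_mono)
    qed (use r in auto)
    then show ?thesis unfolding nn_integral_circ_weight by simp
  qed
  then show ?thesis by (simp add: h2_norm_le_iff[OF B0])
qed

lemma bounded_holo_in_H2:
  assumes "holo_polydisk f" "\<And>z. z \<in> polydisk \<Longrightarrow> cmod (f z) \<le> B"
  shows "f \<in> H2"
  using h2_norm_le_bound[OF assms] assms(1) unfolding H2_def by (auto simp: less_ereal.simps intro: le_less_trans)

lemma multi_lens_in_polydisk:
  assumes "0 < \<theta>" "\<theta> < 1" "z \<in> polydisk" shows "multi_lens \<theta> z \<in> polydisk"
  using assms norm_lens_map_less_1[OF assms(1,2)] unfolding polydisk_def multi_lens_def by auto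

lemma multi_lens_continuous:
  assumes "0 < \<theta>" "\<theta> < 1"
  shows "continuous_on polydisk (multi_lens \<theta> :: complex^'n::finite \<Rightarrow> complex^'n)"
  unfolding multi_lens_def[abs_def]
  by (intro continuous_on_vec_lambda holo_polydisk_continuous holo_polydisk_coord lens_map_holomorphic assms)

text \<open>The approximant takes the values of \<open>f\<close> at the grid points and composes the
  interpolation functions with the lens map. Its rank is at most the number of grid points, and its
  error at z is the interpolation error at the image of z.\<close>

lemma approx_num_multi_lens_upper:
  assumes \<theta>: "0 < \<theta>" "\<theta> < 1"
  obtains K b :: real where "0 < K" "0 < b" "\<And>(L::nat) n. (8 * L\<^sup>2) ^ CARD('n) < n \<Longrightarrow>
     approx_num (comp_op (multi_lens \<theta> :: complex^'n::finite \<Rightarrow> complex^'n)) n \<le> ereal (K * exp (- b * L))"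
proof -
  let ?\<phi> = "multi_lens \<theta> :: complex^'n \<Rightarrow> complex^'n"
  obtain C b \<sigma> where C: "0 < C" "0 < b" "0 < \<sigma>" "\<sigma> < 1"
    and C1: "\<And>r t. 0 < r \<Longrightarrow> r < 1 \<Longrightarrow> sin (2 * t) \<noteq> 0 \<Longrightarrow>
       1 / (1 - (cmod (lens_map \<theta> (of_real r * cis t)))\<^sup>2) \<le> C / \<bar>sin (2 * t)\<bar> powr \<sigma>"
    and C2: "\<And>L r t. 0 < r \<Longrightarrow> r < 1 \<Longrightarrow> sin (2 * t) \<noteq> 0 \<Longrightarrow>
       (cmod (\<Prod>a\<in>lens_nodes L. blaschke a (lens_map \<theta> (of_real r * cis t))))\<^sup>2 / (1 - (cmod (lens_map \<theta> (of_real r * cis t)))\<^sup>2)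
        \<le> C * exp (- b * L) / \<bar>sin (2 * t)\<bar> powr \<sigma>"
    using lens_weight_bounds[OF \<theta>] by metis
  obtain I0 where I0: "0 \<le> I0" "(\<integral>\<^sup>+t. circ_weight t * sing_weight \<sigma> t \<partial>lborel) = ennreal I0"
    using sing_weight_integral_finite[OF C(3,4)] by (cases "\<integral>\<^sup>+t. circ_weight t * sing_weight \<sigma> t \<partial>lborel") auto
  \<comment> \<open>4^d from the interpolation error, d from its sum over coordinates, C^d from the
    weights, with d the number of coordinates.\<close>
  define K0 where "K0 = 4 ^ CARD('n) * (real CARD('n) * C ^ CARD('n))"
  have K0: "0 < K0" unfolding K0_def using C by simp
  \<comment> \<open>Adding 1 makes \<open>K\<close> positive even if \<open>I0\<close> is 0.\<close>
  define K where "K = sqrt (K0 * I0 ^ CARD('n)) + 1"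
  have K: "0 < K" unfolding K_def using K0 I0 by (simp add: add_nonneg_pos)
  \<comment> \<open>The squared means decay at rate \<open>b\<close>, hence \<open>b / 2\<close> for
    the norms.\<close>
  have main: "approx_num (comp_op ?\<phi>) n \<le> ereal (K * exp (- (b / 2) * L))" if n: "(8 * L\<^sup>2) ^ CARD('n) < n" for L n
  proof -
    define A where "A = lens_nodes L"
    have A: "finite A" "A \<subseteq> ball 0 1" unfolding A_def by (rule finite_lens_nodes, rule lens_nodes_subset)
    obtain c where c: "\<And>a. a \<in> A \<Longrightarrow> c a analytic_on cball 0 1"
      and interp: "\<And>(f :: 'n hfun) M v. holo_polydisk f \<Longrightarrow> (\<And>r. 0 < r \<Longrightarrow> r < 1 \<Longrightarrow> torus_mean f r \<le> M) \<Longrightarrow> v \<in> polydisk \<Longrightarrow>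
        (cmod (f v - (\<Sum>p\<in>(\<Pi>\<^sub>E i\<in>UNIV. A). (\<Prod>i\<in>UNIV. c (p i) (v $ i)) * f (\<chi> i. p i))))\<^sup>2
         \<le> 4 ^ CARD('n) * (\<Sum>i\<in>UNIV. (cmod (\<Prod>a\<in>A. blaschke a (v $ i)))\<^sup>2) * (\<Prod>i\<in>UNIV. 1 / (1 - (cmod (v $ i))\<^sup>2)) * M"
      by (rule grid_interpolation[OF A, where 'n = 'n]) blast
    define G where "G = (\<Pi>\<^sub>E i\<in>(UNIV::'n set). A)"
    have G: "finite G" "card G < n"
    proof -
      show "finite G" unfolding G_def using A by (intro finite_PiE) auto
      have "card G = card A ^ CARD('n)" unfolding G_def by (simp add: card_PiE)
      also have "\<dots> \<le> (8 * L\<^sup>2) ^ CARD('n)" unfolding A_def by (intro power_mono card_lens_nodes) auto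
      finally show "card G < n" using n by simp
    qed
    define g where "g = (\<lambda>p (z::complex^'n). \<Prod>i\<in>UNIV. c (p i) (lens_map \<theta> (z $ i)))"
    have gholo: "holo_polydisk (g p)" if p: "p \<in> G" for p
      unfolding g_def
    proof (intro holo_polydisk_prod holo_polydisk_coord)
      fix i
      have "c (p i) analytic_on cball 0 1" using p unfolding G_def by (intro c) auto
      then have "c (p i) holomorphic_on cball 0 1" by (rule analytic_imp_holomorphic)
      moreover have "lens_map \<theta> ` ball 0 1 \<subseteq> cball 0 1"
      proof (rule image_subsetI)
        fix z :: complex assume "z \<in> ball 0 1"
        then show "lens_map \<theta> z \<in> cball 0 1" using norm_lens_map_less_1[OF \<theta>, of z] by simp
      qed
      ultimately show "(\<lambda>z. c (p i) (lens_map \<theta> z)) holomorphic_on ball 0 1"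
        using holomorphic_on_compose_gen[OF lens_map_holomorphic[OF \<theta>]] unfolding o_def by blast
    qed
    have gH2: "g p \<in> H2" if p: "p \<in> G" for p
    proof -
      have "\<exists>B. \<forall>v. cmod v \<le> 1 \<longrightarrow> cmod (c (p i) v) \<le> B" for i
      proof -
        have "c (p i) analytic_on cball 0 1" using p unfolding G_def by (intro c) auto
        then have "continuous_on (cball 0 1) (c (p i))"
          using analytic_imp_holomorphic holomorphic_on_imp_continuous_on by blast
        then have "compact (c (p i) ` cball 0 1)" by (intro compact_continuous_image compact_cball)
        then obtain B where "\<And>x. x \<in> c (p i) ` cball 0 1 \<Longrightarrow> cmod x \<le> B"
          using compact_imp_bounded bounded_iff by metis
        then show ?thesis by (intro exI[of _ B]) auto
      qed
      then obtain B where B: "\<And>i v. cmod v \<le> 1 \<Longrightarrow> cmod (c (p i) v) \<le> B i" by metis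
      show ?thesis
      proof (rule bounded_holo_in_H2[OF gholo[OF p]])
        fix z :: "complex^'n" assume z: "z \<in> polydisk"
        show "cmod (g p z) \<le> (\<Prod>i\<in>UNIV. B i)"
          unfolding g_def prod_norm[symmetric]
        proof (intro prod_mono conjI B norm_ge_zero)
          fix i show "cmod (lens_map \<theta> (z $ i)) \<le> 1"
            using norm_lens_map_less_1[OF \<theta>, of "z $ i"] z unfolding polydisk_def by simp
        qed
      qed
    qed
    define R where "R = (\<lambda>(f::'n hfun) z. \<Sum>p\<in>G. f (\<chi> i. p i) * g p z)"
    have rank: "rank_less R n"
      unfolding rank_less_def
    proof (intro conjI ballI allI)
      fix f h :: "'n hfun" and a
      show "R (\<lambda>z. f z + h z) = (\<lambda>z. R f z + R h z)" unfolding R_def by (simp add: distrib_right sum.distrib)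
      show "R (\<lambda>z. a * f z) = (\<lambda>z. a * R f z)" unfolding R_def by (simp add: sum_distrib_left mult.assoc)
    next
      obtain e where e: "bij_betw e {0..<card G} G" using ex_bij_betw_nat_finite[OF G(1)] by blast
      have "R f = (\<lambda>z. \<Sum>i<card G. f (\<chi> k. e i k) * g (e i) z)" for f
        unfolding R_def using sum.reindex_bij_betw[OF e, of "\<lambda>p. f (\<chi> i. p i) * g p z" for z]
        by (simp add: atLeast0LessThan)
      moreover have "g (e i) \<in> H2" if "i < card G" for i
        using that e by (intro gH2) (auto simp: bij_betw_def)
      ultimately show "\<exists>k g'. k < n \<and> (\<forall>i<k. g' i \<in> H2) \<and> (\<forall>f\<in>H2. \<exists>c. R f = (\<lambda>z. \<Sum>i<k. c i * g' i z))"
        using G(2) by (intro exI[of _ "card G"] exI[of _ "\<lambda>i. g (e i)"]) (auto intro!: exI)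
    qed
    have "op_dist (comp_op ?\<phi>) R \<le> ereal (K * exp (- (b / 2) * L))"
      unfolding op_dist_def
    proof (rule SUP_least)
      fix f :: "'n hfun" assume "f \<in> {f \<in> H2. h2_norm f \<le> 1}"
      then have f: "holo_polydisk f" and "h2_norm f \<le> ereal 1" unfolding H2_def one_ereal_def by blast+
      then have f1: "\<And>r. 0 < r \<Longrightarrow> r < 1 \<Longrightarrow> torus_mean f r \<le> 1"
        by (subst (asm) h2_norm_le_iff) auto
      define E where "E = (\<lambda>z. comp_op ?\<phi> f z - R f z)"
      have Econt: "continuous_on polydisk E" unfolding E_def comp_op_def o_def R_def
        by (intro continuous_intros continuous_on_compose2[OF holo_polydisk_continuous[OF f] multi_lens_continuous[OF \<theta>]]
            holo_polydisk_continuous[OF gholo]) (auto intro: multi_lens_in_polydisk \<theta>)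
      have "torus_mean E r \<le> (K * exp (- (b / 2) * L))\<^sup>2" if r: "0 < r" "r < 1" for r
      proof -
        have "ennreal (torus_mean E r) \<le> ennreal (K0 * exp (- b * L)) * (\<integral>\<^sup>+t. circ_weight t * sing_weight \<sigma> t \<partial>lborel) ^ CARD('n)"
        proof (rule torus_mean_le_prod[OF Econt])
          fix t :: "'n \<Rightarrow> real"
          show "ennreal ((cmod (E (\<chi> i. of_real r * cis (t i))))\<^sup>2) \<le> ennreal (K0 * exp (- b * L)) * (\<Prod>i\<in>UNIV. sing_weight \<sigma> (t i))"
          \<comment> \<open>At angles where some sine vanishes the product of the weights is
            infinite, all factors being nonzero, so the bound is trivial there.\<close>
          proof (cases "\<exists>i. sin (2 * t i) = 0")
            case True
            then have "\<exists>i. sing_weight \<sigma> (t i) = top" unfolding sing_weight_def by auto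
            moreover have "sing_weight \<sigma> (t i) \<noteq> 0" for i unfolding sing_weight_def by (simp add: ennreal_inverse_eq_0_iff)
            ultimately have "(\<Prod>i\<in>UNIV. sing_weight \<sigma> (t i)) = top" by (subst ennreal_prod_eq_top) auto
            then show ?thesis using K0 by (simp add: ennreal_mult_top)
          next
            case False
            define v where "v = ?\<phi> (\<chi> i. of_real r * cis (t i))"
            have vi: "v $ i = lens_map \<theta> (of_real r * cis (t i))" for i unfolding v_def multi_lens_def by simp
            have "(\<chi> i. of_real r * cis (t i)) \<in> polydisk" using r by (simp add: polydisk_def norm_mult)
            then have v: "v \<in> polydisk" unfolding v_def by (rule multi_lens_in_polydisk[OF \<theta>])
            define s where "s = (\<lambda>i. \<bar>sin (2 * t i)\<bar> powr \<sigma>)"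
            have s: "0 < s i" for i unfolding s_def using False by simp
            have w0: "0 < 1 - (cmod (v $ i))\<^sup>2" for i using v one_minus_norm_sq_pos unfolding polydisk_def by auto
            have Ev: "E (\<chi> i. of_real r * cis (t i)) = f v - (\<Sum>p\<in>(\<Pi>\<^sub>E i\<in>UNIV. A). (\<Prod>i\<in>UNIV. c (p i) (v $ i)) * f (\<chi> i. p i))"
              unfolding E_def R_def comp_op_def o_def v_def[symmetric] g_def vi G_def by (simp add: mult.commute)
            have "(cmod (E (\<chi> i. of_real r * cis (t i))))\<^sup>2 \<le>
               4 ^ CARD('n) * (\<Sum>i\<in>UNIV. (cmod (\<Prod>a\<in>A. blaschke a (v $ i)))\<^sup>2) * (\<Prod>i\<in>UNIV. 1 / (1 - (cmod (v $ i))\<^sup>2))"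
              unfolding Ev using interp[OF f f1 v] by simp
            also have "\<dots> = 4 ^ CARD('n) * ((\<Sum>k\<in>UNIV. (cmod (\<Prod>a\<in>A. blaschke a (v $ k)))\<^sup>2 * (\<Prod>i\<in>UNIV. 1 / (1 - (cmod (v $ i))\<^sup>2))))"
              by (simp add: sum_distrib_right)
            also have "\<dots> \<le> 4 ^ CARD('n) * (\<Sum>k\<in>(UNIV::'n set). exp (- b * L) * C ^ CARD('n) * (\<Prod>i\<in>UNIV. 1 / s i))"
            proof (intro mult_left_mono sum_mono)
              fix k
              have "(cmod (\<Prod>a\<in>A. blaschke a (v $ k)))\<^sup>2 * (\<Prod>i\<in>UNIV. 1 / (1 - (cmod (v $ i))\<^sup>2))
                 = ((cmod (\<Prod>a\<in>A. blaschke a (v $ k)))\<^sup>2 / (1 - (cmod (v $ k))\<^sup>2)) * (\<Prod>i\<in>UNIV - {k}. 1 / (1 - (cmod (v $ i))\<^sup>2))"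
                by (subst prod.remove[of UNIV k]) auto
              \<comment> \<open>Coordinate k takes the decaying estimate \<open>C2\<close>, all
                others the plain one \<open>C1\<close>.\<close>
              also have "\<dots> \<le> (C * exp (- b * L) / s k) * (\<Prod>i\<in>UNIV - {k}. C / s i)"
                using False r C C1 C2[of r "t k" L] w0 s unfolding vi s_def A_def
                by (intro mult_mono prod_mono conjI prod_nonneg divide_nonneg_nonneg) (auto intro: less_imp_le)
              also have "\<dots> = exp (- b * L) * (\<Prod>i\<in>UNIV. C / s i)"
                by (subst prod.remove[of UNIV k "\<lambda>i. C / s i"]) auto
              also have "(\<Prod>i\<in>UNIV. C / s i) = C ^ CARD('n) * (\<Prod>i\<in>UNIV. 1 / s i)"
                by (simp add: divide_inverse prod.distrib)
              finally show "(cmod (\<Prod>a\<in>A. blaschke a (v $ k)))\<^sup>2 * (\<Prod>i\<in>UNIV. 1 / (1 - (cmod (v $ i))\<^sup>2))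
                \<le> exp (- b * L) * C ^ CARD('n) * (\<Prod>i\<in>UNIV. 1 / s i)" by (simp add: mult.assoc)
            qed simp
            also have "\<dots> = K0 * exp (- b * L) * (\<Prod>i\<in>UNIV. 1 / s i)" unfolding K0_def by simp
            finally have "ennreal ((cmod (E (\<chi> i. of_real r * cis (t i))))\<^sup>2) \<le> ennreal (K0 * exp (- b * L) * (\<Prod>i\<in>UNIV. 1 / s i))"
              by (rule ennreal_leI)
            also have "\<dots> = ennreal (K0 * exp (- b * L)) * ennreal (\<Prod>i\<in>UNIV. 1 / s i)"
              using K0 s by (intro ennreal_mult prod_nonneg) (auto intro: less_imp_le)
            also have "ennreal (\<Prod>i\<in>UNIV. 1 / s i) = (\<Prod>i\<in>UNIV. ennreal (1 / s i))"
              using s by (intro prod_ennreal[symmetric]) (auto intro: less_imp_le)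
            also have "\<dots> = (\<Prod>i\<in>UNIV. sing_weight \<sigma> (t i))"
              using s unfolding sing_weight_def s_def[symmetric] by (simp add: inverse_ennreal s_def inverse_eq_divide)
            finally show ?thesis .
          qed
        qed (use r in auto)
        also have "\<dots> = ennreal (K0 * exp (- b * L) * I0 ^ CARD('n))"
          unfolding I0(2) using K0 I0 by (simp add: ennreal_power ennreal_mult)
        finally have "torus_mean E r \<le> K0 * exp (- b * L) * I0 ^ CARD('n)"
          using K0 I0 by (subst (asm) ennreal_le_iff) auto
        also have "\<dots> = K0 * I0 ^ CARD('n) * (exp (- (b / 2) * L))\<^sup>2"
          by (simp add: exp_double[symmetric])
        also have "K0 * I0 ^ CARD('n) = (sqrt (K0 * I0 ^ CARD('n)))\<^sup>2" using K0 I0 by simp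
        also have "\<dots> \<le> K\<^sup>2" unfolding K_def using K0 I0 by (intro power_mono) auto
        finally show ?thesis by (simp add: power_mult_distrib mult_right_mono)
      qed
      then show "h2_norm (\<lambda>z. comp_op ?\<phi> f z - R f z) \<le> ereal (K * exp (- (b / 2) * L))"
        unfolding E_def[symmetric] using K by (subst h2_norm_le_iff) auto
    qed
    then show ?thesis unfolding approx_num_def using rank by (intro INF_lower2[of R]) auto
  qed
  show thesis by (rule that[OF K _ main]) (use C(2) in simp)
qed

section \<open>The lower bound\<close>

text \<open>Equals tanh (m / (2 L)), the pseudo-hyperbolic distance of two nodes that are m steps
  apart.\<close>

definition node_dist :: "nat \<Rightarrow> nat \<Rightarrow> real" where
  "node_dist L m = (exp (m / L) - 1) / (exp (m / L) + 1)"

text \<open>With y = 2 / (exp (m / L) - 1) the distance is 1 / (1 + y). The bound 1 + y \<le> exp (2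
  sqrt y) with y \<le> 2 L / m suits m \<le> L, and 1 + y \<le> exp y with y \<le> 4 L^2 / m^2 suits
  m \<ge> L; both exponents can be summed by telescoping.\<close>

lemma node_dist_bounds:
  assumes L: "0 < L" and m: "0 < m"
  shows "exp (- 3 * sqrt (L / m)) \<le> node_dist L m"
    and "exp (- 4 * (real L)\<^sup>2 / (real m)\<^sup>2) \<le> node_dist L m"
    and "0 < node_dist L m" "node_dist L m \<le> 1"
proof -
  define x where "x = real m / real L"
  have x: "0 < x" unfolding x_def using L m by simp
  define y where "y = 2 / (exp x - 1)"
  have e: "x \<le> exp x - 1" "x\<^sup>2 / 2 \<le> exp x - 1"
    using exp_ge_add_one_self[of x] exp_lower_Taylor_quadratic[of x] x by linarith+
  have e0: "0 < exp x - 1" using x by simp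
  have y: "0 < y" unfolding y_def using e0 by simp
  have t: "node_dist L m = 1 / (1 + y)" unfolding node_dist_def y_def x_def[symmetric] using e0 by (simp add: field_simps)
  then show "0 < node_dist L m" "node_dist L m \<le> 1" using y by simp_all
  have tz: "exp (- z) \<le> node_dist L m" if "1 + y \<le> exp z" for z
    unfolding t exp_minus inverse_eq_divide using that y by (intro divide_left_mono) auto
  have "y \<le> 2 / x" unfolding y_def using e x e0 by (intro divide_left_mono) auto
  then have "sqrt y \<le> sqrt (2 * (L / m))" unfolding x_def by simp
  also have "\<dots> = sqrt 2 * sqrt (L / m)" by (rule real_sqrt_mult)
  \<comment> \<open>sqrt 2 \<le> 3 / 2 gives the 3 in the exponent.\<close>
  also have "\<dots> \<le> 3 / 2 * sqrt (L / m)"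
    by (intro mult_right_mono real_le_lsqrt) (auto simp: power2_eq_square)
  finally have sy: "2 * sqrt y \<le> 3 * sqrt (L / m)" by simp
  have "1 + y \<le> (1 + sqrt y)\<^sup>2" using y by (simp add: power2_eq_square algebra_simps)
  also have "\<dots> \<le> (exp (sqrt y))\<^sup>2" by (intro power_mono) (use y in auto)
  also have "\<dots> = exp (2 * sqrt y)" by (simp add: exp_double)
  also have "\<dots> \<le> exp (3 * sqrt (L / m))" using sy by simp
  finally show "exp (- 3 * sqrt (L / m)) \<le> node_dist L m" using tz by simp
  have "y \<le> 2 / (x\<^sup>2 / 2)" unfolding y_def using e x e0 by (intro divide_left_mono) auto
  also have "\<dots> = 4 * (real L)\<^sup>2 / (real m)\<^sup>2" unfolding x_def by (simp add: power_divide)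
  finally have "1 + y \<le> exp (4 * (real L)\<^sup>2 / (real m)\<^sup>2)" using exp_ge_add_one_self[of y] exp_le_cancel_iff[of y "4 * (real L)\<^sup>2 / (real m)\<^sup>2"] by linarith
  from tz[OF this] show "exp (- 4 * (real L)\<^sup>2 / (real m)\<^sup>2) \<le> node_dist L m" by simp
qed

text \<open>The exponents 3 sqrt (L / m) are summed by comparing 1 / sqrt m with 2 (sqrt m - sqrt (m
  - 1)).\<close>

lemma prod_node_dist_small:
  assumes L: "0 < L"
  shows "exp (- 6 * sqrt L * sqrt k) \<le> (\<Prod>m=1..k. node_dist L m)"
proof (induction k)
  case (Suc k)
  define a b where "a = sqrt (real k)" and "b = sqrt (real (Suc k))"
  have ab: "a \<le> b" "0 < b" "0 \<le> a" unfolding a_def b_def by simp_all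
  have "1 = (b - a) * (b + a)" unfolding a_def b_def by (simp add: algebra_simps)
  also have "(b - a) * (b + a) \<le> (b - a) * (2 * b)" using ab by (intro mult_left_mono) auto
  finally have "1 / b \<le> 2 * (b - a)" using ab by (simp add: field_simps)
  then have "3 * sqrt L * (1 / b) \<le> 3 * sqrt L * (2 * (b - a))" by (intro mult_left_mono) auto
  then have "- 6 * sqrt L * b \<le> - 6 * sqrt L * a - 3 * sqrt (L / Suc k)"
    by (simp add: real_sqrt_divide b_def algebra_simps)
  then have "exp (- 6 * sqrt L * b) \<le> exp (- 6 * sqrt L * a - 3 * sqrt (L / Suc k))" by (simp only: exp_le_cancel_iff)
  also have "\<dots> = exp (- 6 * sqrt L * a) * exp (- 3 * sqrt (L / Suc k))"
    by (simp only: exp_add[symmetric]) simp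
  also have "\<dots> \<le> (\<Prod>m=1..k. node_dist L m) * node_dist L (Suc k)"
    using Suc.IH node_dist_bounds[OF L, of "Suc k"] unfolding a_def
    by (intro mult_mono prod_nonneg) (auto intro!: less_imp_le node_dist_bounds(3) L)
  finally show ?case unfolding b_def by simp
qed simp

text \<open>The first L factors cost exp (- 6 L) by the square-root bound; past L the inverse
  squares telescope through 1 / m^2 \<le> 1 / (m - 1) - 1 / m.\<close>

lemma prod_node_dist_large:
  assumes L: "0 < L" and "L \<le> k"
  shows "exp (- 6 * real L - 4 * (real L)\<^sup>2 * (1 / L - 1 / k)) \<le> (\<Prod>m=1..k. node_dist L m)"
  using assms(2)
proof (induction k rule: dec_induct)
  case base
  show ?case using prod_node_dist_small[OF L, of L] by (simp add: mult.assoc)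
next
  case (step k)
  have k: "0 < real k" using step L by simp
  have "1 / (real (Suc k))\<^sup>2 \<le> 1 / (real k * real (Suc k))"
    using k by (intro divide_left_mono) (auto simp: power2_eq_square)
  also have "\<dots> = 1 / k - 1 / Suc k" using k by (simp add: field_simps)
  finally have "4 * (real L)\<^sup>2 * (1 / (real (Suc k))\<^sup>2) \<le> 4 * (real L)\<^sup>2 * (1 / k - 1 / Suc k)"
    by (intro mult_left_mono) auto
  then have "- 6 * real L - 4 * (real L)\<^sup>2 * (1 / L - 1 / Suc k) \<le> (- 6 * real L - 4 * (real L)\<^sup>2 * (1 / L - 1 / k)) + (- 4 * (real L)\<^sup>2 / (real (Suc k))\<^sup>2)"
    by (simp add: algebra_simps)
  then have "exp (- 6 * real L - 4 * (real L)\<^sup>2 * (1 / L - 1 / Suc k)) \<le> exp (- 6 * real L - 4 * (real L)\<^sup>2 * (1 / L - 1 / k)) * exp (- 4 * (real L)\<^sup>2 / (real (Suc k))\<^sup>2)"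
    by (simp only: exp_add[symmetric] exp_le_cancel_iff)
  also have "\<dots> \<le> (\<Prod>m=1..k. node_dist L m) * node_dist L (Suc k)"
    by (intro mult_mono step.IH node_dist_bounds(2) L prod_nonneg)
       (auto intro!: less_imp_le node_dist_bounds(3) L)
  finally show ?case by simp
qed

text \<open>The loss 10 L is 6 L from the near factors and at most 4 L from the far ones. That it
  does not grow with \<open>k\<close> is what permits L^2 nodes.\<close>

lemma prod_node_dist:
  assumes L: "0 < L"
  shows "exp (- 10 * real L) \<le> (\<Prod>m=1..k. node_dist L m)"
proof (cases "L \<le> k")
  case True
  have "4 * (real L)\<^sup>2 * (1 / L - 1 / k) \<le> 4 * (real L)\<^sup>2 * (1 / L)" by (intro mult_left_mono) auto
  also have "\<dots> = 4 * L" using L by (simp add: power2_eq_square)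
  finally have "- 10 * real L \<le> - 6 * real L - 4 * (real L)\<^sup>2 * (1 / L - 1 / k)" by simp
  then have "exp (- 10 * real L) \<le> exp (- 6 * real L - 4 * (real L)\<^sup>2 * (1 / L - 1 / k))" by (simp only: exp_le_cancel_iff)
  also have "\<dots> \<le> (\<Prod>m=1..k. node_dist L m)" by (rule prod_node_dist_large[OF L True])
  finally show ?thesis .
next
  case False
  have "sqrt L * sqrt k \<le> sqrt L * sqrt L" using False by (intro mult_left_mono) auto
  also have "\<dots> = L" by simp
  finally have "- 10 * real L \<le> - 6 * (sqrt L * sqrt k)" by linarith
  then have "- 10 * real L \<le> - 6 * sqrt L * sqrt k" by (simp only: mult.assoc)
  then have "exp (- 10 * real L) \<le> exp (- 6 * sqrt L * sqrt k)" by (simp only: exp_le_cancel_iff)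
  also have "\<dots> \<le> (\<Prod>m=1..k. node_dist L m)" by (rule prod_node_dist_small[OF L])
  finally show ?thesis .
qed

lemma node_eq: "node x = (of_real x - 1) / (of_real x + 1)"
  unfolding node_def by simp

text \<open>The distance is translation invariant in the logarithmic coordinate, so only |i - j|
  matters; the case split spells it out for natural numbers.\<close>

lemma norm_blaschke_exp_nodes:
  assumes "0 < L"
  shows "cmod (blaschke (node (exp (real i / real L))) (node (exp (real j / real L)))) = node_dist L (if i \<le> j then j - i else i - j)"
proof -
  have *: "\<bar>exp y - exp x\<bar> / (exp y + exp x) = (exp \<bar>y - x\<bar> - 1) / (exp \<bar>y - x\<bar> + 1)" for x y :: real
  proof -
    have **: "\<bar>exp y - exp x\<bar> / (exp y + exp x) = (exp (y - x) - 1) / (exp (y - x) + 1)" if "x \<le> y" for x y :: real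
    proof -
      have "exp y = exp x * exp (y - x)" by (simp flip: exp_add)
      then have "\<bar>exp y - exp x\<bar> / (exp y + exp x) = (exp x * (exp (y - x) - 1)) / (exp x * (exp (y - x) + 1))"
        using that by (simp add: algebra_simps)
      then show ?thesis by simp
    qed
    show ?thesis
    proof (cases "x \<le> y")
      case True then show ?thesis using **[of x y] by simp
    next
      case False then show ?thesis using **[of y x] by (simp add: abs_minus_commute add.commute)
    qed
  qed
  have "blaschke (node (exp (real i / real L))) (node (exp (real j / real L))) = 
     of_real ((exp (real j / real L) - exp (real i / real L)) / (exp (real j / real L) + exp (real i / real L)))"
    unfolding node_eq[of "exp (real j / real L)"] by (subst blaschke_node) auto
  then have "cmod (blaschke (node (exp (real i / real L))) (node (exp (real j / real L)))) = 
     \<bar>exp (real j / real L) - exp (real i / real L)\<bar> / (exp (real j / real L) + exp (real i / real L))"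
    by (simp only: norm_of_real abs_divide) simp
  also have "\<dots> = node_dist L (if i \<le> j then j - i else i - j)"
  proof -
    have "\<bar>real j / real L - real i / real L\<bar> = \<bar>real j - real i\<bar> / L" by (simp flip: diff_divide_distrib)
    also have "\<bar>real j - real i\<bar> = real (if i \<le> j then j - i else i - j)" by (auto simp: of_nat_diff)
    finally show ?thesis unfolding * node_dist_def by simp
  qed
  finally show ?thesis .
qed

text \<open>The nodes to the left and those to the right of node j each give a product of distances
  over consecutive steps, hence 20 = 2 * 10.\<close>

lemma prod_blaschke_exp_nodes:
  assumes L: "0 < L" and j: "j < k"
  shows "exp (- 20 * real L) \<le> (\<Prod>i\<in>{..<k} - {j}. cmod (blaschke (node (exp (real i / real L))) (node (exp (real j / real L)))))"
proof -
  have nn: "0 \<le> (\<Prod>m=1..k. node_dist L m)" for k by (intro prod_nonneg) (auto intro!: less_imp_le node_dist_bounds(3) L)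
  have s: "{..<k} - {j} = {..<j} \<union> {j<..<k}" "{..<j} \<inter> {j<..<k} = {}" using j by auto
  have 1: "(\<Prod>i\<in>{..<j}. node_dist L (if i \<le> j then j - i else i - j)) = (\<Prod>m=1..j. node_dist L m)"
    by (rule prod.reindex_bij_witness[of _ "\<lambda>m. j - m" "\<lambda>i. j - i"]) auto
  have 2: "(\<Prod>i\<in>{j<..<k}. node_dist L (if i \<le> j then j - i else i - j)) = (\<Prod>m=1..k - 1 - j. node_dist L m)"
    by (rule prod.reindex_bij_witness[of _ "\<lambda>m. j + m" "\<lambda>i. i - j"]) auto
  have "exp (- 20 * real L) = exp (- 10 * real L) * exp (- 10 * real L)" by (simp flip: exp_add)
  also have "\<dots> \<le> (\<Prod>m=1..j. node_dist L m) * (\<Prod>m=1..k - 1 - j. node_dist L m)"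
    by (intro mult_mono prod_node_dist L nn) auto
  also have "\<dots> = (\<Prod>i\<in>{..<k} - {j}. cmod (blaschke (node (exp (real i / real L))) (node (exp (real j / real L)))))"
    unfolding norm_blaschke_exp_nodes[OF L] s(1) 1[symmetric] 2[symmetric] using s(2)
    by (subst prod.union_disjoint) auto
  finally show ?thesis .
qed

text \<open>Blaschke products over the remaining nodes, normalised at node j; on the disk they are
  bounded by the reciprocal of the normalising value alone.\<close>

lemma blaschke_lagrange:
  assumes L: "0 < L"
  obtains F where "\<And>j. j < k \<Longrightarrow> F j holomorphic_on ball 0 1"
    "\<And>j v. j < k \<Longrightarrow> cmod v < 1 \<Longrightarrow> cmod (F j v) \<le> exp (20 * real L)"
    "\<And>j l. j < k \<Longrightarrow> l < k \<Longrightarrow> F j (node (exp (real l / real L))) = (if l = j then 1 else 0)"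
proof -
  define a where "a = (\<lambda>j. node (exp (real j / real L)))"
  have a: "cmod (a j) < 1" for j unfolding a_def by (rule norm_node) simp
  define D where "D = (\<lambda>j. \<Prod>i\<in>{..<k} - {j}. blaschke (a i) (a j))"
  have D: "exp (- 20 * real L) \<le> cmod (D j)" if "j < k" for j
    unfolding D_def prod_norm[symmetric] a_def by (rule prod_blaschke_exp_nodes[OF L that])
  then have D0: "D j \<noteq> 0" if "j < k" for j using that by (metis exp_gt_zero norm_zero not_le)
  define F where "F = (\<lambda>j v. (\<Prod>i\<in>{..<k} - {j}. blaschke (a i) v) / D j)"
  show thesis
  proof (rule that[of F])
    fix j assume j: "j < k"
    have "F j analytic_on cball 0 1" unfolding F_def divide_inverse
      by (intro analytic_intros blaschke_analytic a)
    then have "F j holomorphic_on cball 0 1" by (rule analytic_imp_holomorphic)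
    then show "F j holomorphic_on ball 0 1" by (rule holomorphic_on_subset) auto
    show "cmod (F j v) \<le> exp (20 * real L)" if v: "cmod v < 1" for v
    proof -
      have "cmod (F j v) = cmod (\<Prod>i\<in>{..<k} - {j}. blaschke (a i) v) / cmod (D j)" unfolding F_def by (rule norm_divide)
      also have "\<dots> \<le> 1 / exp (- 20 * real L)"
        unfolding prod_norm[symmetric] using D[OF j] a v
        by (intro frac_le prod_le_1) (auto intro!: norm_blaschke_le_1)
      finally show ?thesis by (simp add: exp_minus field_simps)
    qed
    fix l assume l: "l < k"
    show "F j (node (exp (real l / real L))) = (if l = j then 1 else 0)"
    proof (cases "l = j")
      case True
      then show ?thesis using D0[OF j] unfolding F_def D_def a_def by simp
    next
      case False
      have "blaschke (a l) (a l) = 0" unfolding blaschke_def by simp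
      then have "(\<Prod>i\<in>{..<k} - {j}. blaschke (a i) (a l)) = 0" using l False by (intro prod_zero) auto
      then show ?thesis using False unfolding F_def a_def by simp
    qed
  qed
qed

lemma lens_map_node:
  assumes \<theta>: "0 < \<theta>" "\<theta> < 1" and x: "0 < x"
  shows "lens_map \<theta> (node (x powr (1 / \<theta>))) = node x"
proof -
  define p where "p = x powr (1 / \<theta>)"
  have p: "0 < p" unfolding p_def using x by simp
  then have nz: "complex_of_real p + 1 \<noteq> 0" by (auto simp: complex_eq_iff)
  have "(1 + node p) / (1 - node p) = of_real p"
  proof -
    have "1 + node p = 2 * of_real p / (of_real p + 1)" "1 - node p = 2 / (of_real p + 1)"
      unfolding node_eq using nz by (simp_all add: field_simps)
    then show ?thesis using nz by simp
  qed
  then have "lens_power \<theta> (node p) = of_real (p powr \<theta>)"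
    unfolding lens_power_def using p by (simp add: powr_of_real)
  also have "p powr \<theta> = x" unfolding p_def using x \<theta> by (simp add: powr_powr)
  finally show ?thesis
    unfolding p_def[symmetric] lens_map_eq[OF \<theta> norm_node[OF p]] node_eq[of x] by simp
qed

lemma node_defect:
  assumes "1 \<le> p" shows "1 / p \<le> 1 - (cmod (node p))\<^sup>2"
proof -
  have "1 - (cmod (node p))\<^sup>2 = 4 * p / (p + 1)\<^sup>2"
    unfolding node_eq using one_minus_norm_cayley_sq[of "of_real p"] assms
    by (simp add: norm_of_real[symmetric] del: norm_of_real)
  moreover have "(p + 1)\<^sup>2 \<le> (2 * p)\<^sup>2" using assms by (intro power_mono) auto
  then have "1 / p \<le> 4 * p / (p + 1)\<^sup>2" using assms by (simp add: field_simps power2_eq_square)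
  ultimately show ?thesis by simp
qed

text \<open>Gaussian elimination: if some unknown l occurs in the last equation, it is solved for
  and eliminated from the others, which leaves one equation and one unknown fewer.\<close>

lemma homogeneous_system_nontrivial:
  fixes C :: "'a \<Rightarrow> nat \<Rightarrow> complex"
  assumes "finite J" "k < card J"
  shows "\<exists>y. (\<exists>j\<in>J. y j \<noteq> 0) \<and> (\<forall>i<k. (\<Sum>j\<in>J. y j * C j i) = 0)"
  using assms
proof (induction k arbitrary: J C)
  case 0
  then have "J \<noteq> {}" by auto
  then show ?case by (intro exI[of _ "\<lambda>_. 1"]) auto
next
  case (Suc k)
  show ?case
  proof (cases "\<forall>j\<in>J. C j k = 0")
    case True
    obtain y where y: "\<exists>j\<in>J. y j \<noteq> 0" "\<forall>i<k. (\<Sum>j\<in>J. y j * C j i) = 0"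
      using Suc.IH[of J C] Suc.prems by auto
    moreover have "(\<Sum>j\<in>J. y j * C j k) = 0" using True by simp
    ultimately show ?thesis by (intro exI[of _ y]) (auto simp: less_Suc_eq)
  next
    case False
    then obtain l where l: "l \<in> J" "C l k \<noteq> 0" by auto
    define C' where "C' = (\<lambda>j i. C j i - C j k / C l k * C l i)"
    have "k < card (J - {l})" using Suc.prems l by simp
    then obtain y where y: "\<exists>j\<in>J - {l}. y j \<noteq> 0" "\<forall>i<k. (\<Sum>j\<in>J - {l}. y j * C' j i) = 0"
      using Suc.IH[of "J - {l}" C'] Suc.prems by auto
    define z where "z = y(l := - (\<Sum>j\<in>J - {l}. y j * (C j k / C l k)))"
    have "(\<Sum>j\<in>J. z j * C j i) = (\<Sum>j\<in>J - {l}. y j * C' j i)" for i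
    proof -
      have "(\<Sum>j\<in>J. z j * C j i) = z l * C l i + (\<Sum>j\<in>J - {l}. z j * C j i)"
        using Suc.prems l by (intro sum.remove) auto
      also have "(\<Sum>j\<in>J - {l}. z j * C j i) = (\<Sum>j\<in>J - {l}. y j * C j i)"
        by (intro sum.cong) (auto simp: z_def)
      also have "z l * C l i = - (\<Sum>j\<in>J - {l}. y j * (C j k / C l k * C l i))"
        unfolding z_def by (simp add: sum_distrib_right mult.assoc)
      finally show ?thesis unfolding C'_def by (simp add: right_diff_distrib sum_subtractf)
    qed
    moreover have "C' j k = 0" for j unfolding C'_def using l by simp
    ultimately have "\<forall>i<Suc k. (\<Sum>j\<in>J. z j * C j i) = 0" using y(2) by (auto simp: less_Suc_eq)
    moreover have "\<exists>j\<in>J. z j \<noteq> 0" using y(1) unfolding z_def by auto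
    ultimately show ?thesis by blast
  qed
qed

text \<open>The point evaluation bound read backwards. The norm is an extended real, so the
  contradiction goes through a real number strictly between it and
  \<open>\<epsilon>\<close>.\<close>

lemma h2_norm_ge_point:
  fixes g :: "'n::finite hfun"
  assumes g: "holo_polydisk g" and v: "v \<in> polydisk" and \<epsilon>: "0 < \<epsilon>"
    and ge: "\<epsilon>\<^sup>2 * (\<Prod>i\<in>UNIV. 1 / (1 - (cmod (v $ i))\<^sup>2)) \<le> (cmod (g v))\<^sup>2"
  shows "ereal \<epsilon> \<le> h2_norm g"
proof (rule ccontr)
  assume "\<not> ereal \<epsilon> \<le> h2_norm g"
  then obtain e where e: "h2_norm g < ereal e" "ereal e < ereal \<epsilon>"
    using ereal_dense2[of "h2_norm g" "ereal \<epsilon>"] by (meson not_le)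
  have "ereal (sqrt (torus_mean g (1/2))) \<le> h2_norm g" unfolding h2_norm_def by (rule SUP_upper) simp
  moreover have "0 \<le> torus_mean g (1/2)" by (intro torus_mean_nonneg holo_polydisk_continuous g) auto
  ultimately have e0: "0 \<le> e" using e(1) by (metis ereal_less_eq(3) le_less_trans less_imp_le order_trans real_sqrt_ge_zero)
  define W where "W = (\<Prod>i\<in>UNIV. 1 / (1 - (cmod (v $ i))\<^sup>2))"
  have W: "0 < W" unfolding W_def using v one_minus_norm_sq_pos by (intro prod_pos) (auto simp: polydisk_def)
  have "(cmod (g v))\<^sup>2 \<le> W * e\<^sup>2" unfolding W_def
    using e(1) h2_norm_le_iff[OF e0, of g] by (intro polydisk_point_bound[OF g v]) auto
  also have "\<dots> < W * \<epsilon>\<^sup>2" using W e(2) e0 by (intro mult_strict_left_mono power_strict_mono) auto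
  also have "\<dots> \<le> (cmod (g v))\<^sup>2" using ge unfolding W_def by (simp add: mult.commute)
  finally show False by simp
qed

text \<open>Per coordinate the exponent collects 20 from the size of the Lagrange functions, 2 from
  the number of grid points via L^2 \<le> exp (2 L), and 1 / (2 \<theta>) from the square root of
  the evaluation weight exp (L / \<theta>) at the preimage of a node.\<close>

lemma approx_num_multi_lens_lower:
  fixes L n :: nat
  assumes \<theta>: "0 < \<theta>" "\<theta> < 1" and L: "0 < L" and n: "n \<le> (L\<^sup>2) ^ CARD('n)"
  shows "ereal (exp (- ((22 + 1 / (2 * \<theta>)) * CARD('n)) * L)) \<le> approx_num (comp_op (multi_lens \<theta> :: complex^'n::finite \<Rightarrow> complex^'n)) n"
  unfolding approx_num_def
proof (rule INF_greatest)
  let ?\<phi> = "multi_lens \<theta> :: complex^'n \<Rightarrow> complex^'n"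
  let ?d = "CARD('n)"
  fix R :: "'n hfun \<Rightarrow> 'n hfun" assume "R \<in> {R. rank_less R n}"
  then have Radd: "\<And>f g. f \<in> H2 \<Longrightarrow> g \<in> H2 \<Longrightarrow> R (\<lambda>z. f z + g z) = (\<lambda>z. R f z + R g z)"
    and Rscale: "\<And>f c. f \<in> H2 \<Longrightarrow> R (\<lambda>z. c * f z) = (\<lambda>z. c * R f z)"
    and "\<exists>k g. k < n \<and> (\<forall>i<k. g i \<in> H2) \<and> (\<forall>f\<in>H2. \<exists>c. R f = (\<lambda>z. \<Sum>i<k. c i * g i z))"
    unfolding rank_less_def by auto
  then obtain k g where k: "k < n" and "\<forall>f\<in>H2. \<exists>c. R f = (\<lambda>z. \<Sum>i<k. c i * g i z)" by auto
  \<comment> \<open>Merely a choice of coefficients for each function, not known to be linear;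
    linearity enters through \<open>R\<close> alone.\<close>
  then obtain coef where coef: "\<And>f. f \<in> H2 \<Longrightarrow> R f = (\<lambda>z. \<Sum>i<k. coef f i * g i z)" by metis
  \<comment> \<open>Nonnegative exponents are enough, since only the number of nodes counts; they
    keep the half-plane coordinates at least 1.\<close>
  define a where "a = (\<lambda>j::nat. node (exp (real j / real L)))"
  obtain F where Fholo: "\<And>j. j < L\<^sup>2 \<Longrightarrow> F j holomorphic_on ball 0 1"
    and Fbd: "\<And>j v. j < L\<^sup>2 \<Longrightarrow> cmod v < 1 \<Longrightarrow> cmod (F j v) \<le> exp (20 * real L)"
    and Fval: "\<And>j l. j < L\<^sup>2 \<Longrightarrow> l < L\<^sup>2 \<Longrightarrow> F j (a l) = (if l = j then 1 else 0)"
    unfolding a_def by (rule blaschke_lagrange[OF L, of "L\<^sup>2"]) blast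
  define J where "J = (\<Pi>\<^sub>E i\<in>(UNIV::'n set). {..<L\<^sup>2})"
  have J: "finite J" unfolding J_def by (intro finite_PiE) auto
  have cJ: "card J = (L\<^sup>2) ^ ?d" unfolding J_def by (simp add: card_PiE)
  have Jlt: "j i < L\<^sup>2" if "j \<in> J" for j i using that unfolding J_def by auto
  define f where "f = (\<lambda>j (z::complex^'n). \<Prod>i\<in>UNIV. F (j i) (z $ i))"
  define M where "M = exp (20 * real L) ^ ?d"
  have fholo: "holo_polydisk (f j)" if "j \<in> J" for j
    unfolding f_def by (intro holo_polydisk_prod holo_polydisk_coord Fholo Jlt that)
  have fbd: "cmod (f j z) \<le> M" if "j \<in> J" "z \<in> polydisk" for j z
  proof -
    have "(\<Prod>i\<in>UNIV. cmod (F (j i) (z $ i))) \<le> (\<Prod>i\<in>(UNIV::'n set). exp (20 * real L))"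
      using that(2) by (intro prod_mono conjI Fbd Jlt that(1)) (auto simp: polydisk_def)
    then show ?thesis unfolding f_def M_def prod_norm by simp
  qed
  have fH2: "f j \<in> H2" if "j \<in> J" for j by (rule bounded_holo_in_H2[OF fholo fbd]) (use that in auto)
  have "k < card J" using k n cJ by simp
  then obtain y where y: "\<exists>j\<in>J. y j \<noteq> 0" "\<forall>i<k. (\<Sum>j\<in>J. y j * coef (f j) i) = 0"
    using homogeneous_system_nontrivial[OF J, of k "\<lambda>j. coef (f j)"] by blast
  define m where "m = Max ((\<lambda>j. cmod (y j)) ` J)"
  have "m \<in> (\<lambda>j. cmod (y j)) ` J" unfolding m_def using J y(1) by (intro Max_in) auto
  then obtain l where l: "l \<in> J" "cmod (y l) = m" by auto
  have ym: "cmod (y j) \<le> m" if "j \<in> J" for j unfolding m_def using J that by (intro Max_ge) auto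
  have m0: "0 < m" using y(1) ym by (metis less_le_trans zero_less_norm_iff)
  define N where "N = real (card J)"
  have N: "0 < N" unfolding N_def cJ using L by simp
  have M: "0 < M" unfolding M_def by simp
  \<comment> \<open>Scaled so that the combination is bounded by 1 (N terms of size at most 1 / N)
    while its largest coefficient is still 1 / (N M).\<close>
  define w where "w = (\<lambda>j. y j / (m * N * M))"
  have wbd: "cmod (w j) \<le> 1 / (N * M)" if "j \<in> J" for j
    unfolding w_def using ym[OF that] m0 N M by (simp add: norm_divide norm_mult field_simps)
  have wl: "cmod (w l) = 1 / (N * M)" unfolding w_def using l m0 N M by (simp add: norm_divide norm_mult)
  have wsum: "(\<Sum>j\<in>J. w j * coef (f j) i) = 0" if "i < k" for i
    using y(2) that unfolding w_def by (simp add: sum_divide_distrib[symmetric])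
  \<comment> \<open>Defined for every subset of \<open>J\<close> so that \<open>R\<close> can be
    moved through the sum by induction.\<close>
  define h where "h = (\<lambda>X z. \<Sum>j\<in>X. w j * f j z)"
  have hH: "holo_polydisk (h X)" "h X \<in> H2" "\<And>z. z \<in> polydisk \<Longrightarrow> cmod (h X z) \<le> card X * (1 / N)" if X: "X \<subseteq> J" for X
  proof -
    show ho: "holo_polydisk (h X)" unfolding h_def
      using X by (intro holo_polydisk_sum holo_polydisk_mult holo_polydisk_const fholo) auto
    show bd: "cmod (h X z) \<le> card X * (1 / N)" if z: "z \<in> polydisk" for z
    proof -
      have "cmod (h X z) \<le> (\<Sum>j\<in>X. 1 / N)" unfolding h_def
      proof (rule sum_norm_le)
        fix j assume "j \<in> X"
        then have j: "j \<in> J" using X by auto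
        have "cmod (w j * f j z) \<le> 1 / (N * M) * M"
          unfolding norm_mult using wbd[OF j] fbd[OF j z] N M by (intro mult_mono) auto
        then show "cmod (w j * f j z) \<le> 1 / N" using M by simp
      qed
      then show ?thesis by simp
    qed
    show "h X \<in> H2" by (rule bounded_holo_in_H2[OF ho bd])
  qed
  have Rh: "R (h X) = (\<lambda>z. \<Sum>i<k. (\<Sum>j\<in>X. w j * coef (f j) i) * g i z)" if "X \<subseteq> J" for X
    using finite_subset[OF that J] that
  proof (induction X rule: finite_induct)
    case empty
    \<comment> \<open>Homogeneity with factor 0 shows that \<open>R\<close> kills the zero
      function.\<close>
    have "R (\<lambda>z. 0 * h {} z) = (\<lambda>z. 0 * R (h {}) z)" by (rule Rscale) (rule hH(2), simp)
    then show ?case by (simp add: h_def)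
  next
    case (insert j X)
    then have j: "j \<in> J" "X \<subseteq> J" by auto
    have wf: "(\<lambda>z. w j * f j z) \<in> H2" using hH(2)[of "{j}"] j unfolding h_def by simp
    have "h (insert j X) = (\<lambda>z. w j * f j z + h X z)" unfolding h_def using insert.hyps by simp
    then have "R (h (insert j X)) = (\<lambda>z. R (\<lambda>z. w j * f j z) z + R (h X) z)" using Radd[OF wf hH(2)[OF j(2)]] by simp
    also have "R (\<lambda>z. w j * f j z) = (\<lambda>z. w j * (\<Sum>i<k. coef (f j) i * g i z))"
      unfolding Rscale[OF fH2[OF j(1)]] coef[OF fH2[OF j(1)]] ..
    finally show ?case using insert.IH[OF j(2)] insert.hyps
      by (simp add: distrib_right sum.distrib sum_distrib_left mult.assoc)
  qed
  have R0: "R (h J) = (\<lambda>z. 0)" using Rh[of J] wsum by simp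
  have h1: "h2_norm (h J) \<le> 1"
    unfolding one_ereal_def
  proof (rule h2_norm_le_bound[OF hH(1)])
    fix z :: "complex^'n" assume "z \<in> polydisk"
    then show "cmod (h J z) \<le> 1" using hH(3)[of J z] N unfolding N_def by simp
  qed simp
  define T where "T = (\<lambda>z. comp_op ?\<phi> (h J) z - R (h J) z)"
  have T: "T z = (\<Sum>j\<in>J. w j * (\<Prod>i\<in>UNIV. F (j i) (lens_map \<theta> (z $ i))))" for z
    unfolding T_def R0 unfolding comp_op_def h_def f_def multi_lens_def by simp
  have Tholo: "holo_polydisk T"
    unfolding T[abs_def]
  proof (intro holo_polydisk_sum holo_polydisk_mult holo_polydisk_const holo_polydisk_prod holo_polydisk_coord)
    fix j and i :: 'n assume "j \<in> J"
    have "lens_map \<theta> ` ball 0 1 \<subseteq> ball 0 1"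
    proof (rule image_subsetI)
      fix z :: complex assume "z \<in> ball 0 1"
      then show "lens_map \<theta> z \<in> ball 0 1" using norm_lens_map_less_1[OF \<theta>, of z] by simp
    qed
    then show "(\<lambda>z. F (j i) (lens_map \<theta> z)) holomorphic_on ball 0 1"
      using holomorphic_on_compose_gen[OF lens_map_holomorphic[OF \<theta>] Fholo[OF Jlt[OF \<open>j \<in> J\<close>]]] unfolding o_def by blast
  qed
  \<comment> \<open>Half-plane coordinates whose \<theta>-th powers are those of the nodes, so that
    \<open>u\<close> is mapped to the grid point with index \<open>l\<close>.\<close>
  define p where "p = (\<lambda>j::nat. exp (real j / real L) powr (1 / \<theta>))"
  define u :: "complex^'n" where "u = (\<chi> i. node (p (l i)))"
  have p1: "1 \<le> p j" "p j = exp (real j / (real L * \<theta>))" for j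
    unfolding p_def using \<theta> by (simp_all add: exp_powr_real)
  have u: "u \<in> polydisk" unfolding polydisk_def u_def using p1(1) by (auto intro!: norm_node less_le_trans[OF zero_less_one])
  have Tu: "T u = w l"
  proof -
    have "lens_map \<theta> (u $ i) = a (l i)" for i
      unfolding u_def a_def p_def by (simp add: lens_map_node[OF \<theta>])
    then have "T u = (\<Sum>j\<in>J. w j * (\<Prod>i\<in>UNIV. F (j i) (a (l i))))" unfolding T by simp
    also have "\<dots> = (\<Sum>j\<in>J. if j = l then w j else 0)"
    proof (rule sum.cong[OF refl])
      fix j assume j: "j \<in> J"
      show "w j * (\<Prod>i\<in>UNIV. F (j i) (a (l i))) = (if j = l then w j else 0)"
      proof (cases "j = l")
        case True
        then show ?thesis using Fval Jlt[OF l(1)] by simp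
      next
        case False
        then obtain i where "j i \<noteq> l i" by auto
        then have "F (j i) (a (l i)) = 0" using Fval Jlt[OF l(1)] Jlt[OF j] by simp
        then have "(\<Prod>i\<in>UNIV. F (j i) (a (l i))) = 0" by (intro prod_zero) auto
        then show ?thesis using False by simp
      qed
    qed
    also have "\<dots> = w l" using J l(1) by simp
    finally show ?thesis .
  qed
  define \<epsilon> where "\<epsilon> = exp (- ((22 + 1 / (2 * \<theta>)) * ?d) * L)"
  have "ereal \<epsilon> \<le> h2_norm T"
  proof (rule h2_norm_ge_point[OF Tholo u])
    show "0 < \<epsilon>" unfolding \<epsilon>_def by simp
    have "1 / (1 - (cmod (u $ i))\<^sup>2) \<le> exp (L / \<theta>)" for i
    proof -
      have "1 / p (l i) \<le> 1 - (cmod (u $ i))\<^sup>2" unfolding u_def using node_defect[OF p1(1)] by simp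
      moreover have "1 / x \<le> q" if "1 / q \<le> x" "1 \<le> q" for x q :: real
      proof -
        have "0 < 1 / q" using that(2) by simp
        then have "0 < x" using that(1) by linarith
        then show ?thesis using that by (simp add: field_simps)
      qed
      ultimately have "1 / (1 - (cmod (u $ i))\<^sup>2) \<le> p (l i)" using p1(1) by blast
      also have "\<dots> = exp (real (l i) / (real L * \<theta>))" by (rule p1(2))
      also have "\<dots> \<le> exp (L / \<theta>)"
      proof -
        have "l i \<le> L\<^sup>2" using Jlt[OF l(1), of i] by simp
        then have "real (l i) \<le> real (L\<^sup>2)" by (rule of_nat_mono)
        then have "real (l i) \<le> real L * real L" by (simp add: power2_eq_square)
        then have "real (l i) / (real L * \<theta>) \<le> (real L * real L) / (real L * \<theta>)" using \<theta> by (intro divide_right_mono) auto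
        then show ?thesis using L by simp
      qed
      finally show ?thesis .
    qed
    then have "(\<Prod>i\<in>UNIV. 1 / (1 - (cmod (u $ i))\<^sup>2)) \<le> (\<Prod>i\<in>(UNIV::'n set). exp (L / \<theta>))"
      using u one_minus_norm_sq_pos by (intro prod_mono) (auto simp: polydisk_def intro: less_imp_le)
    also have "\<dots> = exp (?d * L / \<theta>)" by (simp flip: exp_of_nat_mult)
    finally have W: "(\<Prod>i\<in>UNIV. 1 / (1 - (cmod (u $ i))\<^sup>2)) \<le> exp (?d * L / \<theta>)" .
    have "N * M \<le> exp (22 * (?d * L))"
    proof -
      have "real L \<le> exp L" using exp_ge_add_one_self[of "real L"] by linarith
      then have "N \<le> ((exp (real L))\<^sup>2) ^ ?d" unfolding N_def cJ by (simp add: power_mono)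
      also have "\<dots> = exp (2 * (?d * L))" by (simp flip: exp_of_nat_mult exp_double add: mult_ac)
      finally have "N * M \<le> exp (2 * (?d * L)) * exp (20 * (?d * L))"
        using M unfolding M_def by (intro mult_mono) (auto simp: mult_ac simp flip: exp_of_nat_mult)
      then show ?thesis by (simp add: mult_ac flip: exp_add)
    qed
    then have "exp (- 22 * (?d * L)) \<le> 1 / (N * M)"
      using N M by (simp add: exp_minus field_simps)
    then have "(exp (- 22 * (?d * L)))\<^sup>2 \<le> (cmod (T u))\<^sup>2" unfolding Tu wl by (intro power_mono) auto
    moreover have "\<epsilon>\<^sup>2 * exp (?d * L / \<theta>) = (exp (- 22 * (?d * L)))\<^sup>2"
      unfolding \<epsilon>_def exp_double[symmetric] exp_add[symmetric] using \<theta> by (simp add: field_simps)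
    moreover have "\<epsilon>\<^sup>2 * (\<Prod>i\<in>UNIV. 1 / (1 - (cmod (u $ i))\<^sup>2)) \<le> \<epsilon>\<^sup>2 * exp (?d * L / \<theta>)"
      using W by (intro mult_left_mono) auto
    ultimately show "\<epsilon>\<^sup>2 * (\<Prod>i\<in>UNIV. 1 / (1 - (cmod (u $ i))\<^sup>2)) \<le> (cmod (T u))\<^sup>2" by linarith
  qed
  also have "h2_norm T \<le> op_dist (comp_op ?\<phi>) R"
    unfolding op_dist_def T_def using hH(2)[of J] h1 by (intro SUP_upper) auto
  finally show "ereal (exp (- ((22 + 1 / (2 * \<theta>)) * ?d) * L)) \<le> op_dist (comp_op ?\<phi>) R" unfolding \<epsilon>_def .
qed

section \<open>From grid sizes to stretched exponentials in n\<close>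

lemma powr_root_bounds:
  fixes d n :: nat
  assumes d: "0 < d" and n: "0 < n"
  shows "\<exists>L>0. n \<le> (L\<^sup>2) ^ d \<and> real L \<le> real n powr (1 / (2 * d)) + 1"
    and "\<exists>L. (8 * L\<^sup>2) ^ d < n \<and> real n powr (1 / (2 * d)) \<le> 3 * (real L + 1)"
proof -
  have root: "real n powr (1 / (2 * d)) \<le> x \<longleftrightarrow> real n \<le> (x\<^sup>2) ^ d" if x: "0 < x" for x :: real
  proof -
    have "real n powr (1 / (2 * d)) \<le> x \<longleftrightarrow> (real n powr (1 / (2 * d))) ^ (2 * d) \<le> x ^ (2 * d)"
      using x d by (subst power_mono_iff) auto
    also have "(real n powr (1 / (2 * d))) ^ (2 * d) = real n"
      using n d by (simp add: powr_powr flip: powr_realpow)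
    finally show ?thesis by (simp add: power_mult)
  qed
  \<comment> \<open>Rounding up gives a grid of at least n points, as the lower bound
    requires.\<close>
  define L where "L = nat \<lceil>real n powr (1 / (2 * d))\<rceil>"
  have pos: "0 < real n powr (1 / (2 * d))" using n by simp
  have L: "real n powr (1 / (2 * d)) \<le> real L" "real L \<le> real n powr (1 / (2 * d)) + 1"
    unfolding L_def using pos by linarith+
  have L0: "0 < L" using L(1) pos by linarith
  have "real n \<le> real ((L\<^sup>2) ^ d)" using root[of "real L"] L(1) L0 by simp
  then have "n \<le> (L\<^sup>2) ^ d" by (simp only: of_nat_le_iff)
  then show "\<exists>L>0. n \<le> (L\<^sup>2) ^ d \<and> real L \<le> real n powr (1 / (2 * d)) + 1" using L L0 by blast
  have "n \<le> (8 * n\<^sup>2) ^ d"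
  proof -
    have "n \<le> 8 * n\<^sup>2" by (simp add: power2_eq_square)
    also have "\<dots> \<le> (8 * n\<^sup>2) ^ d" using d n by (intro self_le_power) auto
    finally show ?thesis .
  qed
  \<comment> \<open>k is the last index before (8 k^2)^d reaches n, possibly 0; the factor 3 below
    comes from 8 \<le> 3^2.\<close>
  then have "\<exists>k<n. (\<forall>i\<le>k. \<not> n \<le> (8 * i\<^sup>2) ^ d) \<and> n \<le> (8 * (Suc k)\<^sup>2) ^ d"
    by (rule ex_least_nat_less) (use n d in \<open>simp add: zero_power\<close>)
  then obtain k where k: "\<forall>i\<le>k. \<not> n \<le> (8 * i\<^sup>2) ^ d" "n \<le> (8 * (Suc k)\<^sup>2) ^ d" by blast
  have "real n \<le> real ((8 * (Suc k)\<^sup>2) ^ d)" using k(2) by (rule of_nat_mono)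
  also have "\<dots> = (8 * (real k + 1)\<^sup>2) ^ d" by (simp add: add.commute)
  also have "\<dots> \<le> ((3 * (real k + 1))\<^sup>2) ^ d"
  proof -
    have "8 * x\<^sup>2 \<le> (3 * x)\<^sup>2" for x :: real by (simp add: power_mult_distrib)
    then show ?thesis by (rule power_mono) simp
  qed
  finally have "real n powr (1 / (2 * d)) \<le> 3 * (real k + 1)" by (subst root) auto
  then show "\<exists>L. (8 * L\<^sup>2) ^ d < n \<and> real n powr (1 / (2 * d)) \<le> 3 * (real L + 1)"
    using k(1)[rule_format, of k] by (intro exI[of _ k]) auto
qed

lemma stretched_exponential_summable:
  assumes "0 < c" "0 < \<alpha>" shows "summable (\<lambda>n. exp (- c * real (Suc n) powr \<alpha>))"
proof (rule summable_comparison_test_bigo)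
  have "(\<lambda>n. exp (- c * real (Suc n) powr \<alpha>)) \<in> O(\<lambda>n. 1 / real n ^ 2)"
    using assms by real_asymp
  then show "(\<lambda>n. exp (- c * real (Suc n) powr \<alpha>)) \<in> O(\<lambda>n. inverse (real n ^ 2))" by (simp add: inverse_eq_divide)
  show "summable (\<lambda>n. norm (inverse (real n ^ 2)))" using inverse_power_summable[of 2] by simp
qed

lemma approx_num_multi_lens_bounds:
  assumes \<theta>: "0 < \<theta>" "\<theta> < 1"
  obtains a b a' b' where "a > 0" "b > 0" "a' > 0" "b' > 0"
    "\<And>n::nat. 1 \<le> n \<Longrightarrow> ereal (a' * exp (- b' * real n powr (1 / (2 * real CARD('n)))))
        \<le> approx_num (comp_op (multi_lens \<theta> :: complex^'n::finite \<Rightarrow> complex^'n)) n"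
    "\<And>n::nat. 1 \<le> n \<Longrightarrow> approx_num (comp_op (multi_lens \<theta> :: complex^'n \<Rightarrow> complex^'n)) n
        \<le> ereal (a * exp (- b * real n powr (1 / (2 * real CARD('n) + 1))))"
proof -
  let ?T = "comp_op (multi_lens \<theta> :: complex^'n \<Rightarrow> complex^'n)"
  obtain K b :: real where K: "0 < K" "0 < b" and up: "\<And>(L::nat) n. (8 * L\<^sup>2) ^ CARD('n) < n \<Longrightarrow> approx_num ?T n \<le> ereal (K * exp (- b * L))"
    by (rule approx_num_multi_lens_upper[OF \<theta>, where 'n = 'n]) (rule that)
  define B where "B = (22 + 1 / (2 * \<theta>)) * CARD('n)"
  have B: "0 < B" unfolding B_def using \<theta> by (simp add: add_pos_pos)
  show thesis
  proof (rule that)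
    \<comment> \<open>Rounding n powr (1 / (2 d)) to an integer costs the factors exp (- B) and exp
      b, and the 3 in the choice of L turns b into b / 3.\<close>
    show "0 < K * exp b" "0 < b / 3" "0 < exp (- B)" "0 < B" using K B by simp_all
    fix n :: nat assume n: "1 \<le> n"
    obtain L :: nat where L: "0 < L" "n \<le> (L\<^sup>2) ^ CARD('n)" "real L \<le> real n powr (1 / (2 * CARD('n))) + 1"
      using powr_root_bounds(1)[of "CARD('n)" n] n by auto
    have "exp (- B) * exp (- B * real n powr (1 / (2 * real CARD('n)))) = exp (- B * (real n powr (1 / (2 * CARD('n))) + 1))"
      by (simp add: algebra_simps flip: exp_add)
    also have "\<dots> \<le> exp (- B * L)" using L(3) B by simp
    finally have "ereal (exp (- B) * exp (- B * real n powr (1 / (2 * real CARD('n))))) \<le> ereal (exp (- B * L))"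
      by (simp only: ereal_less_eq)
    also have "\<dots> \<le> approx_num ?T n"
      unfolding B_def by (rule approx_num_multi_lens_lower[OF \<theta> L(1,2)])
    finally show "ereal (exp (- B) * exp (- B * real n powr (1 / (2 * real CARD('n))))) \<le> approx_num ?T n" .
    obtain L :: nat where L: "(8 * L\<^sup>2) ^ CARD('n) < n" "real n powr (1 / (2 * CARD('n))) \<le> 3 * (real L + 1)"
      using powr_root_bounds(2)[of "CARD('n)" n] n by auto
    \<comment> \<open>For n \<ge> 1 the power with exponent 1 / (2 d + 1) is at most the one with 1
      / (2 d), so the bound weakens to the stated one.\<close>
    have "real n powr (1 / (2 * real CARD('n) + 1)) \<le> real n powr (1 / (2 * CARD('n)))"
      using n by (intro powr_mono divide_left_mono) auto
    then have "b * (real n powr (1 / (2 * real CARD('n) + 1))) \<le> b * (3 * (real L + 1))"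
      using L(2) K by (intro mult_left_mono) auto
    then have "- b * L \<le> b + - (b / 3) * real n powr (1 / (2 * real CARD('n) + 1))" by (simp add: algebra_simps)
    then have "exp (- b * L) \<le> exp b * exp (- (b / 3) * real n powr (1 / (2 * real CARD('n) + 1)))"
      by (simp only: exp_add[symmetric] exp_le_cancel_iff)
    then have "K * exp (- b * L) \<le> K * exp b * exp (- (b / 3) * real n powr (1 / (2 * real CARD('n) + 1)))"
      using K by simp
    then have "ereal (K * exp (- b * L)) \<le> ereal (K * exp b * exp (- (b / 3) * real n powr (1 / (2 * real CARD('n) + 1))))"
      by (simp only: ereal_less_eq)
    with up[OF L(1)] show "approx_num ?T n \<le> ereal (K * exp b * exp (- (b / 3) * real n powr (1 / (2 * real CARD('n) + 1))))"
      by (rule order_trans)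
  qed
qed

theorem theorem6p1:
  fixes \<theta> :: real
  assumes "0 < \<theta>" and "\<theta> < 1"
  shows "(\<exists>a b a' b'. a > 0 \<and> b > 0 \<and> a' > 0 \<and> b' > 0 \<and>
            (\<forall>n::nat\<ge>1.
               ereal (a' * exp (- b' * real n powr (1 / (2 * real CARD('n)))))
                 \<le> approx_num (comp_op (multi_lens \<theta> :: complex^'n \<Rightarrow> complex^'n)) n \<and>
               approx_num (comp_op (multi_lens \<theta> :: complex^'n \<Rightarrow> complex^'n)) n
                 \<le> ereal (a * exp (- b * real n powr (1 / (2 * real CARD('n) + 1)))))) \<and>
         gamma_minus (comp_op (multi_lens \<theta> :: complex^'n \<Rightarrow> complex^'n)) = 0 \<and>
         (\<forall>p>0. schatten (comp_op (multi_lens \<theta> :: complex^'n \<Rightarrow> complex^'n)) p)"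
proof -
  let ?T = "comp_op (multi_lens \<theta> :: complex^'n \<Rightarrow> complex^'n)"
  let ?d = "real CARD('n)"
  obtain a b a' b' where pos: "a > 0" "b > 0" "a' > 0" "b' > 0"
    and lo: "\<And>n::nat. 1 \<le> n \<Longrightarrow> ereal (a' * exp (- b' * real n powr (1 / (2 * ?d)))) \<le> approx_num ?T n"
    and up: "\<And>n::nat. 1 \<le> n \<Longrightarrow> approx_num ?T n \<le> ereal (a * exp (- b * real n powr (1 / (2 * ?d + 1))))"
    by (rule approx_num_multi_lens_bounds[OF assms, where 'n = 'n]) (rule that)
  have d: "1 \<le> ?d" by (simp add: Suc_leI)
  define s where "s = (\<lambda>n. real_of_ereal (approx_num ?T n))"
  \<comment> \<open>Caught between two real bounds the approximation numbers are finite, so passing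
    to reals loses nothing for n \<ge> 1.\<close>
  have fin: "approx_num ?T n = ereal (s n)" if "1 \<le> n" for n
    using lo[OF that] up[OF that] unfolding s_def by (cases "approx_num ?T n") auto
  have s_lo: "a' * exp (- b' * real n powr (1 / (2 * ?d))) \<le> s n"
    and s_up: "s n \<le> a * exp (- b * real n powr (1 / (2 * ?d + 1)))" if "1 \<le> n" for n
    using lo[OF that] up[OF that] unfolding fin[OF that] by simp_all
  have s_pos: "0 < s n" if "1 \<le> n" for n
    using less_le_trans[OF _ s_lo[OF that]] pos by simp
  \<comment> \<open>From above the quotient is of order n powr (1 / (2 d) - 1 / d), which tends to
    0; from below it suffices that ln (1 / s n) is bounded below.\<close>
  have "((\<lambda>n. ln (1 / s n) / real n powr (1 / ?d)) \<longlongrightarrow> 0) sequentially"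
  proof (rule tendsto_sandwich)
    have up_le: "- ln a + b * real n powr (1 / (2 * ?d + 1)) \<le> ln (1 / s n)" if "1 \<le> n" for n
    proof -
      have "ln (s n) \<le> ln (a * exp (- b * real n powr (1 / (2 * ?d + 1))))" using s_up[OF that] s_pos[OF that] by (intro ln_mono) auto
      then show ?thesis using pos s_pos[OF that] by (simp add: ln_mult ln_div)
    qed
    show "\<forall>\<^sub>F n in sequentially. - ln a / real n powr (1 / ?d) \<le> ln (1 / s n) / real n powr (1 / ?d)"
      using eventually_ge_at_top[of 1]
    proof eventually_elim
      case (elim n)
      have "0 \<le> b * real n powr (1 / (2 * ?d + 1))" using pos by simp
      then have "- ln a \<le> ln (1 / s n)" using up_le[OF elim] by linarith
      then show ?case by (intro divide_right_mono) auto
    qed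
    show "\<forall>\<^sub>F n in sequentially. ln (1 / s n) / real n powr (1 / ?d) \<le> (- ln a' + b' * real n powr (1 / (2 * ?d))) / real n powr (1 / ?d)"
      using eventually_ge_at_top[of 1]
    proof eventually_elim
      case (elim n)
      have "ln (a' * exp (- b' * real n powr (1 / (2 * ?d)))) \<le> ln (s n)" using s_lo[OF elim] s_pos[OF elim] pos by (intro ln_mono) auto
      then have "ln (1 / s n) \<le> - ln a' + b' * real n powr (1 / (2 * ?d))"
        using pos s_pos[OF elim] by (simp add: ln_mult ln_div)
      then show ?case by (intro divide_right_mono) auto
    qed
    show "(\<lambda>n. - ln a / real n powr (1 / ?d)) \<longlonglongrightarrow> 0" using d by real_asymp
    have "(\<lambda>n. - ln a' / real n powr (1 / ?d) + b' * real n powr (1 / (2 * ?d) - 1 / ?d)) \<longlonglongrightarrow> 0 + 0"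
    proof (rule tendsto_add)
      show "(\<lambda>n. - ln a' / real n powr (1 / ?d)) \<longlonglongrightarrow> 0" using d by real_asymp
      have "1 / (2 * ?d) - 1 / ?d < 0" using d by (simp add: field_simps)
      then have "(\<lambda>n. real n powr (1 / (2 * ?d) - 1 / ?d)) \<longlonglongrightarrow> 0"
        by (intro tendsto_neg_powr filterlim_real_sequentially)
      then show "(\<lambda>n. b' * real n powr (1 / (2 * ?d) - 1 / ?d)) \<longlonglongrightarrow> 0" by (rule tendsto_mult_right_zero)
    qed
    then show "(\<lambda>n. (- ln a' + b' * real n powr (1 / (2 * ?d))) / real n powr (1 / ?d)) \<longlonglongrightarrow> 0"
      by (simp only: add_divide_distrib powr_diff times_divide_eq_right add_0)
  qed
  then have "((\<lambda>n. ereal (ln (1 / s n) / real n powr (1 / ?d))) \<longlongrightarrow> ereal 0) sequentially"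
    by (rule tendsto_ereal)
  then have "gamma_minus ?T = 0"
    unfolding gamma_minus_def s_def zero_ereal_def by (intro lim_imp_Liminf) auto
  moreover have "schatten ?T p" if p: "0 < p" for p
    unfolding schatten_def
  proof (intro conjI allI impI)
    show "approx_num ?T n < \<infinity>" if "1 \<le> n" for n unfolding fin[OF that] by simp
    \<comment> \<open>Raising to the power p only replaces b by b p in the exponent and a by its
      p-th power.\<close>
    have "summable (\<lambda>n. a powr p * exp (- (b * p) * real (Suc n) powr (1 / (2 * ?d + 1))))"
      using pos p d by (intro summable_mult stretched_exponential_summable) auto
    then have "summable (\<lambda>n. s (Suc n) powr p)"
    proof (rule summable_comparison_test')
      fix n :: nat
      have "s (Suc n) powr p \<le> (a * exp (- b * real (Suc n) powr (1 / (2 * ?d + 1)))) powr p"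
        using s_up[of "Suc n"] s_pos[of "Suc n"] p by (intro powr_mono2) auto
      also have "\<dots> = a powr p * exp (- (b * p) * real (Suc n) powr (1 / (2 * ?d + 1)))"
        using pos by (simp add: powr_mult exp_powr_real mult_ac)
      finally show "norm (s (Suc n) powr p) \<le> a powr p * exp (- (b * p) * real (Suc n) powr (1 / (2 * ?d + 1)))" by simp
    qed
    then show "summable (\<lambda>n. real_of_ereal (approx_num ?T (Suc n)) powr p)" unfolding s_def .
  qed
  moreover have "\<exists>a b a' b'. a > 0 \<and> b > 0 \<and> a' > 0 \<and> b' > 0 \<and>
      (\<forall>n::nat\<ge>1. ereal (a' * exp (- b' * real n powr (1 / (2 * ?d)))) \<le> approx_num ?T n \<and>
         approx_num ?T n \<le> ereal (a * exp (- b * real n powr (1 / (2 * ?d + 1)))))"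
    by (rule exI[of _ a], rule exI[of _ b], rule exI[of _ a'], rule exI[of _ b'], intro conjI allI impI pos lo up)
  ultimately show ?thesis by (intro conjI allI impI)
qed

end
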